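(* Let $K$ be a convex body in $\mathbb{R}^d$, and let $\mathcal F=\{\lambda_1 K,\lambda_2 K,\dots\}$ with $\lambda_i>0$ for all $i$ be a (countably infinite) family of homothets of $K$ satisfying \[\sum_{i=1}^{\infty}\lambda_i^d=\infty.\] Let $\Lambda:=\{\lambda_1,\lambda_2,\ldots\}$. (a) If $\Lambda$ is bounded and has a limit point other than zero, then $\mathcal F$ permits a translative covering of $\mathbb{R}^d$ of density $\vartheta(K)$. (b) If $\Lambda$ is bounded and has no limit point other than zero, then $\mathcal F$ permits a translative covering of $\mathbb{R}^d$ of density one. (c) If $\Lambda$ is unbounded, then $\mathcal F$ permits a translative covering of $\mathbb{R}^d$ with maximum multiplicity $4d$, that is, one in which no point of $\mathbb{R}^d$ is covered by more than $4d$ of the translated sets.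
   Context: A convex body is a compact convex subset of $\mathbb{R}^d$ with nonempty interior. For a family $\mathcal F$ of sets in $\mathbb{R}^d$ and $A\subseteq\mathbb{R}^d$, we say $\mathcal F$ permits a translative covering of $A$ (with density $\vartheta$) if one can select a translation vector $x_F\in\mathbb{R}^d$ for each member $F$ of $\mathcal F$ such that $A\subseteq\bigcup_{F\in\mathcal F}(x_F+F)$ (and the density of this covering is $\vartheta$). The density of a covering of $\mathbb{R}^d$ by sets $\{C_i\}$ is $\limsup_{r\to\infty}\frac{\sum_{i:\,C_i\subseteq rB}\operatorname{vol}(C_i)}{\operatorname{vol}(rB)}$, where $B$ is the Euclidean unit ball. $\vartheta(K)$, the translative covering density of $K$, is the minimum (infimum) density of a covering of $\mathbb{R}^d$ by translates of $K$. *)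

theory Defs
  imports "HOL-Analysis.Analysis"
begin

definition convex_body :: "'a::euclidean_space set \<Rightarrow> bool" where
  "convex_body K \<longleftrightarrow> compact K \<and> convex K \<and> interior K \<noteq> {}"

definition covers :: "(nat \<Rightarrow> 'a set) \<Rightarrow> 'a set \<Rightarrow> bool" where
  "covers C A \<longleftrightarrow> A \<subseteq> (\<Union>i. C i)"

definition covering_density :: "(nat \<Rightarrow> 'a::euclidean_space set) \<Rightarrow> ennreal" where
  "covering_density C =
     Limsup at_top (\<lambda>r::real.
       (\<Sum>i. if C i \<subseteq> cball 0 r then emeasure lebesgue (C i) else 0)
         / emeasure lebesgue (cball (0::'a) r))"

definition transl_homothet :: "'a::real_vector \<Rightarrow> real \<Rightarrow> 'a set \<Rightarrow> 'a set" where
  "transl_homothet x t K = (\<lambda>y. x + t *\<^sub>R y) ` K"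

definition transl_cover_density :: "'a::euclidean_space set \<Rightarrow> ennreal" where
  "transl_cover_density K =
     Inf {covering_density (\<lambda>i. transl_homothet (x i) 1 K) | x :: nat \<Rightarrow> 'a.
            covers (\<lambda>i. transl_homothet (x i) 1 K) UNIV}"

end

theory Submission
  imports Defs "HOL-Real_Asymp.Real_Asymp"
begin

text \<open>
  (a), (b): space is tiled by half-open cubes whose sides tend to infinity but are of order at most
  the square root of their distance from the origin. If every large cube can be covered, using only
  members of arbitrarily large index, with total volume between \<open>\<theta>\<close> and \<open>\<theta> + e\<close> times its own, then
  treating the cubes one after the other yields density exactly \<open>\<theta>\<close>; an unused member is dropped at
  a cube of its own, where its bounded volume is negligible. In (a) a cube is covered economically
  by translates of \<open>K\<close> by averaging over the position of the cube in a good covering, and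
  the translates are replaced by members of nearly equal size; their number is rounded up so that
  the lower bound holds as well. In (b) the sizes tend to zero, so a cube can be tiled exactly by
  dyadic cubes comparable to the members. Packing one member into each of these leaves a fixed
  fraction less of the cube uncovered, and covering the rest by small cubes shows that an
  admissible constant \<open>\<alpha>\<close> may be replaced by about \<open>c + (1 - c) \<alpha>\<close>; hence every \<open>\<alpha> > 1\<close> is admissible.

  (c): near the point where an inscribed ball touches the boundary of \<open>K\<close>, a huge homothet of \<open>K\<close>
  looks like a half-space. The normals at such points positively span the space, so at most \<open>2d\<close>
  of these half-spaces have a bounded complement, and no point lies in all of them. Concentric
  shells are thus covered in stages by at most \<open>2d\<close> members with multiplicity at most \<open>2d - 1\<close>,
  and only consecutive stages overlap. The remaining members are placed pairwise disjointly, which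
  gives multiplicity at most \<open>2(2d - 1) + 1\<close>.
\<close>

section \<open>Half-open cubes and homothets\<close>

text \<open>Every member of the family must receive a position, so the leftover members have to be
  made harmless: in (a) and (b) they vanish in the density, in (c) they add at most one to the
  multiplicity. The tiles have to grow because a cube can be covered economically only above a
  threshold that depends on the permitted error; they must grow more slowly than their distance from
  the origin because otherwise the tiles crossing a large sphere would carry a positive share of the
  volume. The square root is a convenient compromise. In (b) the map sending \<alpha> to c + (1 - c)
  \<alpha> has 1 as its only fixed point; working with the infimum of all admissible constants
  replaces an iteration with accumulating errors. In (c) a corner of \<open>K\<close> would look
  like a cone under magnification; hence only boundary points touched by a ball inside
  \<open>K\<close> are used.\<close>

definition hcube :: "'a::euclidean_space \<Rightarrow> real \<Rightarrow> 'a set" where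
  "hcube p h = {x. \<forall>b\<in>Basis. p \<bullet> b \<le> x \<bullet> b \<and> x \<bullet> b < p \<bullet> b + h}"

text \<open>A grid cell is represented by its lower corner, so a family of cells is a set of points
  and the cells meeting a set form its image under \<open>gcorner\<close>.\<close>

definition gcorner :: "'a::euclidean_space \<Rightarrow> real \<Rightarrow> 'a \<Rightarrow> 'a" where
  "gcorner p h x = p + (\<Sum>b\<in>Basis. (h * of_int \<lfloor>(x \<bullet> b - p \<bullet> b) / h\<rfloor>) *\<^sub>R b)"

lemma hcube_borel [measurable]: "hcube p h \<in> sets borel"
proof -
  have "hcube p h = (\<Inter>b\<in>Basis. {x. p \<bullet> b \<le> x \<bullet> b} \<inter> {x. x \<bullet> b < p \<bullet> b + h})"
    by (auto simp: hcube_def)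
  also have "\<dots> \<in> sets borel"
    by (intro sets.finite_INT) auto
  finally show ?thesis .
qed

lemma box_subset_hcube: "box p (p + h *\<^sub>R One) \<subseteq> hcube p h"
  by (auto simp: hcube_def box_def inner_add_left less_imp_le)

lemma hcube_subset_cbox: "hcube p h \<subseteq> cbox p (p + h *\<^sub>R One)"
  by (auto simp: hcube_def cbox_def inner_add_left less_imp_le)

lemma bounded_hcube: "bounded (hcube p h)"
  using bounded_subset[OF bounded_cbox hcube_subset_cbox] .

lemma lmeasurable_hcube [simp]: "hcube p h \<in> lmeasurable"
  by (rule bounded_set_imp_lmeasurable[OF bounded_hcube]) simp

lemma measure_cube: 
  fixes p :: "'a::euclidean_space"
  assumes "h \<ge> 0"
  shows "measure lebesgue (cbox p (p + h *\<^sub>R One)) = h ^ DIM('a)"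
    "measure lebesgue (box p (p + h *\<^sub>R One)) = h ^ DIM('a)"
proof -
  have le: "\<And>b. b \<in> Basis \<Longrightarrow> p \<bullet> b \<le> (p + h *\<^sub>R One) \<bullet> b"
    using assms by (auto simp: inner_add_left)
  have "(\<Prod>b\<in>Basis. (p + h *\<^sub>R One - p) \<bullet> b) = h ^ DIM('a)"
    by simp
  with le show "measure lebesgue (cbox p (p + h *\<^sub>R One)) = h ^ DIM('a)"
    by (simp add: measure_lborel_cbox)
  from le show "measure lebesgue (box p (p + h *\<^sub>R One)) = h ^ DIM('a)"
    by (simp add: measure_lborel_box)
qed

lemma measure_hcube [simp]:
  fixes p :: "'a::euclidean_space"
  assumes "h \<ge> 0"
  shows "measure lborel (hcube p h) = h ^ DIM('a)"
proof (rule antisym)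
  show "measure lborel (hcube p h) \<le> h ^ DIM('a)"
    using measure_mono_fmeasurable[OF hcube_subset_cbox, of p h lborel] measure_cube(1)[OF assms, of p]
    by (simp add: fmeasurable_cbox)
  show "h ^ DIM('a) \<le> measure lborel (hcube p h)"
    using measure_mono_fmeasurable[OF box_subset_hcube, of p h lborel] measure_cube(2)[OF assms, of p]
      lmeasurable_hcube[of p h]
    by (simp add: fmeasurable_def)
qed

lemma dist_hcube:
  fixes p :: "'a::euclidean_space" and h :: real
  assumes "x \<in> hcube p h" "y \<in> hcube p h"
  shows "dist x y \<le> DIM('a) * h"
proof -
  have "norm (x - y) \<le> (\<Sum>b\<in>Basis. \<bar>(x - y) \<bullet> b\<bar>)" by (rule norm_le_l1)
  also have "\<dots> \<le> (\<Sum>b\<in>(Basis::'a set). h)"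
    using assms by (intro sum_mono) (force simp: hcube_def inner_diff_left abs_if)
  finally show ?thesis by (simp add: dist_norm)
qed

lemma hcube_corner: "h > 0 \<Longrightarrow> p \<in> hcube p h"
  by (simp add: hcube_def)

lemma gcorner_inner:
  "b \<in> Basis \<Longrightarrow> gcorner p h x \<bullet> b = p \<bullet> b + h * of_int \<lfloor>(x \<bullet> b - p \<bullet> b) / h\<rfloor>"
  by (simp add: gcorner_def inner_add_left inner_sum_left inner_Basis if_distrib sum.delta cong: if_cong)

text \<open>Cell membership becomes equality of integer coordinates; the cells are thus the classes
  of an equivalence relation, which gives their disjointness at once.\<close>

lemma mem_gcell_iff:
  assumes "h > 0"
  shows "y \<in> hcube (gcorner p h x) h \<longleftrightarrow>
    (\<forall>b\<in>Basis. \<lfloor>(y \<bullet> b - p \<bullet> b) / h\<rfloor> = \<lfloor>(x \<bullet> b - p \<bullet> b) / h\<rfloor>)"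
  unfolding hcube_def mem_Collect_eq floor_eq_iff
  using assms by (intro ball_cong refl) (auto simp: gcorner_inner field_simps)

lemma gcell_self: "h > 0 \<Longrightarrow> x \<in> hcube (gcorner p h x) h"
  by (simp add: mem_gcell_iff)

lemma gcorner_eq:
  assumes "h > 0" "y \<in> hcube (gcorner p h x) h"
  shows "gcorner p h y = gcorner p h x"
  using assms unfolding mem_gcell_iff[OF assms(1)] by (simp add: gcorner_def)

lemma disjoint_gcells:
  assumes "h > 0"
  shows "disjoint_family_on (\<lambda>g. hcube g h) (range (gcorner p h))"
proof -
  have "g = g'" if g: "g \<in> range (gcorner p h)" "g' \<in> range (gcorner p h)" "y \<in> hcube g h" "y \<in> hcube g' h"
    for g g' y :: 'a
    using g gcorner_eq[OF assms, of y p] by (metis rangeE)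
  then show ?thesis unfolding disjoint_family_on_def by blast
qed

lemma finite_gcorner:
  fixes S :: "'a::euclidean_space set"
  assumes "h > 0" "bounded S"
  shows "finite (gcorner p h ` S)"
proof -
  obtain R where R: "\<And>x. x \<in> S \<Longrightarrow> norm x \<le> R" using assms(2) by (auto simp: bounded_iff)
  define N where "N = \<lceil>(R + norm p) / h\<rceil> + 1"
  let ?F = "Basis \<rightarrow>\<^sub>E {-N..N}"
  let ?g = "\<lambda>f. p + (\<Sum>b\<in>Basis. (h * of_int (f b)) *\<^sub>R b)"
  have "gcorner p h x \<in> ?g ` ?F" if "x \<in> S" for x
  proof (rule image_eqI)
    show "gcorner p h x = ?g (restrict (\<lambda>b. \<lfloor>(x \<bullet> b - p \<bullet> b) / h\<rfloor>) Basis)"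
      by (simp add: gcorner_def)
    have "\<lfloor>(x \<bullet> b - p \<bullet> b) / h\<rfloor> \<in> {-N..N}" if b: "b \<in> Basis" for b
    proof -
      have "\<bar>x \<bullet> b\<bar> \<le> R" "\<bar>p \<bullet> b\<bar> \<le> norm p"
        using Basis_le_norm[OF b] R[OF \<open>x \<in> S\<close>] order_trans by blast+
      then have "\<bar>x \<bullet> b - p \<bullet> b\<bar> \<le> R + norm p" by linarith
      then have "\<bar>(x \<bullet> b - p \<bullet> b) / h\<bar> \<le> (R + norm p) / h" 
        using assms(1) by (simp add: divide_right_mono)
      then show ?thesis unfolding N_def atLeastAtMost_iff by linarith
    qed
    then show "restrict (\<lambda>b. \<lfloor>(x \<bullet> b - p \<bullet> b) / h\<rfloor>) Basis \<in> ?F" by auto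
  qed
  moreover have "finite (?g ` ?F)" by (intro finite_imageI finite_PiE) auto
  ultimately show ?thesis by (meson finite_subset image_subsetI)
qed

lemma gcell_subset_hcube:
  assumes "h > 0" "x \<in> hcube p (real n * h)"
  shows "hcube (gcorner p h x) h \<subseteq> hcube p (real n * h)"
proof
  fix y assume y: "y \<in> hcube (gcorner p h x) h"
  have "p \<bullet> b \<le> y \<bullet> b \<and> y \<bullet> b < p \<bullet> b + real n * h" if b: "b \<in> Basis" for b
  proof -
    have eq: "\<lfloor>(y \<bullet> b - p \<bullet> b) / h\<rfloor> = \<lfloor>(x \<bullet> b - p \<bullet> b) / h\<rfloor>"
      using y b assms(1) by (simp add: mem_gcell_iff)
    have "0 \<le> (x \<bullet> b - p \<bullet> b) / h" "(x \<bullet> b - p \<bullet> b) / h < real_of_int (int n)"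
      using assms b by (auto simp: hcube_def field_simps)
    then have "0 \<le> \<lfloor>(y \<bullet> b - p \<bullet> b) / h\<rfloor>" "\<lfloor>(y \<bullet> b - p \<bullet> b) / h\<rfloor> < int n"
      unfolding eq by (simp_all only: zero_le_floor floor_less_iff)
    then have "0 \<le> (y \<bullet> b - p \<bullet> b) / h" "(y \<bullet> b - p \<bullet> b) / h < real n"
      by (simp_all add: floor_less_iff)
    then show ?thesis using assms(1) by (simp add: field_simps)
  qed
  then show "y \<in> hcube p (real n * h)" by (simp add: hcube_def)
qed

lemma hcube_subdivide:
  fixes p :: "'a::euclidean_space"
  assumes "h > 0"
  obtains G where "finite G" "disjoint_family_on (\<lambda>g. hcube g h) G"
    "hcube p (real n * h) = (\<Union>g\<in>G. hcube g h)"
proof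
  let ?G = "gcorner p h ` hcube p (real n * h)"
  show "finite ?G" using assms bounded_hcube by (rule finite_gcorner)
  show "disjoint_family_on (\<lambda>g. hcube g h) ?G"
    using disjoint_gcells[OF assms] by (rule disjoint_family_on_mono[rotated]) auto
  show "hcube p (real n * h) = (\<Union>g\<in>?G. hcube g h)"
  proof
    show "hcube p (real n * h) \<subseteq> (\<Union>g\<in>?G. hcube g h)"
      using gcell_self[OF assms] by (auto intro!: bexI)
    show "(\<Union>g\<in>?G. hcube g h) \<subseteq> hcube p (real n * h)"
      by (rule UN_least) (use gcell_subset_hcube[OF assms] in auto)
  qed
qed

lemma measure_disjoint_hcubes:
  fixes q :: "'i \<Rightarrow> 'a::euclidean_space"
  assumes "finite I" "disjoint_family_on (\<lambda>i. hcube (q i) (s i)) I" "\<And>i. i \<in> I \<Longrightarrow> s i \<ge> 0"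
  shows "measure lebesgue (\<Union>i\<in>I. hcube (q i) (s i)) = (\<Sum>i\<in>I. s i ^ DIM('a))"
proof -
  have "measure lebesgue (\<Union>i\<in>I. hcube (q i) (s i)) = (\<Sum>i\<in>I. measure lebesgue (hcube (q i) (s i)))"
    by (rule measure_finite_Union) (use assms fmeasurableD[OF lmeasurable_hcube] fmeasurableD2[OF lmeasurable_hcube] in auto)
  with assms show ?thesis by simp
qed

text \<open>Outer regularity encloses \<open>W\<close> in an open set of almost the same measure. By
  compactness \<open>W\<close> keeps a positive distance from the complement of that set, so the
  cells of a fine grid that meet \<open>W\<close> stay inside it.\<close>

lemma grid_cover_compact:
  fixes W :: "'a::euclidean_space set"
  assumes "compact W" "e > 0"
  obtains h G where "h > 0" "finite G" "W \<subseteq> (\<Union>g\<in>G. hcube g h)"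
    "real (card G) * h ^ DIM('a) \<le> measure lebesgue W + e"
proof -
  have WL: "W \<in> lmeasurable" using assms(1) by (rule lmeasurable_compact)
  obtain U where U: "open U" "W \<subseteq> U" "U - W \<in> lmeasurable" "emeasure lebesgue (U - W) < ennreal e"
    using sets_lebesgue_outer_open[OF fmeasurableD[OF WL] assms(2)] by blast
  have UL: "U \<in> lmeasurable"
    using fmeasurable.Un[OF WL U(3)] U(2) by (simp add: Un_absorb1)
  have "measure lebesgue U \<le> measure lebesgue W + measure lebesgue (U - W)"
    using measure_Un_le[of W lebesgue "U - W"] U WL by (simp add: Un_absorb1 fmeasurableD)
  moreover have "measure lebesgue (U - W) \<le> e"
    using U(4) assms(2) by (simp add: measure_def enn2real_leI less_imp_le)
  ultimately have mU: "measure lebesgue U \<le> measure lebesgue W + e" by linarith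
  obtain d where d: "d > 0" "\<And>x y. x \<in> W \<Longrightarrow> dist x y < d \<Longrightarrow> y \<in> U"
  proof (cases "W = {}")
    case False
    then show ?thesis using that compact_subset_open_imp_ball_epsilon_subset[OF assms(1) U(1,2)]
      by (metis UN_I mem_ball subsetD)
  qed (use that[of 1] in auto)
  \<comment> \<open>The diameter bound of \<open>dist_hcube\<close> then becomes d / 2.\<close>
  define h where "h = d / (2 * DIM('a))"
  have h: "h > 0" "DIM('a) * h < d" using d by (auto simp: h_def)
  let ?G = "gcorner 0 h ` W"
  have fin: "finite ?G" by (rule finite_gcorner[OF h(1)]) (rule compact_imp_bounded[OF assms(1)])
  have disj: "disjoint_family_on (\<lambda>g. hcube g h) ?G"
    using disjoint_gcells[OF h(1)] by (rule disjoint_family_on_mono[rotated]) auto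
  have sub: "(\<Union>g\<in>?G. hcube g h) \<subseteq> U"
  proof clarify
    fix x y assume "x \<in> W" "y \<in> hcube (gcorner 0 h x) h"
    then have "dist x y \<le> DIM('a) * h" using gcell_self[OF h(1)] by (intro dist_hcube) auto
    then show "y \<in> U" using d(2)[OF \<open>x \<in> W\<close>] h by auto
  qed
  have "real (card ?G) * h ^ DIM('a) = measure lebesgue (\<Union>g\<in>?G. hcube g h)"
    using measure_disjoint_hcubes[OF fin disj] h by simp
  also have "\<dots> \<le> measure lebesgue U"
    using sub U fin by (intro measure_mono_fmeasurable sets.finite_UN) (auto simp: UL)
  also note mU
  finally show ?thesis using that[OF h(1) fin] gcell_self[OF h(1)] by blast
qed

section \<open>Translated homothets and their volumes\<close>

lemma mem_transl_homothet:
  "t \<noteq> 0 \<Longrightarrow> y \<in> transl_homothet x t K \<longleftrightarrow> (y - x) /\<^sub>R t \<in> K"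
  unfolding transl_homothet_def image_iff by (auto simp: algebra_simps intro!: bexI[of _ "(y - x) /\<^sub>R t"])

lemma compact_transl_homothet:
  fixes K :: "'a::euclidean_space set"
  shows "compact K \<Longrightarrow> compact (transl_homothet x t K)"
  unfolding transl_homothet_def by (rule compact_affinity)

lemma transl_homothet_mono: "A \<subseteq> B \<Longrightarrow> transl_homothet x t A \<subseteq> transl_homothet x t B"
  by (auto simp: transl_homothet_def)

lemma measure_transl_homothet:
  fixes K :: "'a::euclidean_space set"
  shows "measure lebesgue (transl_homothet x t K) = \<bar>t\<bar> ^ DIM('a) * measure lebesgue K"
  using measure_lebesgue_affine[of t x K] by (simp add: transl_homothet_def add.commute)

lemma lmeasurable_transl_homothet:
  assumes "compact K" shows "transl_homothet x t K \<in> lmeasurable"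
  using compact_transl_homothet[OF assms] by (rule lmeasurable_compact)

lemma transl_homothet_hcube:
  assumes "t > 0"
  shows "transl_homothet x t (hcube q b) = hcube (x + t *\<^sub>R q) (t * b)"
  using assms by (auto simp: mem_transl_homothet hcube_def inner_diff_left inner_add_left field_simps)

lemma convex_body_measure_pos:
  assumes "convex_body K" shows "measure lebesgue K > 0"
proof -
  have K: "compact K" "interior K \<noteq> {}" using assms by (auto simp: convex_body_def)
  have "\<not> negligible K"
    using K(2) negligible_subset[OF _ interior_subset] open_not_negligible[OF open_interior] by blast
  then show ?thesis using K(1) by (metis lmeasurable_compact negligible_iff_measure zero_less_measure_iff)
qed

lemma convex_body_inner_hcube:
  fixes K :: "'a::euclidean_space set"
  assumes "convex_body K"
  obtains q a where "a > 0" "hcube q a \<subseteq> K"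
proof -
  obtain q e where q: "e > 0" "ball q e \<subseteq> K"
    using assms by (auto simp: convex_body_def mem_interior)
  define a where "a = e / (2 * DIM('a))"
  have a: "a > 0" "DIM('a) * a < e" using q by (auto simp: a_def)
  have "hcube q a \<subseteq> ball q e"
    using dist_hcube[OF hcube_corner[OF a(1)], of _ q] a by force
  then show ?thesis using that a q by blast
qed

lemma bounded_subset_hcube:
  fixes S :: "'a::euclidean_space set"
  assumes "bounded S"
  obtains q b where "b > 0" "S \<subseteq> hcube q b"
proof -
  obtain R where R: "R > 0" "\<And>x. x \<in> S \<Longrightarrow> norm x \<le> R" using assms by (auto simp: bounded_pos)
  have "S \<subseteq> hcube (-(R *\<^sub>R One)) (2 * R + 1)"
  proof
    fix x assume "x \<in> S"
    then have "\<bar>x \<bullet> b\<bar> \<le> R" if "b \<in> Basis" for b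
      using R(2) Basis_le_norm[OF that] order_trans by blast
    then show "x \<in> hcube (-(R *\<^sub>R One)) (2 * R + 1)"
      by (force simp: hcube_def abs_le_iff)
  qed
  then show ?thesis using that R by (metis add_pos_pos mult_2 zero_less_one)
qed

section \<open>From economical coverings of cubes to coverings of space\<close>

text \<open>The points of level n, those in [-2^n, 2^n)^d but in no smaller such cube, are cut by
  the grid of mesh 2^(n div 2). For n > 0 they have norm at least 2^(n-1), so halving the exponent
  makes the mesh of the order of at most the square root of the distance. The shell boundaries lie
  on the grids of both adjacent shells, hence no cell crosses one.\<close>

lemma dyadic_tiling:
  "\<exists>(q :: nat \<Rightarrow> 'a::euclidean_space) (h :: nat \<Rightarrow> real).
    (\<forall>k. h k \<ge> 1) \<and> disjoint_family (\<lambda>k. hcube (q k) (h k)) \<and>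
    (\<Union>k. hcube (q k) (h k)) = UNIV \<and>
    (\<forall>k. \<forall>y\<in>hcube (q k) (h k). (h k)\<^sup>2 \<le> 2 * norm y + 1) \<and>
    filterlim h at_top sequentially"
proof -
  define S :: "nat \<Rightarrow> 'a set" where "S n = {x. \<forall>b\<in>Basis. - (2 ^ n) \<le> x \<bullet> b \<and> x \<bullet> b < 2 ^ n}" for n
  define lev where "lev x = (LEAST n. x \<in> S n)" for x
  define f where "f x = (gcorner 0 (2 ^ (lev x div 2)) x, lev x)" for x
  define D :: "'a \<times> nat \<Rightarrow> 'a set" where "D i = hcube (fst i) (2 ^ (snd i div 2))" for i
  have S_mono: "S m \<subseteq> S n" if "m \<le> n" for m n
  proof -
    have "(2::real) ^ m \<le> 2 ^ n" using that by simp
    then show ?thesis unfolding S_def by (smt (verit) Collect_mono)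
  qed
  have ex: "\<exists>n. x \<in> S n" for x
  proof -
    obtain n where n: "norm x < 2 ^ n" using real_arch_pow[of 2 "norm x"] by auto
    have "\<bar>x \<bullet> b\<bar> < 2 ^ n" if "b \<in> Basis" for b using Basis_le_norm[OF that, of x] n by linarith
    then show ?thesis unfolding S_def by (intro exI[of _ n]) (force simp: abs_less_iff)
  qed
  have lev: "x \<in> S (lev x)" for x unfolding lev_def using ex by (rule LeastI_ex)
  have not_lev: "m < lev x \<Longrightarrow> x \<notin> S m" for x m unfolding lev_def by (rule not_less_Least)
  have self: "x \<in> D (f x)" for x by (simp add: D_def f_def gcell_self)
  \<comment> \<open>As 2^k is a multiple of 2^a, membership in \<open>S k\<close> depends only on
    the integer coordinates of the cell, so a cell lies entirely inside or entirely outside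
    \<open>S k\<close>.\<close>
  have S_cong: "y \<in> S k \<longleftrightarrow> x \<in> S k"
    if "y \<in> hcube (gcorner 0 (2 ^ a) x) (2 ^ a)" "a \<le> k" for x y :: 'a and a k
  proof -
    have eq: "(2::real) ^ k = of_int (2 ^ (k - a)) * 2 ^ a"
      using that(2) by (simp flip: power_add)
    have "- (2 ^ k) \<le> t \<and> t < 2 ^ k \<longleftrightarrow> - (2 ^ (k - a)) \<le> \<lfloor>t / 2 ^ a\<rfloor> \<and> \<lfloor>t / 2 ^ a\<rfloor> < 2 ^ (k - a)" for t :: real
      unfolding eq le_floor_iff floor_less_iff by (simp add: field_simps)
    then show ?thesis using that(1) unfolding S_def by (simp add: mem_gcell_iff)
  qed
  have f_eq: "f y = f x" if "y \<in> D (f x)" for x y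
  proof -
    let ?a = "lev x div 2"
    have y: "y \<in> hcube (gcorner 0 (2 ^ ?a) x) (2 ^ ?a)" using that by (simp add: D_def f_def)
    have "lev y = lev x" unfolding lev_def[of y]
    proof (rule Least_equality)
      show "y \<in> S (lev x)" using S_cong[OF y] lev by auto
      fix m assume m: "y \<in> S m"
      show "lev x \<le> m"
      proof (rule ccontr)
        assume "\<not> lev x \<le> m"
        then have less: "max m ?a < lev x" by auto
        have "y \<in> S (max m ?a)" using S_mono[of m "max m ?a"] m by auto
        then have "x \<in> S (max m ?a)" using S_cong[OF y] by auto
        with not_lev[OF less] show False by simp
      qed
    qed
    then show ?thesis using gcorner_eq[OF _ y] by (simp add: f_def)
  qed
  \<comment> \<open>At level m + 1 the point lies outside \<open>S m\<close>, and (2^((m+1) div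
    2))^2 is at most 2 * 2^m. The summand 1 takes care of level 0.\<close>
  have size: "(2 ^ (lev y div 2))\<^sup>2 \<le> 2 * norm y + 1" for y :: 'a
  proof (cases "lev y")
    case (Suc m)
    then have "y \<notin> S m" using not_lev by simp
    then obtain b where b: "b \<in> Basis" "\<not> (- (2 ^ m) \<le> y \<bullet> b \<and> y \<bullet> b < 2 ^ m)"
      unfolding S_def by blast
    then have "2 ^ m \<le> norm y" using Basis_le_norm[OF b(1), of y] by linarith
    moreover have "(2 ^ (lev y div 2))\<^sup>2 \<le> (2::real) ^ Suc m"
      unfolding Suc power_mult[symmetric] by (rule power_increasing) auto
    ultimately show ?thesis by simp
  qed simp
  have fin: "finite {i \<in> range f. snd i < n}" for n
  proof -
    have "{i \<in> range f. snd i < n} \<subseteq> (\<Union>m<n. (\<lambda>g. (g, m)) ` gcorner 0 (2 ^ (m div 2)) ` S m)"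
      using lev by (auto simp: f_def)
    moreover have "bounded (S m)" for m
      by (rule bounded_subset[OF bounded_hcube[of "- (2 ^ m) *\<^sub>R One" "2 * 2 ^ m"]])
        (auto simp: S_def hcube_def)
    ultimately show ?thesis by (rule_tac finite_subset) (auto intro!: finite_UN_I finite_imageI[OF finite_gcorner])
  qed
  have count: "countable (range f)"
  proof -
    have "range f = (\<Union>n. {i \<in> range f. snd i < n})" by auto
    also have "countable \<dots>" using fin by (intro countable_UN) (auto intro: countable_finite)
    finally show ?thesis .
  qed
  have inf: "infinite (range f)"
  proof
    assume "finite (range f)"
    then have "finite (snd ` range f)" by (rule finite_imageI)
    then obtain n where n: "\<And>x. lev x < n" unfolding finite_nat_set_iff_bounded by (auto simp: f_def)
    obtain b :: 'a where b: "b \<in> Basis" using nonempty_Basis by blast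
    let ?x = "(2 ^ n) *\<^sub>R b :: 'a"
    have "?x \<in> S n" using S_mono[of "lev ?x" n] n[of ?x] lev[of ?x] by auto
    then show False using b unfolding S_def by force
  qed
  \<comment> \<open>Each level has finitely many cells, hence along any injective enumeration the
    levels, and with them the sides, tend to infinity.\<close>
  let ?e = "from_nat_into (range f)"
  have bij: "bij_betw ?e UNIV (range f)" using bij_betw_from_nat_into[OF count inf] .
  have e_mem: "?e k \<in> range f" for k using bij by (auto simp: bij_betw_def)
  have D_eq: "hcube (fst (?e k)) (2 ^ (snd (?e k) div 2)) = D (?e k)" for k by (simp add: D_def)
  show ?thesis
  proof (intro exI[of _ "\<lambda>k. 2 ^ (snd (?e k) div 2)"] exI[of _ "\<lambda>k. fst (?e k)"] conjI allI ballI, unfold D_eq)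
    have "k = l" if "y \<in> D (?e k)" "y \<in> D (?e l)" for k l y
    proof -
      have "?e k = f y" "?e l = f y" using that e_mem[of k] e_mem[of l] f_eq by (metis imageE)+
      then show ?thesis using bij by (metis UNIV_I bij_betw_def inj_on_def)
    qed
    then show "disjoint_family (\<lambda>k. D (?e k))" unfolding disjoint_family_on_def by blast
    have "y \<in> (\<Union>k. D (?e k))" for y
    proof -
      obtain k where "?e k = f y" using bij by (metis bij_betw_def rangeI imageE)
      with self[of y] show ?thesis by (metis UN_I UNIV_I)
    qed
    then show "(\<Union>k. D (?e k)) = UNIV" by blast
    fix k y assume "y \<in> D (?e k)"
    then have "?e k = f y" using e_mem[of k] f_eq by (metis imageE)
    then show "(2 ^ (snd (?e k) div 2))\<^sup>2 \<le> 2 * norm y + 1" using size[of y] by (simp add: f_def)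
  next
    show "filterlim (\<lambda>k. 2 ^ (snd (?e k) div 2) :: real) at_top sequentially"
      unfolding filterlim_at_top
    proof
      fix Z :: real
      obtain n where n: "Z < 2 ^ n" using real_arch_pow[of 2 Z] by auto
      have "finite (?e -` {i \<in> range f. snd i < 2 * n})"
        using bij fin by (intro finite_vimageI) (auto simp: bij_betw_def)
      then have "\<forall>\<^sub>F k in sequentially. \<not> snd (?e k) < 2 * n"
        unfolding cofinite_eq_sequentially[symmetric] eventually_cofinite
        by (rule rev_finite_subset) (use e_mem in auto)
      then show "\<forall>\<^sub>F k in sequentially. Z \<le> 2 ^ (snd (?e k) div 2)"
      proof eventually_elim
        case (elim k)
        then have "(2::real) ^ n \<le> 2 ^ (snd (?e k) div 2)" by (intro power_increasing) auto
        with n show ?case by linarith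
      qed
    qed
  qed simp
qed

text \<open>Each member is charged to a tile that it meets. The members inside a ball are charged to
  tiles meeting it, and these tiles fill only a slightly larger ball: by \<open>size\<close> the
  boundary layer has thickness of order sqrt r. A lower estimate follows in the same way, the layer
  being thickened by the constant \<open>M\<close>. Comparison with balls of radii r + o(r) and r -
  o(r) yields a genuine limit.\<close>

lemma clusters_density:
  fixes C :: "nat \<Rightarrow> 'a::euclidean_space set" and q :: "nat \<Rightarrow> 'a" and h :: "nat \<Rightarrow> real"
  defines "D \<equiv> \<lambda>k. hcube (q k) (h k)"
  assumes h1: "\<And>k. h k \<ge> 1" and disj: "disjoint_family D" and UN: "(\<Union>k. D k) = UNIV"
    and size: "\<And>k y. y \<in> D k \<Longrightarrow> (h k)\<^sup>2 \<le> 2 * norm y + 1"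
    and Cm: "\<And>i. C i \<in> lmeasurable"
    and meet: "\<And>i. C i \<inter> D (\<pi> i) \<noteq> {}"
    and diam: "\<And>i x y. x \<in> C i \<Longrightarrow> y \<in> C i \<Longrightarrow> dist x y \<le> M"
    and fin: "\<And>k. finite {i. \<pi> i = k}"
    and lower: "\<And>k. \<theta> * h k ^ DIM('a) \<le> (\<Sum>i | \<pi> i = k. measure lebesgue (C i))"
    and upper: "\<And>k. (\<Sum>i | \<pi> i = k. measure lebesgue (C i)) \<le> (\<theta> + e k) * h k ^ DIM('a)"
    and e: "e \<longlonglongrightarrow> 0" and \<theta>: "\<theta> \<ge> 0"
  shows "covering_density C = ennreal \<theta>"
proof -
  \<comment> \<open>Bounds the diameter of a tile that meets the ball of radius \<open>r\<close>: by
    \<open>size\<close> its side is at most sqrt (2 * r + 1), and \<open>dist_hcube\<close>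
    contributes the dimension.\<close>
  define \<delta> where "\<delta> r = DIM('a) * sqrt (2 * r + 1)" for r
  define \<omega> where "\<omega> = unit_ball_vol (DIM('a))"
  define T where "T k = (\<Sum>i | \<pi> i = k. measure lebesgue (C i))" for k
  define S where "S r = {k. D k \<inter> cball 0 r \<noteq> {}}" for r
  define I where "I r = {i. C i \<subseteq> cball 0 r}" for r
  define F where "F r = (\<Sum>i\<in>I r. measure lebesgue (C i))" for r
  have \<omega>: "\<omega> > 0" by (simp add: \<omega>_def)
  have ball: "measure lebesgue (cball (0::'a) r) = \<omega> * r ^ DIM('a)" if "r \<ge> 0" for r
    using that by (simp add: \<omega>_def content_cball)
  have M: "M \<ge> 0" 
  proof -
    obtain z where "z \<in> C 0" using meet by blast
    from diam[OF this this] show ?thesis by simp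
  qed
  have D_sub: "D k \<subseteq> cball 0 (r + \<delta> r)" if k: "k \<in> S r" for k r
  proof
    obtain y where y: "y \<in> D k" "norm y \<le> r" using k by (auto simp: S_def)
    fix z assume "z \<in> D k"
    then have "dist y z \<le> DIM('a) * h k" using y(1) unfolding D_def by (intro dist_hcube)
    also have "h k \<le> sqrt (2 * r + 1)"
      using size[OF y(1)] y(2) by (intro real_le_rsqrt) linarith
    then have "DIM('a) * h k \<le> \<delta> r" unfolding \<delta>_def by (intro mult_left_mono) auto
    finally have "norm (y - z) \<le> \<delta> r" by (simp add: dist_norm)
    then show "z \<in> cball 0 (r + \<delta> r)" using y(2) norm_triangle_ineq4[of y "y - z"] by simp
  qed
  have sum_D: "measure lebesgue (\<Union>k\<in>A. D k) = (\<Sum>k\<in>A. h k ^ DIM('a))" if "finite A" for A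
    unfolding D_def
  proof (rule measure_disjoint_hcubes[OF that])
    show "disjoint_family_on (\<lambda>i. hcube (q i) (h i)) A"
      using disj unfolding D_def by (rule disjoint_family_on_mono[rotated]) auto
    show "0 \<le> h i" for i using h1[of i] by linarith
  qed
  have S_le: "(\<Sum>k\<in>A. h k ^ DIM('a)) \<le> \<omega> * (r + \<delta> r) ^ DIM('a)" 
    if "finite A" "A \<subseteq> S r" "r \<ge> 0" for A r
  proof -
    have "\<delta> r \<ge> 0" using that by (simp add: \<delta>_def)
    have "(\<Sum>k\<in>A. h k ^ DIM('a)) \<le> measure lebesgue (cball (0::'a) (r + \<delta> r))"
      unfolding sum_D[OF that(1), symmetric]
    proof (rule measure_mono_fmeasurable)
      show "(\<Union>k\<in>A. D k) \<subseteq> cball 0 (r + \<delta> r)" using D_sub that by blast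
      show "(\<Union>k\<in>A. D k) \<in> sets lebesgue" using that(1) 
        by (intro sets.finite_UN) (auto simp: D_def intro: fmeasurableD)
    qed (auto intro: lmeasurable_compact)
    with ball[of "r + \<delta> r"] \<open>\<delta> r \<ge> 0\<close> that(3) show ?thesis by simp
  qed
  have S_fin: "finite (S r)" if "r \<ge> 0" for r
  proof (rule ccontr)
    assume inf: "infinite (S r)"
    obtain n :: nat where n: "\<omega> * (r + \<delta> r) ^ DIM('a) < n" using reals_Archimedean2 by blast
    obtain A where A: "finite A" "card A = n" "A \<subseteq> S r" using infinite_arbitrarily_large[OF inf] by blast
    have "real n \<le> (\<Sum>k\<in>A. h k ^ DIM('a))"
      using sum_mono[of A "\<lambda>_. 1" "\<lambda>k. h k ^ DIM('a)"] h1 A(2) by (simp add: one_le_power)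
    with S_le[OF A(1,3) that] n show False by linarith
  qed
  have I_sub: "I r \<subseteq> (\<Union>k\<in>S r. {i. \<pi> i = k})" for r
    using meet unfolding I_def S_def by blast
  have I_fin: "finite (I r)" if "r \<ge> 0" for r
    using I_sub finite_subset S_fin[OF that] fin by (metis (no_types, lifting) finite_UN)
  have sum_T: "(\<Sum>i\<in>(\<Union>k\<in>S r. {i. \<pi> i = k}). measure lebesgue (C i)) = (\<Sum>k\<in>S r. T k)" if "r \<ge> 0" for r
    unfolding T_def using S_fin[OF that] fin by (intro sum.UNION_disjoint) auto
  \<comment> \<open>Only finitely many tiles have an error of at least \<open>\<epsilon>\<close>;
    their excess is bounded by a constant, which is swallowed by r^d.\<close>
  have F_upper: "\<exists>c. \<forall>r\<ge>0. F r \<le> (\<theta> + \<epsilon>) * (\<omega> * (r + \<delta> r) ^ DIM('a)) + c" if \<epsilon>: "\<epsilon> > 0" for \<epsilon>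
  proof (intro exI allI impI)
    let ?X = "{k. \<not> e k < \<epsilon>}"
    have X: "finite ?X" 
      using order_tendstoD(2)[OF e \<epsilon>] by (simp flip: cofinite_eq_sequentially add: eventually_cofinite)
    fix r :: real assume r: "r \<ge> 0"
    have "F r \<le> (\<Sum>i\<in>(\<Union>k\<in>S r. {i. \<pi> i = k}). measure lebesgue (C i))"
      unfolding F_def using I_sub S_fin[OF r] fin by (intro sum_mono2) auto
    also have "\<dots> = (\<Sum>k\<in>S r. T k)" using sum_T[OF r] .
    also have "\<dots> \<le> (\<Sum>k\<in>S r. (\<theta> + \<epsilon>) * h k ^ DIM('a) + (if k \<in> ?X then e k * h k ^ DIM('a) else 0))"
    proof (rule sum_mono)
      fix k
      \<comment> \<open>\<open>e k\<close> is almost the best error available for the \<open>k\<close>-th cube; small cubes may have a large one\<close>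
  have hk: "h k ^ DIM('a) \<ge> 0" using h1[of k] by simp
      show "T k \<le> (\<theta> + \<epsilon>) * h k ^ DIM('a) + (if k \<in> ?X then e k * h k ^ DIM('a) else 0)"
      proof (cases "k \<in> ?X")
        case True
        have "\<epsilon> * h k ^ DIM('a) \<ge> 0" using hk \<epsilon> by simp
        with True upper[of k] show ?thesis by (simp add: T_def algebra_simps)
      next
        case False
        then have "(\<theta> + e k) * h k ^ DIM('a) \<le> (\<theta> + \<epsilon>) * h k ^ DIM('a)"
          using hk by (intro mult_right_mono) auto
        with False upper[of k] show ?thesis by (simp add: T_def)
      qed
    qed
    also have "\<dots> = (\<theta> + \<epsilon>) * (\<Sum>k\<in>S r. h k ^ DIM('a)) + (\<Sum>k\<in>S r \<inter> ?X. e k * h k ^ DIM('a))"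
      using S_fin[OF r] by (simp add: sum.distrib sum_distrib_left sum.inter_restrict)
    also have "(\<Sum>k\<in>S r \<inter> ?X. e k * h k ^ DIM('a)) \<le> (\<Sum>k\<in>?X. e k * h k ^ DIM('a))"
    proof (rule sum_mono2[OF X])
      fix k assume k: "k \<in> ?X - S r \<inter> ?X"
      have "h k ^ DIM('a) \<ge> 0" using h1[of k] by simp
      moreover have "e k \<ge> 0" using k \<epsilon> by auto
      ultimately show "0 \<le> e k * h k ^ DIM('a)" by simp
    qed auto
    also have "(\<theta> + \<epsilon>) * (\<Sum>k\<in>S r. h k ^ DIM('a)) \<le> (\<theta> + \<epsilon>) * (\<omega> * (r + \<delta> r) ^ DIM('a))"
      using S_le[OF S_fin[OF r] order_refl r] \<epsilon> \<theta> by (intro mult_left_mono) auto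
    finally show "F r \<le> (\<theta> + \<epsilon>) * (\<omega> * (r + \<delta> r) ^ DIM('a)) + (\<Sum>k\<in>?X. e k * h k ^ DIM('a))"
      by simp
  qed
  \<comment> \<open>A tile meeting the ball of radius r - M - \<delta> r stays in the ball of radius
    r - M, and a member charged to it sticks out of it by at most \<open>M\<close>.\<close>
  have F_lower: "\<theta> * (\<omega> * (r - M - \<delta> r) ^ DIM('a)) \<le> F r" if "r - M - \<delta> r \<ge> 0" "r \<ge> 0" for r
  proof -
    let ?\<rho> = "r - M - \<delta> r"
    have "\<delta> r \<ge> 0" using that(2) by (simp add: \<delta>_def)
    then have "sqrt (2 * ?\<rho> + 1) \<le> sqrt (2 * r + 1)" using M by (intro real_sqrt_le_mono) (simp add: algebra_simps)
    then have "\<delta> ?\<rho> \<le> \<delta> r" by (subst (1 3) \<delta>_def) (intro mult_left_mono, auto)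
    have sub: "(\<Union>k\<in>S ?\<rho>. {i. \<pi> i = k}) \<subseteq> I r"
    proof clarify
      fix i assume i: "\<pi> i \<in> S ?\<rho>"
      obtain y where y: "y \<in> C i" "y \<in> D (\<pi> i)" using meet by blast
      have "norm y \<le> ?\<rho> + \<delta> ?\<rho>" using D_sub[OF i] y(2) by auto
      then have "norm z \<le> r" if "z \<in> C i" for z
        using diam[OF y(1) that] \<open>\<delta> ?\<rho> \<le> \<delta> r\<close> norm_triangle_ineq4[of y "y - z"] by (simp add: dist_norm)
      then show "i \<in> I r" by (auto simp: I_def)
    qed
    have "\<omega> * ?\<rho> ^ DIM('a) = measure lebesgue (cball (0::'a) ?\<rho>)" using ball[OF that(1)] by simp
    also have "\<dots> \<le> measure lebesgue (\<Union>k\<in>S ?\<rho>. D k)"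
    proof (rule measure_mono_fmeasurable)
      show "cball 0 ?\<rho> \<subseteq> (\<Union>k\<in>S ?\<rho>. D k)" using UN unfolding S_def by blast
      show "(\<Union>k\<in>S ?\<rho>. D k) \<in> lmeasurable" unfolding D_def using S_fin[OF that(1)]
        by (intro fmeasurable.finite_UN) auto
    qed auto
    also have "\<dots> = (\<Sum>k\<in>S ?\<rho>. h k ^ DIM('a))" using sum_D[OF S_fin[OF that(1)]] .
    finally have "\<theta> * (\<omega> * ?\<rho> ^ DIM('a)) \<le> \<theta> * (\<Sum>k\<in>S ?\<rho>. h k ^ DIM('a))"
      using \<theta> by (rule mult_left_mono)
    also have "\<dots> \<le> (\<Sum>k\<in>S ?\<rho>. T k)"
      unfolding sum_distrib_left T_def by (intro sum_mono lower)
    also have "\<dots> = (\<Sum>i\<in>(\<Union>k\<in>S ?\<rho>. {i. \<pi> i = k}). measure lebesgue (C i))"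
      using sum_T[OF that(1)] by simp
    also have "\<dots> \<le> F r"
      unfolding F_def using sub I_fin[OF that(2)] by (intro sum_mono2) auto
    finally show ?thesis .
  qed
  have lim: "((\<lambda>r. F r / (\<omega> * r ^ DIM('a))) \<longlongrightarrow> \<theta>) at_top"
  proof (rule order_tendstoI)
    fix a assume a: "a < \<theta>"
    have "((\<lambda>r. (r - M - \<delta> r) / r) \<longlongrightarrow> 1) at_top"
      unfolding \<delta>_def by real_asymp
    then have "((\<lambda>r. \<theta> * ((r - M - \<delta> r) / r) ^ DIM('a)) \<longlongrightarrow> \<theta> * 1 ^ DIM('a)) at_top"
      by (intro tendsto_intros)
    then have "\<forall>\<^sub>F r in at_top. a < \<theta> * ((r - M - \<delta> r) / r) ^ DIM('a)"
      using a by (intro order_tendstoD(1)) auto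
    moreover have "\<forall>\<^sub>F r in at_top. r - M - \<delta> r \<ge> 0"
      unfolding \<delta>_def by real_asymp
    moreover have "\<forall>\<^sub>F r in at_top. (r::real) > 0" by real_asymp
    ultimately show "\<forall>\<^sub>F r in at_top. a < F r / (\<omega> * r ^ DIM('a))"
    proof eventually_elim
      case (elim r)
      have "\<theta> * ((r - M - \<delta> r) / r) ^ DIM('a) = \<theta> * (\<omega> * (r - M - \<delta> r) ^ DIM('a)) / (\<omega> * r ^ DIM('a))"
        using \<omega> by (simp add: power_divide)
      also have "\<dots> \<le> F r / (\<omega> * r ^ DIM('a))"
        using F_lower[of r] elim \<omega> by (intro divide_right_mono) auto
      finally show ?case using elim by linarith
    qed
  next
    fix a assume a: "\<theta> < a"
    define \<epsilon> where "\<epsilon> = (a - \<theta>) / 2"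
    have \<epsilon>: "\<epsilon> > 0" "\<theta> + \<epsilon> < a" using a by (auto simp: \<epsilon>_def field_simps)
    obtain c where c: "\<And>r. r \<ge> 0 \<Longrightarrow> F r \<le> (\<theta> + \<epsilon>) * (\<omega> * (r + \<delta> r) ^ DIM('a)) + c"
      using F_upper[OF \<epsilon>(1)] by blast
    have "((\<lambda>r. (r + \<delta> r) / r) \<longlongrightarrow> 1) at_top"
      unfolding \<delta>_def by real_asymp
    moreover have "((\<lambda>r::real. c / (\<omega> * r ^ DIM('a))) \<longlongrightarrow> 0) at_top"
      using \<omega> by (intro tendsto_divide_0[OF tendsto_const] filterlim_at_top_imp_at_infinity
          filterlim_tendsto_pos_mult_at_top[OF tendsto_const] filterlim_pow_at_top filterlim_ident) auto
    ultimately have "((\<lambda>r. (\<theta> + \<epsilon>) * ((r + \<delta> r) / r) ^ DIM('a) + c / (\<omega> * r ^ DIM('a))) \<longlongrightarrow> (\<theta> + \<epsilon>) * 1 ^ DIM('a) + 0) at_top"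
      by (intro tendsto_intros)
    then have "\<forall>\<^sub>F r in at_top. (\<theta> + \<epsilon>) * ((r + \<delta> r) / r) ^ DIM('a) + c / (\<omega> * r ^ DIM('a)) < a"
      using \<epsilon> by (intro order_tendstoD(2)) auto
    moreover have "\<forall>\<^sub>F r in at_top. (r::real) > 0" by real_asymp
    ultimately show "\<forall>\<^sub>F r in at_top. F r / (\<omega> * r ^ DIM('a)) < a"
    proof eventually_elim
      case (elim r)
      have "F r / (\<omega> * r ^ DIM('a)) \<le> ((\<theta> + \<epsilon>) * (\<omega> * (r + \<delta> r) ^ DIM('a)) + c) / (\<omega> * r ^ DIM('a))"
        using c[of r] elim \<omega> by (intro divide_right_mono) auto
      also have "\<dots> = (\<theta> + \<epsilon>) * ((r + \<delta> r) / r) ^ DIM('a) + c / (\<omega> * r ^ DIM('a))"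
        using \<omega> elim by (subst add_divide_distrib) (simp add: power_divide)
      finally show ?case using elim by linarith
    qed
  qed
  have eq: "(\<Sum>i. if C i \<subseteq> cball 0 r then emeasure lebesgue (C i) else 0) / emeasure lebesgue (cball (0::'a) r)
      = ennreal (F r / (\<omega> * r ^ DIM('a)))" if r: "r > 0" for r
  proof -
    have "(\<Sum>i. if C i \<subseteq> cball 0 r then emeasure lebesgue (C i) else 0)
        = (\<Sum>i\<in>I r. if C i \<subseteq> cball 0 r then emeasure lebesgue (C i) else 0)"
      using I_fin[of r] r by (intro suminf_finite) (auto simp: I_def)
    also have "\<dots> = (\<Sum>i\<in>I r. ennreal (measure lebesgue (C i)))"
      by (intro sum.cong) (auto simp: I_def emeasure_eq_measure2[OF Cm])
    also have "\<dots> = ennreal (F r)" unfolding F_def by (rule sum_ennreal) auto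
    finally have 1: "(\<Sum>i. if C i \<subseteq> cball 0 r then emeasure lebesgue (C i) else 0) = ennreal (F r)" .
    have "cball (0::'a) r \<in> lmeasurable" by (rule lmeasurable_compact) simp
    then have "emeasure lebesgue (cball (0::'a) r) = ennreal (measure lebesgue (cball (0::'a) r))"
      by (rule emeasure_eq_measure2)
    also have "\<dots> = ennreal (\<omega> * r ^ DIM('a))" using ball[of r] r by simp
    finally have 2: "emeasure lebesgue (cball (0::'a) r) = ennreal (\<omega> * r ^ DIM('a))" .
    have "F r \<ge> 0" unfolding F_def by (intro sum_nonneg) auto
    then show ?thesis unfolding 1 2 using r \<omega> by (intro divide_ennreal) auto
  qed
  have "((\<lambda>r. ennreal (F r / (\<omega> * r ^ DIM('a)))) \<longlongrightarrow> ennreal \<theta>) at_top"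
    using lim by (intro tendsto_ennrealI)
  moreover have "\<forall>\<^sub>F r in at_top. ennreal (F r / (\<omega> * r ^ DIM('a))) = 
      (\<Sum>i. if C i \<subseteq> cball 0 r then emeasure lebesgue (C i) else 0) / emeasure lebesgue (cball (0::'a) r)"
    using eventually_gt_at_top[of "0::real"] by eventually_elim (simp only: eq)
  ultimately show ?thesis unfolding covering_density_def
    by (intro lim_imp_Limsup) (auto elim: Lim_transform_eventually)
qed


section \<open>Serving the tiles one after the other\<close>

lemma transl_homothet_at_point:
  assumes "k \<in> K" shows "z \<in> transl_homothet (z - t *\<^sub>R k) t K"
  unfolding transl_homothet_def by (rule image_eqI[OF _ assms]) simp

lemma dist_transl_homothet:
  fixes K :: "'a::euclidean_space set"
  assumes "\<And>x y. x \<in> K \<Longrightarrow> y \<in> K \<Longrightarrow> dist x y \<le> R" "0 \<le> t" "t \<le> L" "0 \<le> R"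
    "u \<in> transl_homothet x t K" "v \<in> transl_homothet x t K"
  shows "dist u v \<le> L * R"
proof -
  obtain a b where ab: "a \<in> K" "b \<in> K" "u = x + t *\<^sub>R a" "v = x + t *\<^sub>R b"
    using assms by (auto simp: transl_homothet_def)
  have "dist u v = t * dist a b"
    using ab assms(2) by (simp add: dist_norm flip: scaleR_diff_right)
  also have "\<dots> \<le> L * R" using assms ab by (intro mult_mono) auto
  finally show ?thesis .
qed

text \<open>\<open>pieces\<close> has to work from every index \<open>N\<close> on, because each
  tile may use only members not yet spent on earlier ones. Its threshold \<open>A\<close> depends on
  the error; since the sides of the tiles tend to infinity, every positive error is eventually
  attainable, and the errors incurred tend to zero.\<close>

lemma exact_density_covering:
  fixes K :: "'a::euclidean_space set" and lam :: "nat \<Rightarrow> real"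
  assumes K: "convex_body K" and lam: "\<And>i. lam i > 0" "\<And>i. lam i \<le> L" and \<theta>: "\<theta> \<ge> 0"
    and pieces: "\<And>e. e > 0 \<Longrightarrow> \<exists>A. \<forall>h\<ge>A. \<forall>p N. \<exists>I x. finite I \<and> I \<subseteq> {N..} \<and>
      hcube p h \<subseteq> (\<Union>i\<in>I. transl_homothet (x i) (lam i) K) \<and>
      \<theta> * h ^ DIM('a) \<le> (\<Sum>i\<in>I. lam i ^ DIM('a) * measure lebesgue K) \<and>
      (\<Sum>i\<in>I. lam i ^ DIM('a) * measure lebesgue K) \<le> (\<theta> + e) * h ^ DIM('a)"
  shows "\<exists>x :: nat \<Rightarrow> 'a. covers (\<lambda>i. transl_homothet (x i) (lam i) K) UNIV
    \<and> covering_density (\<lambda>i. transl_homothet (x i) (lam i) K) = ennreal \<theta>"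
proof -
  obtain q :: "nat \<Rightarrow> 'a" and h :: "nat \<Rightarrow> real" where
    tiling: "(\<forall>k. h k \<ge> 1) \<and> disjoint_family (\<lambda>k. hcube (q k) (h k)) \<and>
      (\<Union>k. hcube (q k) (h k)) = UNIV \<and>
      (\<forall>k. \<forall>y\<in>hcube (q k) (h k). (h k)\<^sup>2 \<le> 2 * norm y + 1) \<and>
      filterlim h at_top sequentially"
    using dyadic_tiling[where ?'a = 'a] by (elim exE)
  then have h1: "\<And>k. h k \<ge> 1" 
    and disj: "disjoint_family (\<lambda>k. hcube (q k) (h k))"
    and UN: "(\<Union>k. hcube (q k) (h k)) = UNIV"
    and size: "\<And>k y. y \<in> hcube (q k) (h k) \<Longrightarrow> (h k)\<^sup>2 \<le> 2 * norm y + 1"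
    and hlim: "filterlim h at_top sequentially"
    by blast+
  define v where "v = measure lebesgue K"
  define V where "V I = (\<Sum>i\<in>I. lam i ^ DIM('a) * v)" for I
  define C where "C x i = transl_homothet x (lam i) K" for x :: 'a and i
  define G where "G c s p N \<longleftrightarrow> (\<exists>I x. finite I \<and> I \<subseteq> {N..} \<and>
      hcube p s \<subseteq> (\<Union>i\<in>I. C (x i) i) \<and>
      \<theta> * s ^ DIM('a) \<le> V I \<and> V I \<le> (\<theta> + c) * s ^ DIM('a))" for c s p N
  have G: "\<exists>A. \<forall>s\<ge>A. \<forall>p N. G c s p N" if "c > 0" for c
    using pieces[OF that] unfolding G_def C_def V_def v_def .
  define P where "P e k N I x \<longleftrightarrow> finite I \<and> I \<subseteq> {N..} \<and>
      hcube (q k) (h k) \<subseteq> (\<Union>i\<in>I. C (x i) i) \<and>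
      \<theta> * h k ^ DIM('a) \<le> V I \<and> V I \<le> (\<theta> + e) * h k ^ DIM('a)" for e k N I x
  \<comment> \<open>Taking nearly the best error of each tile avoids a bookkeeping of thresholds:
    every fixed positive error lies in \<open>E k\<close> for all large \<open>k\<close>. The
    summand 1 / Suc k in \<open>e\<close> is there because the infimum need not be attained.\<close>
  define E where "E k = {e. e > 0 \<and> (\<forall>N. \<exists>I x. P e k N I x)}" for k
  define e where "e k = Inf (E k) + 1 / Suc k" for k
  have hk: "h k ^ DIM('a) \<ge> 1" "h k > 0" for k using h1[of k] by (auto intro: one_le_power)
  have E_bdd: "bdd_below (E k)" for k by (rule bdd_belowI[of _ 0]) (auto simp: E_def)
  \<comment> \<open>A tile below the threshold is covered as part of a larger cube with the same
    corner; the resulting error \<open>c\<close> may be huge but is finite.\<close>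
  have E_ne: "E k \<noteq> {}" for k
  proof -
    obtain A where A: "\<forall>s\<ge>A. \<forall>p N. G 1 s p N" using G[of 1] by auto
    define s where "s = max A (h k)"
    have s: "s \<ge> A" "s \<ge> h k" "s > 0" using hk(2)[of k] by (auto simp: s_def)
    define c where "c = (\<theta> + 1) * s ^ DIM('a) / h k ^ DIM('a)"
    have "c > 0" using s hk(2)[of k] \<theta> by (auto simp: c_def)
    moreover have "\<exists>I x. P c k N I x" for N
    proof -
      have "G 1 s (q k) N" using A s(1) by blast
      then obtain I x where "finite I \<and> I \<subseteq> {N..} \<and> hcube (q k) s \<subseteq> (\<Union>i\<in>I. C (x i) i) \<and>
        \<theta> * s ^ DIM('a) \<le> V I \<and> V I \<le> (\<theta> + 1) * s ^ DIM('a)" unfolding G_def by (elim exE)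
      then have Ix: "finite I" "I \<subseteq> {N..}" "hcube (q k) s \<subseteq> (\<Union>i\<in>I. C (x i) i)"
        "\<theta> * s ^ DIM('a) \<le> V I" "V I \<le> (\<theta> + 1) * s ^ DIM('a)" by auto
      have "hcube (q k) (h k) \<subseteq> hcube (q k) s" using s(2) by (fastforce simp: hcube_def)
      moreover have "\<theta> * h k ^ DIM('a) \<le> \<theta> * s ^ DIM('a)"
        using s(2) hk(2)[of k] \<theta> by (intro mult_left_mono power_mono) auto
      moreover have "(\<theta> + 1) * s ^ DIM('a) \<le> (\<theta> + c) * h k ^ DIM('a)"
      proof -
        have "(\<theta> + 1) * s ^ DIM('a) = c * h k ^ DIM('a)" using hk(2)[of k] by (simp add: c_def)
        also have "\<dots> \<le> (\<theta> + c) * h k ^ DIM('a)" using hk(1)[of k] \<theta> by (intro mult_right_mono) auto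
        finally show ?thesis .
      qed
      ultimately have "P c k N I x" unfolding P_def
        using Ix(1,2) subset_trans[OF _ Ix(3)] order_trans[OF _ Ix(4)] order_trans[OF Ix(5)] by (intro conjI)
      then show ?thesis by (intro exI)
    qed
    ultimately have "c \<in> E k" by (simp add: E_def)
    then show ?thesis by blast
  qed
  have Inf_ge: "Inf (E k) \<ge> 0" for k
    using E_ne by (intro cInf_greatest) (auto simp: E_def)
  have "\<exists>I x. P (e k) k N I x" for k N
  proof -
    have "Inf (E k) < e k" by (simp add: e_def)
    then obtain e' where e': "e' \<in> E k" "e' < e k" using cInf_lessD[OF E_ne] by blast
    then have "\<exists>I x. P e' k N I x" by (simp add: E_def)
    then obtain I x where "P e' k N I x" by (elim exE)
    moreover have "(\<theta> + e') * h k ^ DIM('a) \<le> (\<theta> + e k) * h k ^ DIM('a)"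
      using e'(2) hk(1)[of k] by (intro mult_right_mono) auto
    ultimately have "P (e k) k N I x" unfolding P_def by (elim conjE) (intro conjI, assumption+, linarith)
    then show ?thesis by (intro exI)
  qed
  then obtain I0 X0 where P0: "\<And>k N. P (e k) k N (I0 k N) (X0 k N)" by metis
  \<comment> \<open>From index \<open>Nf k\<close> on every member is still free when tile
    \<open>k\<close> is served, so the blocks \<open>J k\<close> lie in disjoint intervals of
    indices.\<close>
  define Nf where "Nf = rec_nat 0 (\<lambda>k N. Suc (Max (insert N (I0 k N))))"
  define J where "J k = I0 k (Nf k)" for k
  define Y where "Y k = X0 k (Nf k)" for k
  have PJ: "P (e k) k (Nf k) (J k) (Y k)" for k using P0 by (simp add: J_def Y_def)
  have finJ: "finite (J k)" for k using PJ by (simp add: P_def)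
  have Nf_Suc: "Nf (Suc k) = Suc (Max (insert (Nf k) (J k)))" for k by (simp add: Nf_def J_def)
  have Nf_mono: "Nf k \<le> Nf l" if "k \<le> l" for k l
  proof (rule lift_Suc_mono_le[OF _ that])
    fix k show "Nf k \<le> Nf (Suc k)" using finJ[of k] by (simp add: Nf_Suc le_SucI)
  qed
  have J_range: "Nf k \<le> i \<and> i < Nf (Suc k)" if "i \<in> J k" for i k
    using PJ[of k] that finJ[of k] by (auto simp: P_def Nf_Suc less_Suc_eq_le)
  have J_disj: "k = l" if "i \<in> J k" "i \<in> J l" for i k l
  proof (rule ccontr)
    assume "k \<noteq> l"
    then consider "Suc k \<le> l" | "Suc l \<le> k" by linarith
    then show False using J_range[OF that(1)] J_range[OF that(2)] Nf_mono by cases (meson leD le_trans)+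
  qed
  \<comment> \<open>A member outside all blocks goes to the tile with its own index; thus every tile
    receives at most one such member.\<close>
  define \<pi> where "\<pi> i = (if \<exists>k. i \<in> J k then (THE k. i \<in> J k) else i)" for i
  have \<pi>_J: "\<pi> i = k" if "i \<in> J k" for i k
    using that J_disj unfolding \<pi>_def by (auto intro: the_equality)
  obtain k0 where k0: "k0 \<in> K" using K interior_subset unfolding convex_body_def by blast
  \<comment> \<open>A member whose intended position misses its tile contributes nothing to the
    covering of that tile, so it may be moved to the corner of the tile; this secures the hypothesis
    \<open>meet\<close> of \<open>clusters_density\<close>. For a member outside the blocks the
    value of \<open>Y\<close> is arbitrary, and the same test makes it harmless.\<close>
  define x where "x i = (if C (Y (\<pi> i) i) i \<inter> hcube (q (\<pi> i)) (h (\<pi> i)) \<noteq> {} then Y (\<pi> i) i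
    else q (\<pi> i) - lam i *\<^sub>R k0)" for i
  have meet: "C (x i) i \<inter> hcube (q (\<pi> i)) (h (\<pi> i)) \<noteq> {}" for i
  proof -
    have "q (\<pi> i) \<in> C (q (\<pi> i) - lam i *\<^sub>R k0) i \<inter> hcube (q (\<pi> i)) (h (\<pi> i))"
      using hcube_corner[OF hk(2)] transl_homothet_at_point[OF k0] by (simp add: C_def)
    then show ?thesis unfolding x_def by auto
  qed
  have cov: "covers (\<lambda>i. C (x i) i) UNIV"
    unfolding covers_def
  proof
    fix y :: 'a
    obtain k where y: "y \<in> hcube (q k) (h k)" using UN by blast
    then obtain i where i: "i \<in> J k" "y \<in> C (Y k i) i" using PJ[of k] by (auto simp: P_def)
    then have "x i = Y k i" using \<pi>_J[OF i(1)] y by (auto simp: x_def)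
    with i show "y \<in> (\<Union>i. C (x i) i)" by (intro UN_I[of i]) auto
  qed
  have cK: "compact K" using K by (simp add: convex_body_def)
  have v: "v > 0" using convex_body_measure_pos[OF K] by (simp add: v_def)
  have mC: "measure lebesgue (C y i) = lam i ^ DIM('a) * v" for y i
    using lam(1)[of i] by (simp add: C_def measure_transl_homothet v_def)
  obtain R where R: "\<And>x y. x \<in> K \<Longrightarrow> y \<in> K \<Longrightarrow> dist x y \<le> R"
    using compact_imp_bounded[OF cK] by (meson bounded_two_points)
  have R0: "R \<ge> 0" using R[OF k0 k0] by simp
  have \<pi>_notJ: "\<pi> i = i" if "\<And>k. i \<notin> J k" for i using that by (simp add: \<pi>_def)
  have fib: "J k \<subseteq> {i. \<pi> i = k}" "{i. \<pi> i = k} \<subseteq> insert k (J k)" for k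
    using \<pi>_J \<pi>_notJ by (blast, force)
  have fin: "finite {i. \<pi> i = k}" for k using fib(2) finJ by (meson finite.insertI finite_subset)
  \<comment> \<open>The single stray member of a tile has volume at most L^d v, which is negligible
    against the volume of the growing tiles.\<close>
  define e' where "e' k = e k + L ^ DIM('a) * v / h k ^ DIM('a)" for k
  have "covering_density (\<lambda>i. C (x i) i) = ennreal \<theta>"
  proof (rule clusters_density[where \<pi> = \<pi> and q = q and h = h and M = "L * R" and e = e'])
    show "C (x i) i \<in> lmeasurable" for i unfolding C_def using cK by (rule lmeasurable_transl_homothet)
    show "dist u w \<le> L * R" if "u \<in> C (x i) i" "w \<in> C (x i) i" for i u w
      using that lam(1,2)[of i] R0 R unfolding C_def by (intro dist_transl_homothet[of K R "lam i"]) auto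
    show "\<theta> * h k ^ DIM('a) \<le> (\<Sum>i | \<pi> i = k. measure lebesgue (C (x i) i))" for k
    proof -
      have "\<theta> * h k ^ DIM('a) \<le> V (J k)" using PJ[of k] by (simp add: P_def)
      also have "\<dots> \<le> (\<Sum>i | \<pi> i = k. measure lebesgue (C (x i) i))"
        unfolding V_def mC using fin fib(1) v lam(1) by (intro sum_mono2) (auto simp: less_imp_le)
      finally show ?thesis .
    qed
    show "(\<Sum>i | \<pi> i = k. measure lebesgue (C (x i) i)) \<le> (\<theta> + e' k) * h k ^ DIM('a)" for k
    proof -
      have "(\<Sum>i | \<pi> i = k. measure lebesgue (C (x i) i)) \<le> V (insert k (J k))"
        unfolding V_def mC using finJ fib(2) v lam(1) by (intro sum_mono2) (auto simp: less_imp_le)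
      also have "\<dots> \<le> V (J k) + lam k ^ DIM('a) * v"
        unfolding V_def using finJ[of k] v lam(1)[of k] by (cases "k \<in> J k") (auto simp: insert_absorb)
      also have "\<dots> \<le> (\<theta> + e k) * h k ^ DIM('a) + L ^ DIM('a) * v"
        using PJ[of k] lam(1,2)[of k] v by (intro add_mono mult_right_mono power_mono) (auto simp: P_def)
      also have "\<dots> = (\<theta> + e' k) * h k ^ DIM('a)"
        using hk(2)[of k] by (simp add: e'_def field_simps)
      finally show ?thesis .
    qed
    have "e \<longlonglongrightarrow> 0"
    proof (rule order_tendstoI)
      fix a :: real assume "a < 0"
      then show "\<forall>\<^sub>F k in sequentially. a < e k"
        using Inf_ge unfolding e_def by (intro always_eventually allI) (smt (verit) divide_nonneg_nonneg of_nat_0_le_iff)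
    next
      fix a :: real assume a: "0 < a"
      obtain A where A: "\<forall>s\<ge>A. \<forall>p N. G (a / 2) s p N" using G[of "a / 2"] a by auto
      have "\<forall>\<^sub>F k in sequentially. A \<le> h k" using hlim by (simp add: filterlim_at_top)
      moreover have "(\<lambda>k. 1 / real (Suc k)) \<longlonglongrightarrow> 0" by real_asymp
      then have "\<forall>\<^sub>F k in sequentially. 1 / real (Suc k) < a / 2"
        using a by (intro order_tendstoD(2)) auto
      ultimately show "\<forall>\<^sub>F k in sequentially. e k < a"
      proof eventually_elim
        case (elim k)
        have "a / 2 \<in> E k" using A elim(1) a by (simp add: E_def P_def G_def)
        then have "Inf (E k) \<le> a / 2" using E_bdd by (rule cInf_lower)
        with elim(2) show ?case by (simp add: e_def)
      qed
    qed
    moreover have "(\<lambda>k. L ^ DIM('a) * v / h k ^ DIM('a)) \<longlonglongrightarrow> 0"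
      by (intro tendsto_divide_0[OF tendsto_const] filterlim_at_top_imp_at_infinity
          filterlim_pow_at_top hlim) auto
    ultimately show "e' \<longlonglongrightarrow> 0" unfolding e'_def using tendsto_add by fastforce
  qed (use h1 disj UN size meet fin \<theta> in auto)
  with cov show ?thesis unfolding C_def by (intro exI[of _ x] conjI)
qed

section \<open>Coverings by translates and families with a nonzero limit point\<close>

definition cubes_coverable :: "'a::euclidean_space set \<Rightarrow> real \<Rightarrow> bool" where
  "cubes_coverable K \<theta> \<longleftrightarrow> (\<forall>\<epsilon>>0. \<exists>S. \<forall>s\<ge>S. \<forall>p. \<exists>T. finite T \<and>
     hcube p s \<subseteq> (\<Union>x\<in>T. transl_homothet x 1 K) \<and>
     card T * measure lebesgue K \<le> (\<theta> + \<epsilon>) * s ^ DIM('a))"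

text \<open>A crude bound from tiling by translates of the inscribed cube. It serves to show that
  the covering density of \<open>K\<close> is finite.\<close>

lemma cubes_coverable_by_inner_hcube:
  fixes K :: "'a::euclidean_space set"
  assumes "hcube q a \<subseteq> K" "a > 0"
  shows "cubes_coverable K (measure lebesgue K / a ^ DIM('a))"
  unfolding cubes_coverable_def
proof (intro allI impI)
  fix \<epsilon> :: real assume \<epsilon>: "\<epsilon> > 0"
  let ?v = "measure lebesgue K" and ?\<theta> = "measure lebesgue K / a ^ DIM('a)"
  have "((\<lambda>s. (s + a) / s) \<longlongrightarrow> 1) at_top" by real_asymp
  then have "((\<lambda>s. ?\<theta> * ((s + a) / s) ^ DIM('a)) \<longlongrightarrow> ?\<theta> * 1 ^ DIM('a)) at_top"
    by (intro tendsto_intros)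
  then have "\<forall>\<^sub>F s in at_top. ?\<theta> * ((s + a) / s) ^ DIM('a) < ?\<theta> + \<epsilon>"
    using \<epsilon> by (intro order_tendstoD(2)) auto
  with eventually_gt_at_top[of "0::real"]
  have "\<forall>\<^sub>F s in at_top. s > 0 \<and> ?\<theta> * ((s + a) / s) ^ DIM('a) < ?\<theta> + \<epsilon>"
    by eventually_elim auto
  then obtain S where S: "\<And>s. s \<ge> S \<Longrightarrow> s > 0 \<and> ?\<theta> * ((s + a) / s) ^ DIM('a) < ?\<theta> + \<epsilon>"
    unfolding eventually_at_top_linorder by blast
  show "\<exists>S. \<forall>s\<ge>S. \<forall>p. \<exists>T. finite T \<and> hcube p s \<subseteq> (\<Union>x\<in>T. transl_homothet x 1 K) \<and>
     card T * ?v \<le> (?\<theta> + \<epsilon>) * s ^ DIM('a)"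
  proof (intro exI[of _ S] allI impI)
    fix s and p :: 'a assume s: "S \<le> s"
    define m where "m = nat \<lceil>s / a\<rceil>"
    have s0: "s > 0" using S s by blast
    have "real m = of_int \<lceil>s / a\<rceil>" using s0 assms(2) by (simp add: m_def)
    then have m: "s / a \<le> real m" "real m \<le> s / a + 1" by linarith+
    obtain G where G: "finite G" "disjoint_family_on (\<lambda>g. hcube g a) G"
      "hcube p (real m * a) = (\<Union>g\<in>G. hcube g a)"
      using hcube_subdivide[OF assms(2)] by blast
    have "real (card G) * a ^ DIM('a) = (real m * a) ^ DIM('a)"
      using measure_disjoint_hcubes[OF G(1,2)] assms(2) G(3)[symmetric] by simp
    then have cG: "real (card G) = real m ^ DIM('a)"
      using assms(2) by (simp add: power_mult_distrib)
    let ?T = "(\<lambda>g. g - q) ` G"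
    have sub: "hcube p s \<subseteq> (\<Union>x\<in>?T. transl_homothet x 1 K)"
    proof -
      have "hcube p s \<subseteq> hcube p (real m * a)"
        using m(1) assms(2) by (fastforce simp: hcube_def field_simps)
      also have "\<dots> = (\<Union>g\<in>G. transl_homothet (g - q) 1 (hcube q a))"
        unfolding G(3) by (simp add: transl_homothet_hcube)
      also have "\<dots> \<subseteq> (\<Union>x\<in>?T. transl_homothet x 1 K)"
        using transl_homothet_mono[OF assms(1)] by blast
      finally show ?thesis .
    qed
    have "card ?T * ?v \<le> card G * ?v"
      using card_image_le[OF G(1), of "\<lambda>g. g - q"] by (intro mult_right_mono) auto
    also have "\<dots> \<le> (s / a + 1) ^ DIM('a) * ?v"
      unfolding cG using m by (intro mult_right_mono power_mono) auto
    also have "s / a + 1 = (s + a) / s * (s / a)" using s0 assms(2) by (simp add: field_simps)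
    also have "\<dots> ^ DIM('a) * ?v = (?\<theta> * ((s + a) / s) ^ DIM('a)) * s ^ DIM('a)"
      unfolding power_mult_distrib power_divide[of s a] by simp
    also have "\<dots> \<le> (?\<theta> + \<epsilon>) * s ^ DIM('a)"
      using S[OF s] by (intro mult_right_mono) auto
    finally show "\<exists>T. finite T \<and> hcube p s \<subseteq> (\<Union>x\<in>T. transl_homothet x 1 K) \<and>
     card T * ?v \<le> (?\<theta> + \<epsilon>) * s ^ DIM('a)" using sub G(1) by blast
  qed
qed

text \<open>Both copies map \<open>k\<close> to the same point, and dilating a convex set about one
  of its points by a factor of at least 1 enlarges it.\<close>

lemma transl_homothet_grow:
  fixes K :: "'a::euclidean_space set"
  assumes "convex K" "k \<in> K" "0 < s" "s \<le> t"
  shows "transl_homothet x s K \<subseteq> transl_homothet (x - (t - s) *\<^sub>R k) t K"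
proof
  fix y assume "y \<in> transl_homothet x s K"
  then obtain z where z: "z \<in> K" "y = x + s *\<^sub>R z" by (auto simp: transl_homothet_def)
  have "(s / t) *\<^sub>R z + ((t - s) / t) *\<^sub>R k \<in> K"
    using assms z by (intro convexD) (auto simp: field_simps)
  moreover have "y = x - (t - s) *\<^sub>R k + t *\<^sub>R ((s / t) *\<^sub>R z + ((t - s) / t) *\<^sub>R k)"
    using z assms(3,4) by (simp add: scaleR_add_right)
  ultimately show "y \<in> transl_homothet (x - (t - s) *\<^sub>R k) t K"
    unfolding transl_homothet_def by (rule rev_image_eqI)
qed

lemma infinite_frequent_tail:
  assumes "frequently P sequentially"
  shows "infinite {i. N \<le> i \<and> P i}"
proof
  assume "finite {i. N \<le> i \<and> P i}"
  moreover have "{i. P i} \<subseteq> {i. N \<le> i \<and> P i} \<union> {..<N}" by auto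
  ultimately have "finite {i. P i}" by (meson finite_Un finite_lessThan finite_subset)
  then show False using assms by (simp flip: cofinite_eq_sequentially add: frequently_cofinite)
qed

text \<open>Members of size between l - \<eta> and l + \<eta> replace the translates of (l - \<eta>)
  K in an economical covering, each containing the translate it replaces. The loss is the factor ((l
  + \<eta>) / (l - \<eta>))^d, which tends to 1 with \<eta>.\<close>

lemma density_covering_near_limit:
  fixes K :: "'a::euclidean_space set" and lam :: "nat \<Rightarrow> real"
  assumes K: "convex_body K" and lam: "\<And>i. lam i > 0" "\<And>i. lam i \<le> L"
    and l: "l > 0" "\<And>e. e > 0 \<Longrightarrow> frequently (\<lambda>i. dist (lam i) l < e) sequentially"
    and \<theta>: "\<theta> \<ge> 0" "cubes_coverable K \<theta>"
  shows "\<exists>x :: nat \<Rightarrow> 'a. covers (\<lambda>i. transl_homothet (x i) (lam i) K) UNIV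
    \<and> covering_density (\<lambda>i. transl_homothet (x i) (lam i) K) = ennreal \<theta>"
proof (rule exact_density_covering[OF K lam \<theta>(1)])
  fix e :: real assume e: "e > 0"
  define v where "v = measure lebesgue K"
  have v: "v > 0" using convex_body_measure_pos[OF K] by (simp add: v_def)
  have d1: "DIM('a) \<ge> 1" by (simp add: DIM_positive Suc_leI)
  have "((\<lambda>\<eta>. (\<theta> + \<eta>) * ((l + \<eta>) / (l - \<eta>)) ^ DIM('a)) \<longlongrightarrow> (\<theta> + 0) * ((l + 0) / (l - 0)) ^ DIM('a)) (at_right 0)"
    using l by (intro tendsto_intros) auto
  then have "\<forall>\<^sub>F \<eta> in at_right 0. (\<theta> + \<eta>) * ((l + \<eta>) / (l - \<eta>)) ^ DIM('a) < \<theta> + e / 2"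
    using e l by (intro order_tendstoD(2)) auto
  moreover have "\<forall>\<^sub>F \<eta> in at_right 0. \<eta> < l" 
    using l(1) eventually_at_right_field by blast
  moreover have "\<forall>\<^sub>F \<eta> in at_right 0. (\<eta>::real) > 0" by (rule eventually_at_right_less)
  ultimately have "\<forall>\<^sub>F \<eta> in at_right 0. \<eta> > 0 \<and> \<eta> < l \<and> (\<theta> + \<eta>) * ((l + \<eta>) / (l - \<eta>)) ^ DIM('a) < \<theta> + e / 2"
    by eventually_elim auto
  then obtain \<eta> where \<eta>: "\<eta> > 0" "\<eta> < l" "(\<theta> + \<eta>) * ((l + \<eta>) / (l - \<eta>)) ^ DIM('a) < \<theta> + e / 2"
    using eventually_happens trivial_limit_at_right_real by blast
  define m where "m = l - \<eta>"
  have m: "m > 0" using \<eta> by (simp add: m_def)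
  obtain S where S: "\<forall>s\<ge>S. \<forall>p. \<exists>T. finite T \<and>
     hcube p s \<subseteq> (\<Union>x\<in>T. transl_homothet x 1 K) \<and> card T * v \<le> (\<theta> + \<eta>) * s ^ DIM('a)"
    using \<theta>(2) \<eta>(1) unfolding cubes_coverable_def v_def by blast
  \<comment> \<open>The bound 1 gives h <= h^d, the second makes the rescaled side h / m reach the
    threshold \<open>S\<close>, and the third makes the one member gained by rounding up cost at
    most e / 2 times the volume of the cube.\<close>
  define A where "A = Max {1, S * m, 2 * v * (l + \<eta>) ^ DIM('a) / e}"
  obtain k0 where k0: "k0 \<in> K" using K interior_subset unfolding convex_body_def by blast
  show "\<exists>A. \<forall>h\<ge>A. \<forall>p N. \<exists>I x. finite I \<and> I \<subseteq> {N..} \<and>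
      hcube p h \<subseteq> (\<Union>i\<in>I. transl_homothet (x i) (lam i) K) \<and>
      \<theta> * h ^ DIM('a) \<le> (\<Sum>i\<in>I. lam i ^ DIM('a) * measure lebesgue K) \<and>
      (\<Sum>i\<in>I. lam i ^ DIM('a) * measure lebesgue K) \<le> (\<theta> + e) * h ^ DIM('a)"
    unfolding v_def[symmetric]
  proof (intro exI[of _ A] allI impI)
    fix h and p :: 'a and N assume "A \<le> h"
    then have h: "1 \<le> h" "S * m \<le> h" "2 * v * (l + \<eta>) ^ DIM('a) / e \<le> h" by (auto simp: A_def)
    define s where "s = h / m"
    have s: "S \<le> s" "s > 0" "h = s * m" using h m by (auto simp: s_def field_simps)
    obtain T where T: "finite T" "hcube (p /\<^sub>R m) s \<subseteq> (\<Union>x\<in>T. transl_homothet x 1 K)"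
      "card T * v \<le> (\<theta> + \<eta>) * s ^ DIM('a)" using S s(1) by blast
    \<comment> \<open>The number of members is dictated by volume, not by \<open>card T\<close>, and
      rounded up: even if all had the smallest size \<open>m\<close>, their volume would be at least
      \<theta> times that of the cube.\<close>
    define n where "n = nat \<lceil>(\<theta> + \<eta>) * s ^ DIM('a) / v\<rceil>"
    have "(\<theta> + \<eta>) * s ^ DIM('a) / v \<ge> 0" using \<theta> \<eta> s v by simp
    then have "real n = of_int \<lceil>(\<theta> + \<eta>) * s ^ DIM('a) / v\<rceil>" by (simp add: n_def)
    then have "(\<theta> + \<eta>) * s ^ DIM('a) / v \<le> real n" "real n \<le> (\<theta> + \<eta>) * s ^ DIM('a) / v + 1" by linarith+
    then have n: "(\<theta> + \<eta>) * s ^ DIM('a) \<le> n * v" "n * v \<le> (\<theta> + \<eta>) * s ^ DIM('a) + v"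
      using v by (auto simp: field_simps)
    have "infinite {i. N \<le> i \<and> dist (lam i) l < \<eta>}" using infinite_frequent_tail l(2)[OF \<eta>(1)] by blast
    then obtain I where I: "finite I" "card I = n" "I \<subseteq> {i. N \<le> i \<and> dist (lam i) l < \<eta>}"
      using infinite_arbitrarily_large by blast
    have lamI: "m \<le> lam i" "lam i \<le> l + \<eta>" if "i \<in> I" for i
      using I(3) that by (auto simp: m_def dist_real_def abs_less_iff)
    have "card T \<le> card I" 
    proof -
      have "card T * v \<le> card I * v" unfolding I(2) using T(3) n(1) by linarith
      then show ?thesis using v by simp
    qed
    then obtain f where f: "f ` T \<subseteq> I" "inj_on f T" using card_le_inj[OF T(1) I(1)] by blast
    \<comment> \<open>Members outside the image of \<open>f\<close> get an arbitrary position from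
      \<open>inv_into\<close>; they matter only for their volume.\<close>
    define x where "x i = m *\<^sub>R inv_into T f i - (lam i - m) *\<^sub>R k0" for i
    have cov: "hcube p h \<subseteq> (\<Union>i\<in>I. transl_homothet (x i) (lam i) K)"
    proof
      fix y assume "y \<in> hcube p h"
      then have "y /\<^sub>R m \<in> hcube (p /\<^sub>R m) s" using m s by (auto simp: hcube_def field_simps)
      then obtain t where t: "t \<in> T" "y /\<^sub>R m \<in> transl_homothet t 1 K" using T(2) by blast
      then have "y \<in> transl_homothet (m *\<^sub>R t) m K"
        using m by (simp add: mem_transl_homothet scaleR_diff_right)
      moreover have "inv_into T f (f t) = t" using f(2) t(1) by simp
      moreover have "f t \<in> I" using f t by blast
      ultimately have "y \<in> transl_homothet (x (f t)) (lam (f t)) K"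
        using transl_homothet_grow[OF _ k0 m lamI(1)[of "f t"]] K unfolding x_def convex_body_def by auto
      with \<open>f t \<in> I\<close> show "y \<in> (\<Union>i\<in>I. transl_homothet (x i) (lam i) K)" by blast
    qed
    have "\<theta> * h ^ DIM('a) \<le> (\<theta> + \<eta>) * s ^ DIM('a) * m ^ DIM('a)"
      unfolding s(3) power_mult_distrib using \<eta> m s by (simp add: mult_right_mono)
    also have "\<dots> \<le> n * v * m ^ DIM('a)" using n(1) m by (intro mult_right_mono) auto
    also have "\<dots> = (\<Sum>i\<in>I. m ^ DIM('a) * v)" using I(2) by simp
    also have "\<dots> \<le> (\<Sum>i\<in>I. lam i ^ DIM('a) * v)"
      using lamI m v by (intro sum_mono mult_right_mono power_mono) auto
    finally have lo: "\<theta> * h ^ DIM('a) \<le> (\<Sum>i\<in>I. lam i ^ DIM('a) * v)" .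
    have "(\<Sum>i\<in>I. lam i ^ DIM('a) * v) \<le> (\<Sum>i\<in>I. (l + \<eta>) ^ DIM('a) * v)"
      using lamI lam(1) v by (intro sum_mono mult_right_mono power_mono) (auto simp: less_imp_le)
    also have "\<dots> = n * v * (l + \<eta>) ^ DIM('a)" using I(2) by simp
    also have "\<dots> \<le> ((\<theta> + \<eta>) * s ^ DIM('a) + v) * (l + \<eta>) ^ DIM('a)"
      using n(2) l \<eta> by (intro mult_right_mono) auto
    also have "\<dots> = (\<theta> + \<eta>) * ((l + \<eta>) / m) ^ DIM('a) * h ^ DIM('a) + v * (l + \<eta>) ^ DIM('a)"
      using m by (simp add: s_def power_divide field_simps)
    also have "\<dots> \<le> (\<theta> + e / 2) * h ^ DIM('a) + e / 2 * h ^ DIM('a)"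
    proof (intro add_mono mult_right_mono)
      have "v * (l + \<eta>) ^ DIM('a) \<le> e / 2 * h" using h(3) e by (simp add: field_simps)
      also have "\<dots> \<le> e / 2 * h ^ DIM('a)" using e h(1) d1 by (intro mult_left_mono self_le_power) auto
      finally show "v * (l + \<eta>) ^ DIM('a) \<le> e / 2 * h ^ DIM('a)" .
    qed (use \<eta> h in \<open>auto simp: m_def\<close>)
    also have "\<dots> = (\<theta> + e) * h ^ DIM('a)" by (simp add: algebra_simps)
    finally have "(\<Sum>i\<in>I. lam i ^ DIM('a) * v) \<le> (\<theta> + e) * h ^ DIM('a)" .
    with cov lo I show "\<exists>I x. finite I \<and> I \<subseteq> {N..} \<and>
      hcube p h \<subseteq> (\<Union>i\<in>I. transl_homothet (x i) (lam i) K) \<and>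
      \<theta> * h ^ DIM('a) \<le> (\<Sum>i\<in>I. lam i ^ DIM('a) * v) \<and>
      (\<Sum>i\<in>I. lam i ^ DIM('a) * v) \<le> (\<theta> + e) * h ^ DIM('a)"
      by (intro exI[of _ I] exI[of _ x]) auto
  qed
qed

text \<open>The constant sequence 1 has the limit point 1, so the preceding construction applies to
  translates themselves.\<close>

lemma transl_cover_density_finite:
  fixes K :: "'a::euclidean_space set"
  assumes K: "convex_body K"
  shows "transl_cover_density K < top"
proof -
  obtain q a where qa: "a > 0" "hcube q a \<subseteq> K" by (rule convex_body_inner_hcube[OF K])
  have "\<exists>x :: nat \<Rightarrow> 'a. covers (\<lambda>i. transl_homothet (x i) 1 K) UNIV
    \<and> covering_density (\<lambda>i. transl_homothet (x i) 1 K) = ennreal (measure lebesgue K / a ^ DIM('a))"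
    using qa by (intro density_covering_near_limit[OF K, where lam = "\<lambda>_. 1" and l = 1 and L = 1]
        cubes_coverable_by_inner_hcube) (auto simp: frequently_const)
  then obtain x :: "nat \<Rightarrow> 'a" where x: "covers (\<lambda>i. transl_homothet (x i) 1 K) UNIV"
    "covering_density (\<lambda>i. transl_homothet (x i) 1 K) = ennreal (measure lebesgue K / a ^ DIM('a))"
    by blast
  then have "transl_cover_density K \<le> ennreal (measure lebesgue K / a ^ DIM('a))"
    unfolding transl_cover_density_def x(2)[symmetric]
    by (intro Inf_lower CollectI exI[of _ x] conjI refl)
  then show ?thesis using ennreal_less_top le_less_trans by blast
qed

text \<open>The mean over \<open>B\<close> of the number of sets \<open>E i\<close> containing a
  point is at most the sum of their volumes divided by the volume of \<open>B\<close>.\<close>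

lemma exists_le_average:
  fixes E :: "'i \<Rightarrow> 'a::euclidean_space set"
  assumes B: "B \<in> lmeasurable" "measure lebesgue B > 0" and J: "finite J" 
    and E: "\<And>i. i \<in> J \<Longrightarrow> E i \<in> lmeasurable"
  shows "\<exists>t\<in>B. card {i\<in>J. t \<in> E i} * measure lebesgue B \<le> (\<Sum>i\<in>J. measure lebesgue (E i))"
proof (rule ccontr)
  let ?V = "\<Sum>i\<in>J. measure lebesgue (E i)" and ?b = "measure lebesgue B"
  assume "\<not> ?thesis"
  then have less: "?V < card {i\<in>J. t \<in> E i} * ?b" if "t \<in> B" for t using that by (auto simp: not_le)
  \<comment> \<open>The counting function has integer values, so exceeding \<open>?V / ?b\<close>
    everywhere means being at least \<open>c\<close> everywhere. This keeps the inequality strict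
    without a strict comparison of integrals.\<close>
  define c where "c = real_of_int \<lfloor>?V / ?b\<rfloor> + 1"
  have c: "?V < c * ?b" using B(2) unfolding c_def by (simp flip: pos_divide_less_eq)
  have "c \<le> card {i\<in>J. t \<in> E i}" if "t \<in> B" for t
  proof -
    have "?V / ?b < of_int (int (card {i\<in>J. t \<in> E i}))" using less[OF that] B(2) by (simp add: field_simps)
    then have "\<lfloor>?V / ?b\<rfloor> < int (card {i\<in>J. t \<in> E i})" by (simp only: floor_less_iff)
    then show ?thesis unfolding c_def by linarith
  qed
  moreover have "card {i\<in>J. t \<in> E i} = (\<Sum>i\<in>J. indicat_real (E i) t)" for t
    using J by (simp add: indicator_def sum.If_cases Int_def)
  ultimately have le: "c * indicat_real B t \<le> (\<Sum>i\<in>J. indicat_real (E i) t)" for t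
    by (cases "t \<in> B") (auto intro: sum_nonneg)
  have "c * ?b = integral\<^sup>L lebesgue (\<lambda>t. c * indicat_real B t)" using B(1) by simp
  also have "\<dots> \<le> integral\<^sup>L lebesgue (\<lambda>t. \<Sum>i\<in>J. indicat_real (E i) t)"
    using B(1) E le
    by (intro integral_mono integrable_mult_right Bochner_Integration.integrable_sum)
      (simp_all only: lmeasurable_iff_integrable)
  also have "\<dots> = (\<Sum>i\<in>J. integral\<^sup>L lebesgue (indicat_real (E i)))"
    using E by (intro Bochner_Integration.integral_sum) (simp only: lmeasurable_iff_integrable)
  also have "\<dots> = ?V" by simp
  finally show False using c by linarith
qed

text \<open>In a good covering, let a cube of side \<open>s\<close> move with its corner
  \<open>t\<close> ranging over a huge ball. On average few translates meet it; those meeting it for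
  a suitable \<open>t\<close> are shifted by p - t. This transfers the density of one covering to
  cubes in every position, with a boundary loss ((s + 2 * b) / s)^d.\<close>

lemma cubes_coverable_transl_cover_density:
  fixes K :: "'a::euclidean_space set"
  assumes K: "convex_body K" and \<theta>: "transl_cover_density K = ennreal \<theta>" "\<theta> \<ge> 0"
  shows "cubes_coverable K \<theta>"
  unfolding cubes_coverable_def
proof (intro allI impI)
  fix \<epsilon> :: real assume \<epsilon>: "\<epsilon> > 0"
  define v where "v = measure lebesgue K"
  define \<omega> where "\<omega> = unit_ball_vol (DIM('a))"
  define d where "d = real DIM('a)"
  define \<theta>' where "\<theta>' = \<theta> + \<epsilon> / 2"
  have \<theta>': "\<theta> < \<theta>'" "\<theta>' < \<theta> + \<epsilon>" "\<theta>' > 0" using \<epsilon> \<theta>(2) by (auto simp: \<theta>'_def)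
  have v: "v > 0" using convex_body_measure_pos[OF K] by (simp add: v_def)
  have cK: "compact K" using K by (simp add: convex_body_def)
  have \<omega>: "\<omega> > 0" by (simp add: \<omega>_def)
  have d0: "d \<ge> 0" by (simp add: d_def)
  have ball: "emeasure lebesgue (cball (0::'a) r) = ennreal (\<omega> * r ^ DIM('a))" if "r \<ge> 0" for r
    using that by (simp add: \<omega>_def emeasure_cball)
  obtain q b where b: "b > 0" "K \<subseteq> hcube q b"
    using bounded_subset_hcube[OF compact_imp_bounded[OF cK]] by blast
  have "transl_cover_density K < ennreal \<theta>'" unfolding \<theta>(1) using \<theta>' \<theta>(2) by (simp add: ennreal_less_iff)
  then obtain x :: "nat \<Rightarrow> 'a" where cov: "covers (\<lambda>i. transl_homothet (x i) 1 K) UNIV"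
    and dens: "covering_density (\<lambda>i. transl_homothet (x i) 1 K) < ennreal \<theta>'"
    unfolding transl_cover_density_def Inf_less_iff by blast
  define C where "C i = transl_homothet (x i) 1 K" for i
  have Cm: "emeasure lebesgue (C i) = ennreal v" for i
    using emeasure_eq_measure2[OF lmeasurable_transl_homothet[OF cK, of "x i" 1]]
    by (simp add: C_def measure_transl_homothet v_def)
  have C_sub: "C i \<subseteq> hcube (x i + q) b" for i
    using transl_homothet_mono[OF b(2), of "x i" 1] by (simp add: C_def transl_homothet_hcube)
  have "\<forall>\<^sub>F r in at_top. (\<Sum>i. if C i \<subseteq> cball 0 r then emeasure lebesgue (C i) else 0)
         / emeasure lebesgue (cball (0::'a) r) < ennreal \<theta>'"
    using dens unfolding covering_density_def C_def[symmetric] by (rule Limsup_lessD)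
  \<comment> \<open>Stated for finite sets of indices, because the finiteness of the set of all
    translates inside a ball is itself deduced from this bound.\<close>
  then have ev: "\<forall>\<^sub>F r in at_top. \<forall>F. finite F \<longrightarrow> F \<subseteq> {i. C i \<subseteq> cball 0 r} \<longrightarrow> card F * v \<le> \<theta>' * (\<omega> * r ^ DIM('a))"
    using eventually_gt_at_top[of "0::real"]
  proof eventually_elim
    case (elim r)
    show ?case
    proof (intro allI impI)
      fix F assume F: "finite F" "F \<subseteq> {i. C i \<subseteq> cball 0 r}"
      let ?f = "\<lambda>i. if C i \<subseteq> cball 0 r then emeasure lebesgue (C i) else 0"
      have pos: "\<omega> * r ^ DIM('a) > 0" using \<omega> elim by simp
      have "ennreal (card F * v) = (\<Sum>i\<in>F. ennreal v)"
        using v by (subst sum_ennreal) auto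
      also have "\<dots> = (\<Sum>i\<in>F. ?f i)" using F(2) by (intro sum.cong) (auto simp: Cm)
      also have "\<dots> \<le> (\<Sum>i. ?f i)" by (rule sum_le_suminf) (use F in auto)
      also have "(\<Sum>i. ?f i) < ennreal \<theta>' * ennreal (\<omega> * r ^ DIM('a))"
      proof -
        have "(\<Sum>i. ?f i) / ennreal (\<omega> * r ^ DIM('a)) < ennreal \<theta>'"
          using elim(1) unfolding ball[OF less_imp_le[OF elim(2)]] .
        moreover have "ennreal (\<omega> * r ^ DIM('a)) \<noteq> 0" "ennreal (\<omega> * r ^ DIM('a)) < top"
          using pos by (simp_all add: ennreal_eq_0_iff not_le)
        ultimately show ?thesis using divide_less_ennreal by blast
      qed
      also have "\<dots> = ennreal (\<theta>' * (\<omega> * r ^ DIM('a)))"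
        using \<theta>' pos by (simp add: ennreal_mult)
      finally have "card F * v < \<theta>' * (\<omega> * r ^ DIM('a))"
        using v by (subst (asm) ennreal_less_iff) auto
      then show "card F * v \<le> \<theta>' * (\<omega> * r ^ DIM('a))" by simp
    qed
  qed
  have "((\<lambda>s. (s + 2 * b) / s) \<longlongrightarrow> 1) at_top" by real_asymp
  then have "((\<lambda>s. \<theta>' * ((s + 2 * b) / s) ^ DIM('a)) \<longlongrightarrow> \<theta>' * 1 ^ DIM('a)) at_top"
    by (intro tendsto_intros)
  then have "\<forall>\<^sub>F s in at_top. \<theta>' * ((s + 2 * b) / s) ^ DIM('a) < \<theta> + \<epsilon>"
    using \<theta>' by (intro order_tendstoD(2)) auto
  with eventually_gt_at_top[of "0::real"]
  have "\<forall>\<^sub>F s in at_top. s > 0 \<and> \<theta>' * ((s + 2 * b) / s) ^ DIM('a) < \<theta> + \<epsilon>"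
    by eventually_elim auto
  then obtain S where S: "\<And>s. s \<ge> S \<Longrightarrow> s > 0 \<and> \<theta>' * ((s + 2 * b) / s) ^ DIM('a) < \<theta> + \<epsilon>"
    unfolding eventually_at_top_linorder by blast
  show "\<exists>S. \<forall>s\<ge>S. \<forall>p. \<exists>T. finite T \<and> hcube p s \<subseteq> (\<Union>x\<in>T. transl_homothet x 1 K) \<and>
     card T * measure lebesgue K \<le> (\<theta> + \<epsilon>) * s ^ DIM('a)"
    unfolding v_def[symmetric]
  proof (intro exI[of _ S] allI impI)
    fix s and p :: 'a assume s: "S \<le> s"
    have s0: "s > 0" and S': "\<theta>' * ((s + 2 * b) / s) ^ DIM('a) < \<theta> + \<epsilon>" using S s by auto
    \<comment> \<open>A translate meeting a cube whose corner lies in the ball of radius r - c is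
      contained in the ball of radius \<open>r\<close>, so it has been counted.\<close>
    define c where "c = d * (b + s)"
    have "((\<lambda>r. r / (r - c)) \<longlongrightarrow> 1) at_top" by real_asymp
    then have "((\<lambda>r. \<theta>' * ((s + 2 * b) / s) ^ DIM('a) * (r / (r - c)) ^ DIM('a)) \<longlongrightarrow> 
        \<theta>' * ((s + 2 * b) / s) ^ DIM('a) * 1 ^ DIM('a)) at_top"
      by (intro tendsto_intros)
    then have "\<forall>\<^sub>F r in at_top. \<theta>' * ((s + 2 * b) / s) ^ DIM('a) * (r / (r - c)) ^ DIM('a) < \<theta> + \<epsilon>"
      using S' by (intro order_tendstoD(2)) auto
    then have "\<forall>\<^sub>F r in at_top. r > max 0 c \<and> 
        \<theta>' * ((s + 2 * b) / s) ^ DIM('a) * (r / (r - c)) ^ DIM('a) < \<theta> + \<epsilon> \<and>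
        (\<forall>F. finite F \<longrightarrow> F \<subseteq> {i. C i \<subseteq> cball 0 r} \<longrightarrow> card F * v \<le> \<theta>' * (\<omega> * r ^ DIM('a)))"
      using ev eventually_gt_at_top[of "max 0 c"] by eventually_elim auto
    then obtain r where r: "r > 0" "r > c" 
      "\<theta>' * ((s + 2 * b) / s) ^ DIM('a) * (r / (r - c)) ^ DIM('a) < \<theta> + \<epsilon>"
      "\<And>F. finite F \<Longrightarrow> F \<subseteq> {i. C i \<subseteq> cball 0 r} \<Longrightarrow> card F * v \<le> \<theta>' * (\<omega> * r ^ DIM('a))"
      unfolding eventually_at_top_linorder by auto
    define J where "J = {i. C i \<subseteq> cball 0 r}"
    have J: "finite J"
    proof (rule ccontr)
      assume inf: "infinite J"
      obtain n :: nat where n: "\<theta>' * (\<omega> * r ^ DIM('a)) / v < n" using reals_Archimedean2 by blast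
      obtain F where "finite F" "card F = n" "F \<subseteq> J" using infinite_arbitrarily_large[OF inf] by blast
      then show False using r(4)[of F] n v by (simp add: J_def field_simps)
    qed
    have cJ: "card J * v \<le> \<theta>' * (\<omega> * r ^ DIM('a))" using r(4) J by (simp add: J_def)
    \<comment> \<open>Contains every corner \<open>t\<close> for which the cube of side
      \<open>s\<close> at \<open>t\<close> meets the box around \<open>C i\<close>. A side of s + b
      would do; the slack disappears for large \<open>s\<close>.\<close>
    define E where "E i = hcube (x i + q - s *\<^sub>R One) (s + 2 * b)" for i
    have mE: "measure lebesgue (E i) = (s + 2 * b) ^ DIM('a)" for i using s0 b by (simp add: E_def)
    define \<rho> where "\<rho> = r - c"
    have \<rho>: "\<rho> > 0" using r by (simp add: \<rho>_def)
    have m\<rho>: "measure lebesgue (cball (0::'a) \<rho>) = \<omega> * \<rho> ^ DIM('a)"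
      using \<rho> by (simp add: \<omega>_def content_cball)
    obtain t where t: "t \<in> cball 0 \<rho>" "card {i\<in>J. t \<in> E i} * (\<omega> * \<rho> ^ DIM('a)) \<le> card J * (s + 2 * b) ^ DIM('a)"
      using exists_le_average[of "cball 0 \<rho>" J E] J \<rho> \<omega>
      unfolding m\<rho> mE by (auto simp: E_def lmeasurable_compact)
    let ?J = "{i\<in>J. t \<in> E i}"
    let ?T = "(\<lambda>i. x i + (p - t)) ` ?J"
    have sub: "hcube p s \<subseteq> (\<Union>x\<in>?T. transl_homothet x 1 K)"
    proof
      fix y assume y: "y \<in> hcube p s"
      define z where "z = y - (p - t)"
      have z: "z \<in> hcube t s" using y by (auto simp: z_def hcube_def inner_diff_left)
      obtain i where i: "z \<in> C i" using cov unfolding covers_def C_def by blast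
      have zi: "z \<in> hcube (x i + q) b" using C_sub i by blast
      have "t \<in> E i"
        using z zi b(1) unfolding hcube_def E_def mem_Collect_eq 
        by (intro ballI) (drule (1) bspec, drule (1) bspec, simp add: inner_add_left inner_diff_left)
      moreover have "i \<in> J" unfolding J_def mem_Collect_eq
      proof
        fix w assume w: "w \<in> C i"
        have "norm (t - z) \<le> d * s" using dist_hcube[OF hcube_corner[OF s0] z] by (simp add: d_def dist_norm)
        moreover have "norm (z - w) \<le> d * b" using dist_hcube[OF zi] C_sub w by (auto simp: d_def dist_norm)
        moreover have "norm t \<le> r - d * (b + s)" using t(1) by (simp add: \<rho>_def c_def)
        moreover have "norm w \<le> norm t + norm (t - z) + norm (z - w)"
          using norm_triangle_ineq4[of t "t - w"] norm_triangle_ineq[of "t - z" "z - w"] by simp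
        ultimately show "w \<in> cball 0 r" by (simp add: algebra_simps)
      qed
      moreover have "y \<in> transl_homothet (x i + (p - t)) 1 K"
        using i by (simp add: mem_transl_homothet C_def z_def algebra_simps)
      ultimately show "y \<in> (\<Union>x\<in>?T. transl_homothet x 1 K)" by blast
    qed
    have pos: "\<omega> * \<rho> ^ DIM('a) > 0" using \<omega> \<rho> by simp
    have "card ?T * v \<le> card ?J * v" using card_image_le[of ?J] J v by (intro mult_right_mono) auto
    also have "\<dots> \<le> card J * (s + 2 * b) ^ DIM('a) / (\<omega> * \<rho> ^ DIM('a)) * v"
      using t(2) pos v by (intro mult_right_mono) (auto simp: pos_le_divide_eq)
    also have "\<dots> = card J * v * ((s + 2 * b) ^ DIM('a) / (\<omega> * \<rho> ^ DIM('a)))" by simp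
    also have "\<dots> \<le> \<theta>' * (\<omega> * r ^ DIM('a)) * ((s + 2 * b) ^ DIM('a) / (\<omega> * \<rho> ^ DIM('a)))"
      using cJ pos s0 b by (intro mult_right_mono) auto
    also have "\<dots> = \<theta>' * ((s + 2 * b) / s) ^ DIM('a) * (r / (r - c)) ^ DIM('a) * s ^ DIM('a)"
      using \<omega> s0 by (simp add: power_divide \<rho>_def)
    also have "\<dots> \<le> (\<theta> + \<epsilon>) * s ^ DIM('a)" using r(3) s0 by (intro mult_right_mono) auto
    finally have "card ?T * v \<le> (\<theta> + \<epsilon>) * s ^ DIM('a)" .
    with sub J show "\<exists>T. finite T \<and> hcube p s \<subseteq> (\<Union>x\<in>T. transl_homothet x 1 K) \<and>
     card T * v \<le> (\<theta> + \<epsilon>) * s ^ DIM('a)" by (intro exI[of _ ?T]) auto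
  qed
qed

lemma covering_bounded_with_limit_point:
  fixes K :: "'a::euclidean_space set" and lam :: "nat \<Rightarrow> real"
  assumes K: "convex_body K" and lam: "\<And>i. lam i > 0" "bounded (range lam)"
    and l: "l \<noteq> 0" "\<forall>e>0. frequently (\<lambda>i. dist (lam i) l < e) sequentially"
  shows "\<exists>x :: nat \<Rightarrow> 'a. covers (\<lambda>i. transl_homothet (x i) (lam i) K) UNIV
    \<and> covering_density (\<lambda>i. transl_homothet (x i) (lam i) K) = transl_cover_density K"
proof -
  obtain L where L: "\<And>i. lam i \<le> L" using lam(2) unfolding bounded_iff by (auto simp: abs_le_iff)
  obtain \<theta> where \<theta>: "\<theta> \<ge> 0" "transl_cover_density K = ennreal \<theta>"
    using transl_cover_density_finite[OF K] by (cases "transl_cover_density K") auto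
  have "l > 0"
  proof (rule ccontr)
    assume "\<not> l > 0"
    then have "-l > 0" using l(1) by simp
    then have "frequently (\<lambda>i. dist (lam i) l < -l) sequentially" using l(2) by blast
    then obtain i where "dist (lam i) l < -l" using frequently_ex by blast
    then show False using lam(1)[of i] by (simp add: dist_real_def)
  qed
  then show ?thesis unfolding \<theta>(2)
    using cubes_coverable_transl_cover_density[OF K \<theta>(2,1)] l(2) \<theta>(1) L
    by (intro density_covering_near_limit[OF K lam(1)]) auto
qed

section \<open>Homothets tending to zero\<close>

definition tiles :: "'i set \<Rightarrow> ('i \<Rightarrow> 'a::euclidean_space) \<Rightarrow> ('i \<Rightarrow> real) \<Rightarrow> 'a set \<Rightarrow> bool" where
  "tiles I q s U \<longleftrightarrow> finite I \<and> disjoint_family_on (\<lambda>i. hcube (q i) (s i)) I \<and>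
     (\<Union>i\<in>I. hcube (q i) (s i)) = U"

lemma tiles_Un:
  assumes "tiles I q s U" "tiles J q s V" "U \<inter> V = {}"
  shows "tiles (I \<union> J) q s (U \<union> V)"
proof -
  have "hcube (q i) (s i) \<subseteq> U" if "i \<in> I" for i using assms(1) that unfolding tiles_def by blast
  moreover have "hcube (q j) (s j) \<subseteq> V" if "j \<in> J" for j using assms(2) that unfolding tiles_def by blast
  ultimately have IJ: "hcube (q i) (s i) \<inter> hcube (q j) (s j) = {}" if "i \<in> I" "j \<in> J" for i j
    using that assms(3) by fast
  have "disjoint_family_on (\<lambda>i. hcube (q i) (s i)) (I \<union> J)"
    unfolding disjoint_family_on_def
  proof (intro ballI impI)
    fix m n assume "m \<in> I \<union> J" "n \<in> I \<union> J" "m \<noteq> n"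
    then show "hcube (q m) (s m) \<inter> hcube (q n) (s n) = {}"
      using disjoint_family_onD[of "\<lambda>i. hcube (q i) (s i)" _ m n] assms(1,2) IJ[of m n] IJ[of n m]
      unfolding tiles_def by (metis Int_commute UnE)
  qed
  then show ?thesis using assms(1,2) by (simp add: tiles_def UN_Un)
qed

lemma tiles_cong:
  assumes "\<And>i. i \<in> I \<Longrightarrow> q i = q' i" "\<And>i. i \<in> I \<Longrightarrow> s i = s' i"
  shows "tiles I q s U = tiles I q' s' U"
  using assms unfolding tiles_def disjoint_family_on_def by simp

lemma tiles_reindex:
  assumes "tiles I (\<lambda>i. q (f i)) (\<lambda>i. s (f i)) U"
  shows "tiles (f ` I) q s U"
proof -
  have "hcube (q (f m)) (s (f m)) \<inter> hcube (q (f n)) (s (f n)) = {}"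
    if "m \<in> I" "n \<in> I" "f m \<noteq> f n" for m n
    using assms that unfolding tiles_def disjoint_family_on_def by metis
  then show ?thesis using assms unfolding tiles_def disjoint_family_on_def by auto
qed

lemma tiles_subset:
  assumes "tiles I q s U" "J \<subseteq> I"
  shows "tiles J q s (\<Union>i\<in>J. hcube (q i) (s i))"
    "tiles (I - J) q s (U - (\<Union>i\<in>J. hcube (q i) (s i)))"
proof -
  have I: "finite I" "disjoint_family_on (\<lambda>i. hcube (q i) (s i)) I" "(\<Union>i\<in>I. hcube (q i) (s i)) = U"
    using assms(1) by (auto simp: tiles_def)
  show "tiles J q s (\<Union>i\<in>J. hcube (q i) (s i))"
    unfolding tiles_def using finite_subset[OF assms(2) I(1)] disjoint_family_on_mono[OF assms(2) I(2)] by simp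
  have "hcube (q i) (s i) \<inter> hcube (q j) (s j) = {}" if "i \<in> I - J" "j \<in> J" for i j
    using that assms(2) by (intro disjoint_family_onD[OF I(2)]) auto
  then have "(\<Union>i\<in>I - J. hcube (q i) (s i)) = U - (\<Union>i\<in>J. hcube (q i) (s i))"
    unfolding I(3)[symmetric] by fast
  then show "tiles (I - J) q s (U - (\<Union>i\<in>J. hcube (q i) (s i)))"
    unfolding tiles_def using I(1) disjoint_family_on_mono[OF Diff_subset I(2)] by simp
qed

lemma tiles_refine:
  fixes U :: "'a::euclidean_space set"
  assumes "tiles G (\<lambda>g. g) (\<lambda>_. 2 * h) U" "h > 0"
  shows "\<exists>G'. tiles G' (\<lambda>g. g) (\<lambda>_. h) U"
proof -
  have "\<exists>H. finite H \<and> disjoint_family_on (\<lambda>g. hcube g h) H \<and> hcube g (2 * h) = (\<Union>g\<in>H. hcube g h)" for g :: 'a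
    using hcube_subdivide[OF assms(2), of g 2] by (metis of_nat_numeral)
  then obtain H where H: "\<And>g::'a. finite (H g)" "\<And>g::'a. disjoint_family_on (\<lambda>g. hcube g h) (H g)"
    "\<And>g::'a. hcube g (2 * h) = (\<Union>g\<in>H g. hcube g h)" by metis
  have "u = u'" if "g \<in> G" "g' \<in> G" "u \<in> H g" "u' \<in> H g'" "y \<in> hcube u h" "y \<in> hcube u' h" for g g' u u' y
  proof -
    have "y \<in> hcube g (2 * h)" "y \<in> hcube g' (2 * h)" using that H(3) by blast+
    then have "g = g'" using assms(1) that(1,2) unfolding tiles_def disjoint_family_on_def by blast
    then show ?thesis using H(2)[of g] that unfolding disjoint_family_on_def by blast
  qed
  then have "disjoint_family_on (\<lambda>g. hcube g h) (\<Union>g\<in>G. H g)"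
    unfolding disjoint_family_on_def by blast
  moreover have "(\<Union>u\<in>(\<Union>g\<in>G. H g). hcube u h) = U"
    using assms(1) H(3) unfolding tiles_def by (simp add: UN_UN_flatten)
  ultimately have "tiles (\<Union>g\<in>G. H g) (\<lambda>g. g) (\<lambda>_. h) U"
    using assms(1) H(1) unfolding tiles_def by blast
  then show ?thesis by blast
qed

lemma tiles_measure:
  fixes U :: "'a::euclidean_space set"
  assumes "tiles I q s U" "\<And>i. i \<in> I \<Longrightarrow> 0 \<le> s i"
  shows "measure lebesgue U = (\<Sum>i\<in>I. s i ^ DIM('a))"
  using assms measure_disjoint_hcubes[of I q s] unfolding tiles_def by auto

lemma dyadic_level:
  fixes s t :: real
  assumes "0 < t" "t \<le> s"
  shows "\<exists>k. t \<le> s / 2 ^ k \<and> s / 2 ^ k < 2 * t"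
proof -
  obtain n where "s / t < 2 ^ n" using real_arch_pow[of 2 "s / t"] by auto
  then have ex: "\<exists>k. s / 2 ^ k < 2 * t" using assms by (intro exI[of _ n]) (simp add: field_simps)
  define k where "k = (LEAST k. s / 2 ^ k < 2 * t)"
  have k: "s / 2 ^ k < 2 * t" unfolding k_def by (rule LeastI_ex[OF ex])
  have "t \<le> s / 2 ^ k"
  proof (cases k)
    case (Suc m)
    then have "\<not> s / 2 ^ m < 2 * t" unfolding k_def using not_less_Least by (metis lessI)
    then show ?thesis using Suc by simp
  qed (use assms in simp)
  with k show ?thesis by blast
qed

text \<open>Greedy filling. Each \<open>t i\<close> is rounded up to a dyadic fraction of
  \<open>s\<close>, and coarse levels are placed first, into the cells still free. If a level has
  enough members for all free cells, the tiling is complete; otherwise its members are all placed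
  and the remaining cells are subdivided. Were this to go on forever, all late members would fit
  disjointly into the cube, and the sum of their \<open>t i ^ DIM('a)\<close> would be bounded by
  the volume of the cube.\<close>

lemma tile_hcube_by_null_sequence:
  fixes t :: "nat \<Rightarrow> real" and p :: "'a::euclidean_space"
  assumes t: "\<And>i. t i > 0" "t \<longlonglongrightarrow> 0" and div: "\<not> summable (\<lambda>i. t i ^ DIM('a))" and s: "s > 0"
  shows "\<exists>I (q :: nat \<Rightarrow> 'a) \<sigma>. I \<subseteq> {N..} \<and> (\<forall>i\<in>I. t i \<le> \<sigma> i \<and> \<sigma> i < 2 * t i) \<and> tiles I q \<sigma> (hcube p s)"
proof (rule ccontr)
  assume neg: "\<not> ?thesis"
  have "\<forall>\<^sub>F i in sequentially. t i < s" using t(2) s by (rule order_tendstoD)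
  then obtain M where M: "\<And>i. M \<le> i \<Longrightarrow> t i < s" unfolding eventually_sequentially by blast
  \<comment> \<open>Only members not larger than \<open>s\<close> have a dyadic level.\<close>
  define N' where "N' = max M N"
  have "\<exists>k. t i \<le> s / 2 ^ k \<and> s / 2 ^ k < 2 * t i" if "N' \<le> i" for i
    using dyadic_level[of "t i" s] t(1)[of i] M[of i] that by (simp add: N'_def)
  then obtain k where k: "\<And>i. N' \<le> i \<Longrightarrow> t i \<le> s / 2 ^ k i" "\<And>i. N' \<le> i \<Longrightarrow> s / 2 ^ k i < 2 * t i"
    by metis
  define \<sigma> where "\<sigma> i = s / 2 ^ k i" for i
  define A where "A j = {i. N' \<le> i \<and> k i < j}" for j
  have \<sigma>0: "\<sigma> i > 0" for i using s by (simp add: \<sigma>_def)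
  have finA: "finite (A j)" for j
  proof -
    have "\<forall>\<^sub>F i in sequentially. t i < s / 2 ^ j / 2" by (rule order_tendstoD(2)[OF t(2)]) (use s in auto)
    then have "finite {i. \<not> t i < s / 2 ^ j / 2}"
      by (simp flip: cofinite_eq_sequentially add: eventually_cofinite)
    moreover have "A j \<subseteq> {i. \<not> t i < s / 2 ^ j / 2}"
    proof clarify
      fix i assume i: "i \<in> A j" "t i < s / 2 ^ j / 2"
      have "s / 2 ^ j \<le> s / 2 ^ k i" using i(1) s by (intro divide_left_mono power_increasing) (auto simp: A_def)
      then show False using k(2)[of i] i by (simp add: A_def)
    qed
    ultimately show ?thesis by (rule rev_finite_subset)
  qed
  have A_ge: "A j \<subseteq> {N..}" for j by (auto simp: A_def N'_def)
  \<comment> \<open>Invariant before level \<open>j\<close>: the members in \<open>A j\<close> fill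
    \<open>U\<close> exactly, and the free part \<open>V\<close> is cut into cells of side s /
    2^j.\<close>
  have state: "\<exists>G q U V. tiles (A j) q \<sigma> U \<and> tiles G (\<lambda>g. g) (\<lambda>_. s / 2 ^ j) V \<and> U \<inter> V = {} \<and> U \<union> V = hcube p s" for j
  proof (induction j)
    case 0
    show ?case by (intro exI[of _ "{p}"] exI[of _ "{}"] exI[of _ "hcube p s"]) (auto simp: A_def tiles_def disjoint_family_on_def)
  next
    case (Suc j)
    then obtain G q U V where st: "tiles (A j) q \<sigma> U" "tiles G (\<lambda>g. g) (\<lambda>_. s / 2 ^ j) V" 
      "U \<inter> V = {}" "U \<union> V = hcube p s" by blast
    define L where "L = {i. N' \<le> i \<and> k i = j}"
    have AS: "A (Suc j) = A j \<union> L" by (auto simp: A_def L_def)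
    have dis: "A j \<inter> L = {}" by (auto simp: A_def L_def)
    have finL: "finite L" using finA[of "Suc j"] AS by simp
    have \<sigma>L: "\<sigma> i = s / 2 ^ j" if "i \<in> L" for i using that by (simp add: \<sigma>_def L_def)
    have finG: "finite G" using st(2) by (simp add: tiles_def)
    show ?case
    proof (cases "card G \<le> card L")
      \<comment> \<open>Level \<open>j\<close> has a member for every free cell, which completes a
        tiling of the kind excluded by \<open>neg\<close>.\<close>
      case True
      then obtain f where f: "f ` G \<subseteq> L" "inj_on f G" using card_le_inj[OF finG finL] by blast
      define q' where "q' i = (if i \<in> L then inv_into G f i else q i)" for i
      have "tiles G (\<lambda>g. q' (f g)) (\<lambda>g. \<sigma> (f g)) V = tiles G (\<lambda>g. g) (\<lambda>_. s / 2 ^ j) V"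
        using f \<sigma>L by (intro tiles_cong) (auto simp: q'_def image_subset_iff)
      then have "tiles (f ` G) q' \<sigma> V" using st(2) by (intro tiles_reindex) simp
      moreover have "tiles (A j) q' \<sigma> U = tiles (A j) q \<sigma> U"
        using dis by (intro tiles_cong) (auto simp: q'_def)
      ultimately have "tiles (A j \<union> f ` G) q' \<sigma> (hcube p s)"
        using tiles_Un[of "A j" q' \<sigma> U "f ` G" V] st by simp
      moreover have sub: "A j \<union> f ` G \<subseteq> A (Suc j)" using f AS by auto
      moreover have "t i \<le> \<sigma> i \<and> \<sigma> i < 2 * t i" if "i \<in> A (Suc j)" for i
        using that k[of i] by (simp add: A_def \<sigma>_def)
      ultimately have "A j \<union> f ` G \<subseteq> {N..} \<and> (\<forall>i\<in>A j \<union> f ` G. t i \<le> \<sigma> i \<and> \<sigma> i < 2 * t i) \<and>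
          tiles (A j \<union> f ` G) q' \<sigma> (hcube p s)"
        using subset_trans[OF sub A_ge] by blast
      then have "\<exists>I (q :: nat \<Rightarrow> 'a) \<sigma>. I \<subseteq> {N..} \<and> (\<forall>i\<in>I. t i \<le> \<sigma> i \<and> \<sigma> i < 2 * t i) \<and> tiles I q \<sigma> (hcube p s)"
        by (intro exI)
      with neg show ?thesis by (rule notE)
    next
      case False
      then obtain f where f: "f ` L \<subseteq> G" "inj_on f L" using card_le_inj[OF finL finG] by auto
      define q' where "q' i = (if i \<in> L then f i else q i)" for i
      define V1 where "V1 = (\<Union>g\<in>f ` L. hcube g (s / 2 ^ j))"
      have T1: "tiles (f ` L) (\<lambda>g. g) (\<lambda>_. s / 2 ^ j) V1" "tiles (G - f ` L) (\<lambda>g. g) (\<lambda>_. s / 2 ^ j) (V - V1)"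
        using tiles_subset[OF st(2) f(1)] by (simp_all add: V1_def)
      have V1: "V1 \<subseteq> V" using st(2) f(1) by (auto simp: V1_def tiles_def)
      have "tiles L q' \<sigma> V1 = tiles L f (\<lambda>_. s / 2 ^ j) V1"
        using \<sigma>L by (intro tiles_cong) (auto simp: q'_def)
      also have "\<dots>" using T1(1) finL f(2) unfolding tiles_def disjoint_family_on_def by (auto dest: inj_onD)
      finally have "tiles L q' \<sigma> V1" .
      moreover have "tiles (A j) q' \<sigma> U = tiles (A j) q \<sigma> U"
        using dis by (intro tiles_cong) (auto simp: q'_def)
      ultimately have "tiles (A (Suc j)) q' \<sigma> (U \<union> V1)"
        unfolding AS using st V1 by (intro tiles_Un) auto
      moreover have "\<exists>G'. tiles G' (\<lambda>g. g) (\<lambda>_. s / 2 ^ Suc j) (V - V1)"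
        using T1(2) s by (intro tiles_refine) auto
      moreover have "(U \<union> V1) \<inter> (V - V1) = {}" "(U \<union> V1) \<union> (V - V1) = hcube p s"
        using st V1 by auto
      ultimately show ?thesis by blast
    qed
  qed
  have "(\<Sum>i\<in>A j. t i ^ DIM('a)) \<le> s ^ DIM('a)" for j
  proof -
    obtain q :: "nat \<Rightarrow> 'a" and U where U: "tiles (A j) q \<sigma> U" "U \<subseteq> hcube p s" using state[of j] by blast
    have "(\<Sum>i\<in>A j. t i ^ DIM('a)) \<le> (\<Sum>i\<in>A j. \<sigma> i ^ DIM('a))"
      using k(1) t(1) by (intro sum_mono power_mono) (auto simp: \<sigma>_def A_def less_imp_le)
    also have "\<dots> = measure lebesgue U" using tiles_measure[OF U(1)] \<sigma>0 by (simp add: less_imp_le)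
    also have "\<dots> \<le> measure lebesgue (hcube p s)"
    proof (rule measure_mono_fmeasurable[OF U(2)])
      have "(\<Union>i\<in>A j. hcube (q i) (\<sigma> i)) \<in> sets lebesgue" using finA
        by (intro sets.finite_UN) (auto intro: fmeasurableD)
      moreover have "(\<Union>i\<in>A j. hcube (q i) (\<sigma> i)) = U" using U(1) unfolding tiles_def by blast
      ultimately show "U \<in> sets lebesgue" by simp
    qed simp
    also have "\<dots> = s ^ DIM('a)" using s by simp
    finally show ?thesis .
  qed
  then have bound: "(\<Sum>i<n. t (i + N') ^ DIM('a)) \<le> s ^ DIM('a)" for n
  proof -
    \<comment> \<open>Exceeds the levels of the first \<open>n\<close> late members, so all of them
      have been placed before level \<open>j\<close>.\<close>
    define j where "j = Suc (Max (insert 0 (k ` {N'..<n + N'})))"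
    have "k i < j" if "N' \<le> i" "i < n + N'" for i
      unfolding j_def less_Suc_eq_le using that by (intro Max_ge) auto
    then have sub: "{N'..<n + N'} \<subseteq> A j" by (auto simp: A_def)
    have "(\<Sum>i<n. t (i + N') ^ DIM('a)) = (\<Sum>i\<in>{N'..<n + N'}. t i ^ DIM('a))"
      using sum.shift_bounds_nat_ivl[of "\<lambda>i. t i ^ DIM('a)" 0 N' n] by (simp add: lessThan_atLeast0 add.commute)
    also have "\<dots> \<le> (\<Sum>i\<in>A j. t i ^ DIM('a))"
      using finA sub t(1) by (intro sum_mono2) (auto simp: less_imp_le)
    also have "\<dots> \<le> s ^ DIM('a)" by fact
    finally show ?thesis .
  qed
  have "summable (\<lambda>i. t (i + N') ^ DIM('a))"
    using t(1) bound by (intro summableI_nonneg_bounded[of _ "s ^ DIM('a)"]) (auto simp: less_imp_le)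
  then show False using div by (simp add: summable_iff_shift[of "\<lambda>i. t i ^ DIM('a)"])
qed

section \<open>Admissible constants for covering cubes by small members\<close>

definition coverable :: "'a::euclidean_space set \<Rightarrow> (nat \<Rightarrow> real) \<Rightarrow> nat \<Rightarrow> 'a set \<Rightarrow> real \<Rightarrow> bool" where
  "coverable K lam N U c \<longleftrightarrow> (\<exists>I x. finite I \<and> I \<subseteq> {N..} \<and>
     U \<subseteq> (\<Union>i\<in>I. transl_homothet (x i) (lam i) K) \<and>
     (\<Sum>i\<in>I. lam i ^ DIM('a) * measure lebesgue K) \<le> c)"

lemma coverable_mono:
  fixes K :: "'a::euclidean_space set"
  assumes "coverable K lam N U c" "V \<subseteq> U" "c \<le> d"
  shows "coverable K lam N V d"
proof -
  obtain I x where I: "finite I" "I \<subseteq> {N..}" "U \<subseteq> (\<Union>i\<in>I. transl_homothet (x i) (lam i) K)"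
    "(\<Sum>i\<in>I. lam i ^ DIM('a) * measure lebesgue K) \<le> c"
    using assms(1) unfolding coverable_def by (elim exE conjE)
  then show ?thesis unfolding coverable_def
    using subset_trans[OF assms(2) I(3)] order_trans[OF I(4) assms(3)] by (intro exI conjI)
qed

text \<open>The second hypothesis holds for every starting index, so the members for
  \<open>V\<close> can be taken beyond those used for \<open>U\<close>.\<close>

lemma coverable_Un:
  fixes K :: "'a::euclidean_space set"
  assumes "coverable K lam N U c" "\<And>N. coverable K lam N V d"
  shows "coverable K lam N (U \<union> V) (c + d)"
proof -
  obtain I x where I: "finite I" "I \<subseteq> {N..}" "U \<subseteq> (\<Union>i\<in>I. transl_homothet (x i) (lam i) K)"
    "(\<Sum>i\<in>I. lam i ^ DIM('a) * measure lebesgue K) \<le> c"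
    using assms(1) unfolding coverable_def by (elim exE conjE)
  define N' where "N' = Suc (Max (insert N I))"
  have N': "i < N'" if "i \<in> insert N I" for i
    unfolding N'_def less_Suc_eq_le using I(1) that by (intro Max_ge) auto
  have "coverable K lam N' V d" by (rule assms(2))
  then obtain J y where J: "finite J" "J \<subseteq> {N'..}" "V \<subseteq> (\<Union>i\<in>J. transl_homothet (y i) (lam i) K)"
    "(\<Sum>i\<in>J. lam i ^ DIM('a) * measure lebesgue K) \<le> d"
    unfolding coverable_def by (elim exE conjE)
  have dis: "I \<inter> J = {}" using N' J(2) by fastforce
  define z where "z i = (if i \<in> I then x i else y i)" for i
  have zI: "z i = x i" if "i \<in> I" for i using that by (simp add: z_def)
  have zJ: "z i = y i" if "i \<in> J" for i using that dis by (auto simp: z_def)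
  have "U \<union> V \<subseteq> (\<Union>i\<in>I \<union> J. transl_homothet (z i) (lam i) K)"
    using I(3) J(3) zI zJ by (auto simp: UN_Un)
  moreover have "I \<union> J \<subseteq> {N..}" using I(2) J(2) N'[of N] by force
  moreover have "(\<Sum>i\<in>I \<union> J. lam i ^ DIM('a) * measure lebesgue K) \<le> c + d"
    using I J dis by (simp add: sum.union_disjoint)
  ultimately show ?thesis unfolding coverable_def using I(1) J(1) by (intro exI[of _ "I \<union> J"] exI[of _ z]) auto
qed

lemma coverable_hcubes:
  fixes K :: "'a::euclidean_space set" and c :: real
  assumes "\<And>p N. coverable K lam N (hcube p s) c" "finite G"
  shows "coverable K lam N (\<Union>g\<in>G. hcube g s) (card G * c)"
  using assms(2)
proof (induction arbitrary: N)
  case empty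
  show ?case unfolding coverable_def by (intro exI[of _ "{}"]) auto
next
  case (insert g G)
  have "coverable K lam N (hcube g s \<union> (\<Union>g\<in>G. hcube g s)) (c + card G * c)"
    using assms(1) insert.IH by (rule coverable_Un)
  with insert.hyps show ?case by (simp add: algebra_simps)
qed

text \<open>There is no threshold on \<open>s\<close>, unlike in \<open>cubes_coverable\<close>: the
  fine grid cubes left over by a packing have to be covered at the same rate. This is what makes the
  property self-improving.\<close>

definition economical :: "'a::euclidean_space set \<Rightarrow> (nat \<Rightarrow> real) \<Rightarrow> real \<Rightarrow> bool" where
  "economical K lam \<alpha> \<longleftrightarrow> (\<forall>s>0. \<forall>p N. coverable K lam N (hcube p s) (\<alpha> * s ^ DIM('a)))"

lemma economical_mono:
  fixes K :: "'a::euclidean_space set"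
  assumes "economical K lam \<alpha>" "\<alpha> \<le> \<beta>"
  shows "economical K lam \<beta>"
  unfolding economical_def
proof (intro allI impI)
  fix s :: real and p and N assume s: "s > 0"
  show "coverable K lam N (hcube p s) (\<beta> * s ^ DIM('a))"
  proof (rule coverable_mono[OF _ order_refl])
    show "coverable K lam N (hcube p s) (\<alpha> * s ^ DIM('a))"
      using assms(1) s unfolding economical_def by blast
    show "\<alpha> * s ^ DIM('a) \<le> \<beta> * s ^ DIM('a)" using assms(2) s by (intro mult_right_mono) auto
  qed
qed

locale null_homothets =
  fixes K :: "'a::euclidean_space set" and lam :: "nat \<Rightarrow> real"
  assumes K: "convex_body K" and lam: "\<And>i. lam i > 0" "lam \<longlonglongrightarrow> 0"
    and div: "\<not> summable (\<lambda>i. lam i ^ DIM('a))"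
begin

text \<open>The factor \<open>c\<close> decides the use: a small one gives tiles contained in the
  members, for covering, and a large one gives tiles containing them, for packing.\<close>

lemma tile_hcube_scaled:
  assumes "c > 0" "s > 0"
  shows "\<exists>I (q :: nat \<Rightarrow> 'a) \<sigma>. I \<subseteq> {N..} \<and> (\<forall>i\<in>I. c * lam i \<le> \<sigma> i \<and> \<sigma> i < 2 * (c * lam i)) \<and> tiles I q \<sigma> (hcube p s)"
proof (rule tile_hcube_by_null_sequence)
  show "(\<lambda>i. c * lam i) \<longlonglongrightarrow> 0" using tendsto_mult_right_zero[OF lam(2)] by simp
  show "\<not> summable (\<lambda>i. (c * lam i) ^ DIM('a))"
    using div assms(1) by (simp add: power_mult_distrib)
qed (use lam assms in auto)

lemma economical_ex: "\<exists>\<alpha>\<ge>1. economical K lam \<alpha>"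
proof -
  obtain q0 a where a: "a > 0" "hcube q0 a \<subseteq> K" by (rule convex_body_inner_hcube[OF K])
  define v where "v = measure lebesgue K"
  have v: "v > 0" using convex_body_measure_pos[OF K] by (simp add: v_def)
  \<comment> \<open>With factor a / 2 a tile has side less than \<open>a * lam i\<close> and fits
    into the cube inscribed in the member, while \<open>lam i\<close> is at most 2 / a times the
    side.\<close>
  define \<alpha> where "\<alpha> = (2 / a) ^ DIM('a) * v"
  have "coverable K lam N (hcube p s) (\<alpha> * s ^ DIM('a))" if s: "s > 0" for s p N
  proof -
    obtain I and q :: "nat \<Rightarrow> 'a" and \<sigma> where I: "I \<subseteq> {N..}" 
      "\<forall>i\<in>I. a / 2 * lam i \<le> \<sigma> i \<and> \<sigma> i < 2 * (a / 2 * lam i)" "tiles I q \<sigma> (hcube p s)"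
      using tile_hcube_scaled[of "a / 2" s N p] a s by auto
    define x where "x i = q i - lam i *\<^sub>R q0" for i
    have "hcube (q i) (\<sigma> i) \<subseteq> transl_homothet (x i) (lam i) K" if "i \<in> I" for i
    proof -
      have "hcube (q i) (\<sigma> i) \<subseteq> hcube (q i) (lam i * a)"
        using I(2) that by (fastforce simp: hcube_def algebra_simps)
      also have "\<dots> = transl_homothet (x i) (lam i) (hcube q0 a)"
        using lam by (simp add: transl_homothet_hcube x_def)
      also have "\<dots> \<subseteq> transl_homothet (x i) (lam i) K" using a(2) by (rule transl_homothet_mono)
      finally show ?thesis .
    qed
    then have "hcube p s \<subseteq> (\<Union>i\<in>I. transl_homothet (x i) (lam i) K)"
      using I(3) unfolding tiles_def by blast
    moreover have "(\<Sum>i\<in>I. lam i ^ DIM('a) * v) \<le> \<alpha> * s ^ DIM('a)"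
    proof -
      have "(\<Sum>i\<in>I. lam i ^ DIM('a) * v) \<le> (\<Sum>i\<in>I. (2 / a * \<sigma> i) ^ DIM('a) * v)"
        using I(2) lam a v by (intro sum_mono mult_right_mono power_mono) (auto simp: field_simps less_imp_le)
      also have "\<dots> = \<alpha> * (\<Sum>i\<in>I. \<sigma> i ^ DIM('a))"
        unfolding \<alpha>_def sum_distrib_left by (intro sum.cong) (auto simp: power_mult_distrib power_divide)
      also have "(\<Sum>i\<in>I. \<sigma> i ^ DIM('a)) = measure lebesgue (hcube p s)"
        using I(2) lam(1) a by (intro tiles_measure[OF I(3), symmetric]) (smt (verit) mult_pos_pos half_gt_zero)
      finally show ?thesis using s by simp
    qed
    ultimately show ?thesis using I unfolding coverable_def v_def tiles_def by blast
  qed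
  then have "economical K lam \<alpha>" unfolding economical_def by blast
  then have "economical K lam (max 1 \<alpha>)" by (rule economical_mono) simp
  then show ?thesis by (intro exI[of _ "max 1 \<alpha>"]) auto
qed

text \<open>Here \<open>c\<close> is a lower bound for the fraction of the cube that the first packing fills.\<close>

lemma economical_step:
  "\<exists>c>0. c \<le> 1 \<and> (\<forall>\<alpha>\<ge>1. \<forall>\<eta>>0. economical K lam \<alpha> \<longrightarrow> economical K lam (c + \<alpha> * (1 - c + \<eta>)))"
proof -
  have cK: "compact K" and convK: "convex K" using K by (auto simp: convex_body_def)
  obtain q0 b where b: "b > 0" "K \<subseteq> hcube q0 b" using bounded_subset_hcube[OF compact_imp_bounded[OF cK]] by blast
  define v where "v = measure lebesgue K"
  have v: "v > 0" using convex_body_measure_pos[OF K] by (simp add: v_def)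
  \<comment> \<open>With factor \<open>b\<close> each tile contains its member and has side less
    than \<open>2 * b * lam i\<close>, so the member fills at least this fraction of the
    tile.\<close>
  define c where "c = v / (2 * b) ^ DIM('a)"
  have "v \<le> measure lebesgue (hcube q0 b)"
    unfolding v_def using b(2) lmeasurable_compact[OF cK] by (intro measure_mono_fmeasurable) auto
  then have "v \<le> b ^ DIM('a)" using b(1) by simp
  also have "\<dots> \<le> (2 * b) ^ DIM('a)" using b(1) by (intro power_mono) auto
  finally have c: "c > 0" "c \<le> 1" using v b(1) by (auto simp: c_def)
  have "coverable K lam N (hcube p s) ((c + \<alpha> * (1 - c + \<eta>)) * s ^ DIM('a))"
    if \<alpha>: "\<alpha> \<ge> 1" "economical K lam \<alpha>" and \<eta>: "\<eta> > 0" and s: "s > 0" for \<alpha> \<eta> s p N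
  proof -
    obtain I and q :: "nat \<Rightarrow> 'a" and \<sigma> where I: "I \<subseteq> {N..}" 
      "\<forall>i\<in>I. b * lam i \<le> \<sigma> i \<and> \<sigma> i < 2 * (b * lam i)" "tiles I q \<sigma> (hcube p s)"
      using tile_hcube_scaled[of b s N p] b s by auto
    have finI: "finite I" using I(3) by (simp add: tiles_def)
    define x where "x i = q i - lam i *\<^sub>R q0" for i
    define C where "C i = transl_homothet (x i) (lam i) K" for i
    have C_sub: "C i \<subseteq> hcube (q i) (\<sigma> i)" if "i \<in> I" for i
    proof -
      have "C i \<subseteq> transl_homothet (x i) (lam i) (hcube q0 b)" 
        unfolding C_def using b(2) by (rule transl_homothet_mono)
      also have "\<dots> = hcube (q i) (lam i * b)"
        using lam by (simp add: transl_homothet_hcube x_def)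
      also have "\<dots> \<subseteq> hcube (q i) (\<sigma> i)"
        using I(2) that by (fastforce simp: hcube_def algebra_simps)
      finally show ?thesis .
    qed
    have mC: "measure lebesgue (C i) = lam i ^ DIM('a) * v" for i
      using lam(1)[of i] by (simp add: C_def measure_transl_homothet v_def)
    have convC: "convex (C i)" and compC: "compact (C i)" for i
      using convK cK by (simp_all add: C_def transl_homothet_def convex_affinity compact_affinity)
    \<comment> \<open>Interiors are removed so that the remainder \<open>W\<close> is compact, as
      \<open>grid_cover_compact\<close> demands; the frontier of a convex set is negligible, so no
      volume is lost.\<close>
    have mint: "measure lebesgue (interior (C i)) = lam i ^ DIM('a) * v" for i
      using measure_interior[OF compact_imp_bounded[OF compC] negligible_convex_frontier[OF convC]] mC by simp
    have dis: "disjoint_family_on (\<lambda>i. interior (C i)) I"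
      using I(3) C_sub interior_subset unfolding tiles_def disjoint_family_on_def by blast
    define S where "S = (\<Sum>i\<in>I. lam i ^ DIM('a) * v)"
    let ?O = "\<Union>i\<in>I. interior (C i)"
    have mO: "measure lebesgue ?O = S"
    proof -
      have ilm: "interior (C i) \<in> lmeasurable" for i
        using bounded_subset[OF compact_imp_bounded[OF compC] interior_subset] lmeasurable_open by blast
      have "measure lebesgue ?O = (\<Sum>i\<in>I. measure lebesgue (interior (C i)))"
      proof (rule measure_finite_Union[OF finI _ dis])
        show "(\<lambda>i. interior (C i)) ` I \<subseteq> sets lebesgue" using fmeasurableD[OF ilm] by blast
        show "emeasure lebesgue (interior (C i)) \<noteq> \<infinity>" for i
          unfolding infinity_ennreal_def by (rule fmeasurableD2[OF ilm])
      qed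
      then show ?thesis unfolding mint S_def .
    qed
    have O_sub: "?O \<subseteq> cbox p (p + s *\<^sub>R One)"
    proof -
      have "?O \<subseteq> (\<Union>i\<in>I. hcube (q i) (\<sigma> i))" using C_sub interior_subset by blast
      also have "\<dots> \<subseteq> cbox p (p + s *\<^sub>R One)" using I(3) hcube_subset_cbox by (simp add: tiles_def)
      finally show ?thesis .
    qed
    have openO: "open ?O" by blast
    define W where "W = cbox p (p + s *\<^sub>R One) - ?O"
    have cW: "compact W" unfolding W_def using openO by (intro compact_diff compact_cbox)
    have Olm: "?O \<in> lmeasurable"
      using openO bounded_subset[OF bounded_cbox O_sub] by (rule lmeasurable_open[rotated])
    have mW: "measure lebesgue W = s ^ DIM('a) - S"
      unfolding W_def mO[symmetric] using O_sub Olm s measure_cube(1)[of s p]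
      by (subst measurable_measure_Diff) (auto simp: fmeasurableD)
    have "\<eta> * s ^ DIM('a) > 0" using \<eta> s by simp
    then obtain h G where G: "h > 0" "finite G" "W \<subseteq> (\<Union>g\<in>G. hcube g h)"
      "real (card G) * h ^ DIM('a) \<le> measure lebesgue W + \<eta> * s ^ DIM('a)"
      using grid_cover_compact[OF cW] by blast
    have "coverable K lam N (\<Union>i\<in>I. C i) S"
      unfolding coverable_def S_def C_def v_def using finI I(1) by (intro exI[of _ I] exI[of _ x]) auto
    moreover have "coverable K lam N (\<Union>g\<in>G. hcube g h) (card G * (\<alpha> * h ^ DIM('a)))" for N
      using \<alpha>(2) G(1,2) unfolding economical_def by (intro coverable_hcubes) auto
    ultimately have cov: "coverable K lam N ((\<Union>i\<in>I. C i) \<union> (\<Union>g\<in>G. hcube g h)) (S + card G * (\<alpha> * h ^ DIM('a)))"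
      by (rule coverable_Un)
    show ?thesis
    proof (rule coverable_mono[OF cov])
      have "cbox p (p + s *\<^sub>R One) \<subseteq> (\<Union>i\<in>I. C i) \<union> W"
        using interior_subset unfolding W_def by blast
      then show "hcube p s \<subseteq> (\<Union>i\<in>I. C i) \<union> (\<Union>g\<in>G. hcube g h)"
        using G(3) hcube_subset_cbox[of p s] by blast
      have "c * s ^ DIM('a) \<le> S"
      proof -
        have "c * s ^ DIM('a) = c * (\<Sum>i\<in>I. \<sigma> i ^ DIM('a))"
        proof -
          have "(\<Sum>i\<in>I. \<sigma> i ^ DIM('a)) = measure lebesgue (hcube p s)"
            using I(2) lam(1) b by (intro tiles_measure[OF I(3), symmetric]) (smt (verit) mult_pos_pos)
          then show ?thesis using s by simp
        qed
        also have "\<dots> \<le> c * (\<Sum>i\<in>I. (2 * b * lam i) ^ DIM('a))"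
        proof (intro mult_left_mono sum_mono power_mono)
          fix i assume i: "i \<in> I"
          then have "b * lam i \<le> \<sigma> i" "\<sigma> i < 2 * (b * lam i)" using I(2) by auto
          moreover have "0 < b * lam i" using lam(1) b by simp
          ultimately show "\<sigma> i \<le> 2 * b * lam i" "0 \<le> \<sigma> i" by auto
        qed (use c in auto)
        also have "\<dots> = S"
          unfolding S_def c_def sum_distrib_left using b by (intro sum.cong) (auto simp: power_mult_distrib)
        finally show ?thesis .
      qed
      \<comment> \<open>As \<alpha> is at least 1, S + \<alpha> (s^d - S) does not increase with
        \<open>S\<close>; the worst case is the guaranteed share c s^d.\<close>
      then have "S + \<alpha> * (s ^ DIM('a) - S) \<le> c * s ^ DIM('a) + \<alpha> * (s ^ DIM('a) - c * s ^ DIM('a))"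
        using mult_right_mono[of "c * s ^ DIM('a)" S "\<alpha> - 1"] \<alpha>(1) by (simp add: algebra_simps)
      moreover have "card G * (\<alpha> * h ^ DIM('a)) \<le> \<alpha> * (s ^ DIM('a) - S + \<eta> * s ^ DIM('a))"
        using mult_left_mono[OF G(4)[unfolded mW], of \<alpha>] \<alpha>(1) by (simp add: algebra_simps)
      ultimately show "S + card G * (\<alpha> * h ^ DIM('a)) \<le> (c + \<alpha> * (1 - c + \<eta>)) * s ^ DIM('a)"
        by (simp add: algebra_simps)
    qed
  qed
  then show ?thesis using c unfolding economical_def by blast
qed

text \<open>If the infimum of the admissible constants exceeded 1, a step from an admissible
  constant close to it would land below it.\<close>

lemma economical_all:
  assumes "\<alpha> > 1" shows "economical K lam \<alpha>"
proof -
  define E where "E = {\<alpha>. \<alpha> \<ge> 1 \<and> economical K lam \<alpha>}"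
  define m where "m = Inf E"
  have ne: "E \<noteq> {}" using economical_ex by (auto simp: E_def)
  have bdd: "bdd_below E" by (rule bdd_belowI[of _ 1]) (auto simp: E_def)
  have m1: "m \<ge> 1" unfolding m_def using ne by (intro cInf_greatest) (auto simp: E_def)
  obtain c where c: "c > 0" "c \<le> 1" 
    "\<And>\<alpha> \<eta>. \<alpha> \<ge> 1 \<Longrightarrow> \<eta> > 0 \<Longrightarrow> economical K lam \<alpha> \<Longrightarrow> economical K lam (c + \<alpha> * (1 - c + \<eta>))"
    using economical_step by blast
  have "m \<le> 1"
  proof (rule ccontr)
    assume "\<not> m \<le> 1"
    \<comment> \<open>The gain m - (c + (1 - c) m) of an ideal step at \<open>m\<close>. Starting
      slightly above \<open>m\<close> and the error \<open>\<eta>\<close> cost at most g / 4 each;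
      the cap 1 below keeps \<open>\<beta>\<close> under m + 1, as the choice of
      \<open>\<eta>\<close> presupposes.\<close>
    define g where "g = c * (m - 1)"
    have g: "g > 0" using c \<open>\<not> m \<le> 1\<close> by (simp add: g_def)
    have "m < m + min 1 (g / 4)" using g by simp
    then obtain \<beta> where \<beta>: "\<beta> \<in> E" "\<beta> < m + min 1 (g / 4)" unfolding m_def using cInf_lessD[OF ne] by blast
    have \<beta>1: "\<beta> \<ge> 1" "economical K lam \<beta>" using \<beta> by (auto simp: E_def)
    define \<eta> where "\<eta> = g / 4 / (m + 1)"
    have \<eta>: "\<eta> > 0" using g m1 by (simp add: \<eta>_def)
    have "c + \<beta> * (1 - c + \<eta>) \<ge> c + 1 * (1 - c + \<eta>)" using \<beta>1 c \<eta> by (intro add_left_mono mult_right_mono) auto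
    then have "c + \<beta> * (1 - c + \<eta>) \<in> E" using c(3)[OF \<beta>1(1) \<eta> \<beta>1(2)] \<eta> by (simp add: E_def)
    then have "m \<le> c + \<beta> * (1 - c + \<eta>)" unfolding m_def using bdd by (intro cInf_lower)
    moreover have "c + \<beta> * (1 - c + \<eta>) = c + (1 - c) * \<beta> + \<beta> * \<eta>" by (simp add: algebra_simps)
    moreover have "\<beta> * \<eta> \<le> (m + 1) * \<eta>" using \<beta> \<eta> by (intro mult_right_mono) auto
    moreover have "(m + 1) * \<eta> = g / 4"
      unfolding \<eta>_def by (subst times_divide_eq_right, rule nonzero_mult_div_cancel_left) (use m1 in linarith)
    moreover have "(1 - c) * \<beta> \<le> (1 - c) * (m + g / 4)" using \<beta> c by (intro mult_left_mono) auto
    moreover have "(1 - c) * (m + g / 4) = m - c * m + (1 - c) * (g / 4)" by (simp add: algebra_simps)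
    moreover have "(1 - c) * (g / 4) \<le> 1 * (g / 4)" using c g by (intro mult_right_mono) auto
    moreover have "g = c * m - c" by (simp add: g_def algebra_simps)
    ultimately show False using g by linarith
  qed
  then have "Inf E < \<alpha>" using assms m_def by simp
  then obtain \<beta> where \<beta>: "\<beta> \<in> E" "\<beta> < \<alpha>" using cInf_lessD[OF ne] by blast
  then show ?thesis using economical_mono[of K lam \<beta> \<alpha>] by (auto simp: E_def)
qed

text \<open>For density one the lower bound is automatic: sets covering a cube have at least its
  volume.\<close>

lemma covering_density_one:
  "\<exists>x :: nat \<Rightarrow> 'a. covers (\<lambda>i. transl_homothet (x i) (lam i) K) UNIV
    \<and> covering_density (\<lambda>i. transl_homothet (x i) (lam i) K) = 1"
proof -
  have cK: "compact K" using K by (simp add: convex_body_def)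
  have "Bseq lam" using lam(2) by (intro convergent_imp_Bseq) (auto simp: convergent_def)
  then obtain L where L: "\<And>i. norm (lam i) \<le> L" unfolding Bseq_def by blast
  have L': "lam i \<le> L" for i using L[of i] by simp
  have "\<exists>x :: nat \<Rightarrow> 'a. covers (\<lambda>i. transl_homothet (x i) (lam i) K) UNIV
    \<and> covering_density (\<lambda>i. transl_homothet (x i) (lam i) K) = ennreal 1"
  proof (rule exact_density_covering[where K = K and lam = lam and L = L and \<theta> = 1])
    fix e :: real assume e: "e > 0"
    show "\<exists>A. \<forall>h\<ge>A. \<forall>p N. \<exists>I x. finite I \<and> I \<subseteq> {N..} \<and>
      hcube p h \<subseteq> (\<Union>i\<in>I. transl_homothet (x i) (lam i) K) \<and>
      1 * h ^ DIM('a) \<le> (\<Sum>i\<in>I. lam i ^ DIM('a) * measure lebesgue K) \<and>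
      (\<Sum>i\<in>I. lam i ^ DIM('a) * measure lebesgue K) \<le> (1 + e) * h ^ DIM('a)"
    proof (rule exI[of _ 1], intro allI impI)
      fix h :: real and p :: 'a and N assume h: "1 \<le> h"
      have "coverable K lam N (hcube p h) ((1 + e) * h ^ DIM('a))"
        using economical_all[of "1 + e"] e h unfolding economical_def by auto
      then obtain I x where I: "finite I" "I \<subseteq> {N..}" 
        "hcube p h \<subseteq> (\<Union>i\<in>I. transl_homothet (x i) (lam i) K)"
        "(\<Sum>i\<in>I. lam i ^ DIM('a) * measure lebesgue K) \<le> (1 + e) * h ^ DIM('a)"
        unfolding coverable_def by (elim exE conjE)
      have "h ^ DIM('a) = measure lebesgue (hcube p h)" using h by simp
      also have "\<dots> \<le> measure lebesgue (\<Union>i\<in>I. transl_homothet (x i) (lam i) K)"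
        using I(1,3) lmeasurable_transl_homothet[OF cK]
        by (intro measure_mono_fmeasurable fmeasurable.finite_UN) auto
      also have "\<dots> \<le> (\<Sum>i\<in>I. measure lebesgue (transl_homothet (x i) (lam i) K))"
        using I(1) lmeasurable_transl_homothet[OF cK] by (intro measure_UNION_le) (auto dest: fmeasurableD)
      also have "\<dots> = (\<Sum>i\<in>I. lam i ^ DIM('a) * measure lebesgue K)"
        using lam(1) by (intro sum.cong) (auto simp: measure_transl_homothet abs_of_pos)
      finally show "\<exists>I x. finite I \<and> I \<subseteq> {N..} \<and>
        hcube p h \<subseteq> (\<Union>i\<in>I. transl_homothet (x i) (lam i) K) \<and>
        1 * h ^ DIM('a) \<le> (\<Sum>i\<in>I. lam i ^ DIM('a) * measure lebesgue K) \<and>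
        (\<Sum>i\<in>I. lam i ^ DIM('a) * measure lebesgue K) \<le> (1 + e) * h ^ DIM('a)"
        using I by (intro exI[of _ I] exI[of _ x]) auto
    qed
  qed (use K lam L' in auto)
  then show ?thesis by simp
qed

end

text \<open>The points of the bounding interval at distance at least \<open>e\<close> from 0 form a
  compact set; it is covered by finitely many balls, each of which the sequence eventually
  avoids.\<close>

lemma tendsto_zero_if_no_other_limit_point:
  fixes f :: "nat \<Rightarrow> real"
  assumes "bounded (range f)"
    and "\<And>l. l \<noteq> 0 \<Longrightarrow> \<exists>e>0. \<not> frequently (\<lambda>i. dist (f i) l < e) sequentially"
  shows "f \<longlonglongrightarrow> 0"
proof (rule tendstoI)
  fix e :: real assume e: "e > 0"
  obtain L where "\<forall>x\<in>range f. norm x \<le> L" using assms(1) unfolding bounded_iff by (elim exE)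
  then have L: "norm (f i) \<le> L" for i by simp
  define X where "X = cball 0 L - ball (0::real) e"
  have "compact X" unfolding X_def by (intro compact_diff) auto
  have "\<exists>d>0. \<forall>\<^sub>F i in sequentially. f i \<notin> ball l d" if "l \<in> X" for l
  proof -
    have "l \<noteq> 0" using that e by (auto simp: X_def)
    then obtain d where "d > 0" "\<not> frequently (\<lambda>i. dist (f i) l < d) sequentially" using assms(2) by blast
    then show ?thesis by (auto simp: not_frequently dist_commute)
  qed
  then obtain d where d: "\<And>l. l \<in> X \<Longrightarrow> d l > 0" "\<And>l. l \<in> X \<Longrightarrow> \<forall>\<^sub>F i in sequentially. f i \<notin> ball l (d l)"
    by metis
  have "X \<subseteq> (\<Union>l\<in>X. ball l (d l))" using d(1) by force
  then obtain F where F: "F \<subseteq> X" "finite F" "X \<subseteq> (\<Union>l\<in>F. ball l (d l))"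
    using compactE_image[OF \<open>compact X\<close>, of X "\<lambda>l. ball l (d l)"] by auto
  have "\<forall>\<^sub>F i in sequentially. \<forall>l\<in>F. f i \<notin> ball l (d l)"
    using F(1,2) d(2) by (intro eventually_ball_finite) auto
  then show "\<forall>\<^sub>F i in sequentially. dist (f i) 0 < e"
  proof eventually_elim
    case (elim i)
    then have "f i \<notin> X" using F(3) by blast
    with L[of i] show ?case by (auto simp: X_def dist_commute)
  qed
qed

section \<open>Unbounded families\<close>

text \<open>Inner unit normals at boundary points \<open>p\<close> that are touched by a ball inside
  \<open>K\<close>. The supporting half-space bounds a magnified copy from outside, the ball from
  inside.\<close>

definition inner_ball_normals :: "'a::euclidean_space set \<Rightarrow> 'a set" where
  "inner_ball_normals K = {w. norm w = 1 \<and>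
     (\<exists>p \<rho>. \<rho> > 0 \<and> (\<forall>y\<in>K. w \<bullet> p \<le> w \<bullet> y) \<and> ball (p + \<rho> *\<^sub>R w) \<rho> \<subseteq> K)}"

text \<open>The largest ball about \<open>q\<close> in the interior of \<open>K\<close> touches the
  complement of the interior at a point \<open>p\<close>; convexity makes the tangent hyperplane of
  the ball at \<open>p\<close> a supporting hyperplane of \<open>K\<close>.\<close>

lemma inner_ball_touches:
  fixes K :: "'a::euclidean_space set"
  assumes K: "compact K" "convex K" and q: "q \<in> interior K"
  obtains p r w where "r > 0" "norm w = 1" "q = p + r *\<^sub>R w" "ball q r \<subseteq> interior K"
    "\<And>y. y \<in> K \<Longrightarrow> w \<bullet> p \<le> w \<bullet> y"
proof -
  define Z where "Z = - interior K"
  have "Z \<noteq> {}"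
  proof
    assume "Z = {}"
    then have "K = UNIV" unfolding Z_def using interior_subset[of K] by auto
    then show False using compact_imp_bounded[OF K(1)] not_bounded_UNIV by simp
  qed
  moreover have "closed Z" by (simp add: Z_def closed_Compl)
  ultimately obtain p where p: "p \<in> Z" "infdist q Z = dist q p" using infdist_attains_inf by blast
  define r where "r = dist q p"
  have r: "r > 0" using p q by (auto simp: r_def Z_def)
  have ball: "ball q r \<subseteq> interior K"
  proof
    fix y assume y: "y \<in> ball q r"
    show "y \<in> interior K"
    proof (rule ccontr)
      assume "y \<notin> interior K"
      then have "infdist q Z \<le> dist q y" by (intro infdist_le) (simp add: Z_def)
      with y p(2) show False by (simp add: r_def)
    qed
  qed
  define w where "w = (q - p) /\<^sub>R r"
  have w: "norm w = 1" "q = p + r *\<^sub>R w" using r by (simp_all add: w_def r_def dist_norm)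
  have supp: "w \<bullet> p \<le> w \<bullet> y" if y: "y \<in> K" for y
  proof (rule ccontr)
    assume "\<not> w \<bullet> p \<le> w \<bullet> y"
    then have "w \<bullet> (y - p) < 0" by (simp add: inner_diff_right)
    \<comment> \<open>extend the segment from \<open>y\<close> through \<open>p\<close> to \<open>z\<close> in the ball: then \<open>p\<close> is interior\<close>
    define a where "a = - (r * (w \<bullet> (y - p)))"
    have a: "a > 0" using r \<open>w \<bullet> (y - p) < 0\<close> by (simp add: a_def mult_pos_neg)
    define D where "D = (y - p) \<bullet> (y - p)"
    have D: "D > 0" using a by (auto simp: D_def a_def)
    \<comment> \<open>Minimises the squared distance r^2 - 2 \<epsilon> a + \<epsilon>^2 D of
      \<open>z\<close> from \<open>q\<close>.\<close>
    define \<epsilon> where "\<epsilon> = a / D"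
    have \<epsilon>: "\<epsilon> > 0" using a D by (simp add: \<epsilon>_def)
    define z where "z = p - \<epsilon> *\<^sub>R (y - p)"
    have "(norm (z - q))\<^sup>2 = (r *\<^sub>R w + \<epsilon> *\<^sub>R (y - p)) \<bullet> (r *\<^sub>R w + \<epsilon> *\<^sub>R (y - p))"
    proof -
      have "z - q = - (r *\<^sub>R w + \<epsilon> *\<^sub>R (y - p))" unfolding z_def w(2) by simp
      then show ?thesis by (simp only: norm_minus_cancel power2_norm_eq_inner)
    qed
    also have "\<dots> = r\<^sup>2 * (w \<bullet> w) + 2 * \<epsilon> * (r * (w \<bullet> (y - p))) + \<epsilon>\<^sup>2 * D"
      unfolding D_def inner_add_left inner_add_right inner_scaleR_left inner_scaleR_right
      by (simp add: inner_commute power2_eq_square algebra_simps)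
    also have "w \<bullet> w = 1" using w(1) by (simp add: norm_eq_1)
    also have "r * (w \<bullet> (y - p)) = - a" by (simp add: a_def)
    also have "\<epsilon>\<^sup>2 * D = \<epsilon> * a" using D by (simp add: \<epsilon>_def power2_eq_square)
    finally have "(norm (z - q))\<^sup>2 = r\<^sup>2 - \<epsilon> * a" by simp
    also have "\<dots> < r\<^sup>2" using a \<epsilon> by simp
    finally have "norm (z - q) < r" using r by (simp add: power2_less_imp_less)
    then have "z \<in> interior K" using ball by (auto simp: dist_norm norm_minus_commute)
    then have "y - (1 / (1 + \<epsilon>)) *\<^sub>R (y - z) \<in> interior K"
      using \<epsilon> y by (intro mem_interior_convex_shrink[OF K(2)]) auto
    moreover have "y - z = (1 + \<epsilon>) *\<^sub>R (y - p)" by (simp add: z_def algebra_simps)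
    ultimately have "p \<in> interior K" using \<epsilon> by simp
    with p(1) show False by (simp add: Z_def)
  qed
  show ?thesis using that[OF r w ball supp] .
qed

text \<open>If no normal pointed against \<open>v\<close>, a ball of radius \<open>r0\<close> could
  be pushed in direction \<open>v\<close> forever: the hyperplane touched from a later centre is at
  least as far from that centre as from \<open>q0\<close>, hence at distance at least
  \<open>r0\<close>. This contradicts boundedness.\<close>

lemma inner_ball_normals_spread:
  fixes K :: "'a::euclidean_space set"
  assumes K: "convex_body K" and v: "v \<noteq> 0"
  shows "\<exists>w\<in>inner_ball_normals K. w \<bullet> v < 0"
proof (rule ccontr)
  assume "\<not> ?thesis"
  then have pos: "\<And>w. w \<in> inner_ball_normals K \<Longrightarrow> w \<bullet> v \<ge> 0" by force
  have cK: "compact K" "convex K" using K by (auto simp: convex_body_def)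
  obtain q0 where q0: "q0 \<in> interior K" using K by (auto simp: convex_body_def)
  then obtain r0 where r0: "r0 > 0" "cball q0 r0 \<subseteq> K" unfolding mem_interior_cball by blast
  have step: "ball (q0 + t *\<^sub>R v) r0 \<subseteq> interior K" if t: "t \<ge> 0" "q0 + t *\<^sub>R v \<in> interior K" for t
  proof -
    obtain p r w where w: "r > 0" "norm w = 1" "q0 + t *\<^sub>R v = p + r *\<^sub>R w"
      "ball (q0 + t *\<^sub>R v) r \<subseteq> interior K" "\<And>y. y \<in> K \<Longrightarrow> w \<bullet> p \<le> w \<bullet> y"
      using inner_ball_touches[OF cK t(2)] by metis
    have "w \<in> inner_ball_normals K"
      unfolding inner_ball_normals_def mem_Collect_eq using w interior_subset
      by (intro conjI exI[of _ p] exI[of _ r]) auto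
    then have wv: "w \<bullet> v \<ge> 0" by (rule pos)
    have ww: "w \<bullet> w = 1" using w(2) by (simp add: norm_eq_1)
    \<comment> \<open>The point of the initial ball closest to the hyperplane shows that the
      hyperplane is at distance at least \<open>r0\<close> from \<open>q0\<close>.\<close>
    have "q0 - r0 *\<^sub>R w \<in> K" using r0 w(2) by (intro subsetD[OF r0(2)]) (simp add: dist_norm)
    then have "w \<bullet> p \<le> w \<bullet> (q0 - r0 *\<^sub>R w)" by (rule w(5))
    then have "r0 \<le> w \<bullet> (q0 - p)" using ww by (simp add: inner_diff_right)
    also have "\<dots> \<le> w \<bullet> (q0 + t *\<^sub>R v - p)" using wv t(1) by (simp add: inner_diff_right inner_add_right)
    also have "\<dots> = r" unfolding w(3) using ww by simp
    finally show ?thesis using w(4) by (meson order_trans subset_ball)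
  qed
  define \<delta> where "\<delta> = r0 / (2 * norm v)"
  have \<delta>: "\<delta> > 0" using r0 v by (simp add: \<delta>_def)
  have in_int: "q0 + (real n * \<delta>) *\<^sub>R v \<in> interior K" for n
  proof (induction n)
    case (Suc n)
    have "norm (\<delta> *\<^sub>R v) < r0" using r0 v by (simp add: \<delta>_def)
    then have "q0 + (real (Suc n) * \<delta>) *\<^sub>R v \<in> ball (q0 + (real n * \<delta>) *\<^sub>R v) r0"
      by (simp add: dist_norm algebra_simps)
    then show ?case using step[OF _ Suc] \<delta> by auto
  qed (use q0 in simp)
  obtain B where B: "\<And>x. x \<in> K \<Longrightarrow> norm x \<le> B" using compact_imp_bounded[OF cK(1)] by (auto simp: bounded_iff)
  obtain n :: nat where n: "(B + norm q0) / (\<delta> * norm v) < n" using reals_Archimedean2 by blast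
  have "norm (q0 + (real n * \<delta>) *\<^sub>R v) \<le> B" using B in_int interior_subset by blast
  moreover have "norm ((real n * \<delta>) *\<^sub>R v) \<le> norm (q0 + (real n * \<delta>) *\<^sub>R v) + norm q0"
    using norm_triangle_ineq4[of "q0 + (real n * \<delta>) *\<^sub>R v" q0] by simp
  moreover have "norm ((real n * \<delta>) *\<^sub>R v) > B + norm q0"
    using n \<delta> v by (simp add: field_simps)
  ultimately show False by linarith
qed

section \<open>Positively spanning sets\<close>

text \<open>Caratheodory's theorem for cones: as long as the vectors are dependent, a multiple of a
  linear relation is subtracted to make one coefficient vanish, and that vector is dropped.\<close>

lemma conic_combination_independent:
  fixes c :: "'a::euclidean_space \<Rightarrow> real"
  assumes "finite S" "\<And>w. w \<in> S \<Longrightarrow> c w \<ge> 0"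
  shows "\<exists>T\<subseteq>S. \<exists>a. (\<forall>w\<in>T. a w > 0) \<and> independent T \<and> (\<Sum>w\<in>T. a w *\<^sub>R w) = (\<Sum>w\<in>S. c w *\<^sub>R w)"
  using assms
proof (induction S arbitrary: c rule: finite_psubset_induct)
  case (psubset S)
  have IH: "\<exists>T\<subseteq>S. \<exists>a. (\<forall>w\<in>T. a w > 0) \<and> independent T \<and> (\<Sum>w\<in>T. a w *\<^sub>R w) = (\<Sum>w\<in>S - {v}. c' w *\<^sub>R w)"
    if v: "v \<in> S" "\<And>w. w \<in> S \<Longrightarrow> c' w \<ge> 0" for v c'
  proof -
    have "S - {v} \<subset> S" using v(1) by blast
    then obtain T a where "T \<subseteq> S - {v}" 
      "(\<forall>w\<in>T. a w > 0) \<and> independent T \<and> (\<Sum>w\<in>T. a w *\<^sub>R w) = (\<Sum>w\<in>S - {v}. c' w *\<^sub>R w)"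
      using psubset.IH[of "S - {v}" c'] v(2) by auto
    then show ?thesis by (intro exI[of _ T] conjI exI[of _ a]) auto
  qed
  show ?case
  proof (cases "\<exists>w\<in>S. c w = 0")
    case True
    then obtain w where w: "w \<in> S" "c w = 0" by blast
    have "(\<Sum>w\<in>S. c w *\<^sub>R w) = (\<Sum>w\<in>S - {w}. c w *\<^sub>R w)"
      using w psubset.hyps by (simp add: sum.remove)
    then show ?thesis using IH[OF w(1), of c] psubset.prems by simp
  next
    case False
    then have cpos: "c w > 0" if "w \<in> S" for w using psubset.prems that by force
    show ?thesis
    proof (cases "independent S")
      case True
      then show ?thesis using cpos by blast
    next
      case False
      then obtain u0 where u0: "\<exists>v\<in>S. u0 v \<noteq> 0" "(\<Sum>v\<in>S. u0 v *\<^sub>R v) = 0"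
        using dependent_finite[OF psubset.hyps(1)] by auto
      \<comment> \<open>Subtracting positive multiples of the relation makes a coefficient vanish
        only if the relation has a positive entry; a change of sign provides one.\<close>
      obtain u where u: "\<exists>v\<in>S. u v > 0" "(\<Sum>v\<in>S. u v *\<^sub>R v) = 0"
      proof (cases "\<exists>v\<in>S. u0 v > 0")
        case False
        then have "\<exists>v\<in>S. - u0 v > 0" using u0(1) by force
        moreover have "(\<Sum>v\<in>S. (- u0 v) *\<^sub>R v) = 0" using u0(2) by (simp add: sum_negf)
        ultimately show ?thesis using that[of "\<lambda>v. - u0 v"] by simp
      qed (use that u0 in blast)
      define P where "P = {v\<in>S. u v > 0}"
      have P: "finite P" "P \<noteq> {}" using psubset.hyps u(1) by (auto simp: P_def)
      \<comment> \<open>The largest multiple of the relation that keeps all coefficients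
        nonnegative; the coefficient of the minimising vector becomes 0.\<close>
      define t where "t = Min ((\<lambda>v. c v / u v) ` P)"
      have "t \<in> (\<lambda>v. c v / u v) ` P" unfolding t_def using P by (intro Min_in) auto
      then obtain w where w: "w \<in> P" "t = c w / u w" by blast
      have t_le: "t \<le> c v / u v" if "v \<in> P" for v unfolding t_def using P that by (intro Min_le) auto
      have t0: "t > 0" using w cpos by (simp add: P_def)
      define c' where "c' v = c v - t * u v" for v
      have c'0: "c' v \<ge> 0" if "v \<in> S" for v
      proof (cases "u v > 0")
        case True
        then show ?thesis using t_le[of v] that by (simp add: c'_def P_def field_simps)
      next
        case False
        then have "t * u v \<le> 0" using t0 by (simp add: mult_le_0_iff)
        with cpos[OF that] show ?thesis by (simp add: c'_def)
      qed
      have c'w: "c' w = 0" and wS: "w \<in> S" using w by (auto simp: c'_def P_def)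
      have "(\<Sum>v\<in>S. c v *\<^sub>R v) = (\<Sum>v\<in>S. c' v *\<^sub>R v) + t *\<^sub>R (\<Sum>v\<in>S. u v *\<^sub>R v)"
        unfolding c'_def scaleR_sum_right by (simp add: scaleR_diff_left sum_subtractf)
      also have "\<dots> = (\<Sum>v\<in>S - {w}. c' v *\<^sub>R v)"
        using u(2) c'w wS psubset.hyps by (simp add: sum.remove)
      finally show ?thesis using IH[OF wS, of c'] c'0 by simp
    qed
  qed
qed

text \<open>A point outside the cone could be separated from it, but some vector of \<open>W\<close>
  has a negative product with the separating direction, and its ray eventually violates the
  separation.\<close>

lemma convex_cone_hull_eq_UNIV:
  fixes W :: "'a::euclidean_space set"
  assumes "\<And>v. v \<noteq> 0 \<Longrightarrow> \<exists>w\<in>W. w \<bullet> v < 0"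
  shows "convex_cone hull W = UNIV"
proof (rule ccontr)
  assume "convex_cone hull W \<noteq> UNIV"
  then obtain y where y: "y \<notin> convex_cone hull W" by blast
  let ?S = "(\<lambda>x. x - y) ` (convex_cone hull W)"
  have "convex ?S" by (simp add: convex_convex_cone_hull convex_translation_subtract)
  moreover have "0 \<notin> ?S" using y by auto
  ultimately have "\<exists>a. a \<noteq> 0 \<and> (\<forall>x\<in>?S. 0 \<le> a \<bullet> x)" by (rule separating_hyperplane_set_0)
  then obtain a where a: "a \<noteq> 0" "\<forall>x\<in>?S. 0 \<le> a \<bullet> x" by blast
  obtain w where w: "w \<in> W" "w \<bullet> a < 0" using assms[OF a(1)] by blast
  have neg: "a \<bullet> w < 0" using w(2) by (simp add: inner_commute)
  define t where "t = (\<bar>a \<bullet> y\<bar> + 1) / - (a \<bullet> w)"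
  have t: "t > 0" using neg by (simp add: t_def divide_pos_neg)
  have "t *\<^sub>R w \<in> convex_cone hull W" using t w(1) by (intro convex_cone_hull_mul hull_inc) auto
  then have "0 \<le> a \<bullet> (t *\<^sub>R w - y)" by (intro bspec[OF a(2)]) auto
  moreover have "t * (a \<bullet> w) = - (\<bar>a \<bullet> y\<bar> + 1)" using neg by (simp add: t_def)
  ultimately show False by (simp add: inner_diff_right abs_if split: if_splits)
qed

text \<open>Origin of 2d: a basis \<open>B\<close> chosen from \<open>W\<close>, and an independent
  subset \<open>S\<close> of \<open>W\<close> of which minus the sum of \<open>B\<close> is a
  positive combination. Adding the two combinations gives a positive relation on their
  union.\<close>

lemma positively_spanning_subset:
  fixes W :: "'a::euclidean_space set"
  assumes W: "\<And>v. v \<noteq> 0 \<Longrightarrow> \<exists>w\<in>W. w \<bullet> v < 0"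
  shows "\<exists>F k. finite F \<and> F \<subseteq> W \<and> F \<noteq> {} \<and> card F \<le> 2 * DIM('a) \<and>
    (\<forall>w\<in>F. k w > 0) \<and> (\<Sum>w\<in>F. k w *\<^sub>R w) = 0 \<and> span F = UNIV"
proof -
  have hull: "convex_cone hull W = UNIV" using W by (rule convex_cone_hull_eq_UNIV)
  obtain b :: 'a where "b \<in> Basis" using nonempty_Basis by blast
  then have "W \<noteq> {}" using W[of b] nonzero_Basis by blast
  have cone: "\<exists>S\<subseteq>W. \<exists>c. finite S \<and> (\<forall>w\<in>S. c w > 0) \<and> independent S \<and> (\<Sum>w\<in>S. c w *\<^sub>R w) = y" for y
  proof -
    have "y \<in> conic hull (convex hull W)"
      using hull convex_cone_hull_separate_nonempty[OF \<open>W \<noteq> {}\<close>] by simp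
    then obtain a x where a: "a \<ge> 0" "x \<in> convex hull W" "y = a *\<^sub>R x"
      unfolding conic_hull_explicit by blast
    then obtain S u where S: "finite S" "S \<subseteq> W" "\<forall>x\<in>S. 0 \<le> u x" "(\<Sum>v\<in>S. u v *\<^sub>R v) = x"
      unfolding convex_hull_explicit by blast
    have "y = (\<Sum>v\<in>S. (a * u v) *\<^sub>R v)" using a(3) S(4) by (simp add: scaleR_sum_right[symmetric] scaleR_scaleR[symmetric] del: scaleR_scaleR)
    moreover obtain T c where "T \<subseteq> S" "\<forall>w\<in>T. c w > 0" "independent T"
      "(\<Sum>w\<in>T. c w *\<^sub>R w) = (\<Sum>v\<in>S. (a * u v) *\<^sub>R v)"
      using conic_combination_independent[OF S(1), of "\<lambda>v. a * u v"] S(3) a(1) by auto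
    ultimately show ?thesis using S(1,2) finite_subset by (intro exI[of _ T] conjI exI[of _ c]) auto
  qed
  have "span W = UNIV"
  proof -
    have "y \<in> span W" for y
    proof -
      obtain S c where "S \<subseteq> W" "(\<Sum>w\<in>S. c w *\<^sub>R w) = y" using cone by blast
      then show ?thesis by (auto intro!: span_sum span_scale intro: span_base)
    qed
    then show ?thesis by blast
  qed
  obtain B where B: "B \<subseteq> W" "independent B" "W \<subseteq> span B" by (rule maximal_independent_subset)
  have spanB: "span B = UNIV" using B(3) \<open>span W = UNIV\<close> span_mono[OF B(3)] by (simp add: span_span top.extremum_unique)
  have finB: "finite B" "card B \<le> DIM('a)" using independent_bound[OF B(2)] by auto
  have Bne: "B \<noteq> {}"
  proof
    assume "B = {}"
    then have "b \<in> span {}" using spanB by simp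
    then show False using nonzero_Basis[OF \<open>b \<in> Basis\<close>] by simp
  qed
  obtain S c where S: "S \<subseteq> W" "finite S" "\<And>w. w \<in> S \<Longrightarrow> c w > 0" "independent S"
    "(\<Sum>w\<in>S. c w *\<^sub>R w) = - (\<Sum>w\<in>B. w)" using cone[of "- (\<Sum>w\<in>B. w)"] by blast
  have cS: "card S \<le> DIM('a)" using independent_bound[OF S(4)] by auto
  define k where "k w = (if w \<in> B then 1 else 0) + (if w \<in> S then c w else 0)" for w
  have "(\<Sum>w\<in>B \<union> S. k w *\<^sub>R w) = (\<Sum>w\<in>B \<union> S. if w \<in> B then w else 0) + (\<Sum>w\<in>B \<union> S. if w \<in> S then c w *\<^sub>R w else 0)"
    unfolding sum.distrib[symmetric] by (intro sum.cong) (auto simp: k_def scaleR_add_left)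
  also have "\<dots> = (\<Sum>w\<in>B. w) + (\<Sum>w\<in>S. c w *\<^sub>R w)"
    using finB(1) S(2) by (simp add: sum.inter_restrict[symmetric] Int_absorb1)
  also have "\<dots> = 0" using S(5) by simp
  finally have sum0: "(\<Sum>w\<in>B \<union> S. k w *\<^sub>R w) = 0" .
  show ?thesis
  proof (intro exI[of _ "B \<union> S"] exI[of _ k] conjI ballI)
    show "card (B \<union> S) \<le> 2 * DIM('a)" using card_Un_le[of B S] finB(2) cS by linarith
    show "k w > 0" if "w \<in> B \<union> S" for w using that S(3)[of w] by (auto simp: k_def)
    show "span (B \<union> S) = UNIV" using span_mono[of B "B \<union> S"] spanB by auto
  qed (use finB S B Bne sum0 in auto)
qed

text \<open>The sum of the positive parts of the products has a positive minimum on the unit sphere: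
  at a zero all products would be nonpositive, hence zero by the positive relation, although
  \<open>F\<close> spans. One summand reaches the average. Consequently the half-spaces w . z >= s +
  1 cover everything at distance at least (s + 1) / \<sigma> from the origin.\<close>

lemma positively_spanning_lower_bound:
  fixes F :: "'a::euclidean_space set"
  assumes F: "finite F" "F \<noteq> {}" "\<And>w. w \<in> F \<Longrightarrow> k w > 0" "(\<Sum>w\<in>F. k w *\<^sub>R w) = 0" "span F = UNIV"
  shows "\<exists>\<sigma>>0. \<forall>z. \<exists>w\<in>F. \<sigma> * norm z \<le> w \<bullet> z"
proof -
  define g where "g z = (\<Sum>w\<in>F. max 0 (w \<bullet> z))" for z
  have "continuous_on (sphere 0 1) g" unfolding g_def by (intro continuous_intros)
  moreover have "sphere (0::'a) 1 \<noteq> {}" by simp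
  ultimately obtain z0 where z0: "z0 \<in> sphere 0 1" "\<And>z. z \<in> sphere 0 1 \<Longrightarrow> g z0 \<le> g z"
    using continuous_attains_inf[OF compact_sphere] by metis
  have "g z0 > 0"
  proof (rule ccontr)
    assume "\<not> g z0 > 0"
    moreover have "g z0 \<ge> 0" unfolding g_def by (intro sum_nonneg) auto
    ultimately have "g z0 = 0" by simp
    then have le: "w \<bullet> z0 \<le> 0" if "w \<in> F" for w
      using that F(1) unfolding g_def by (subst (asm) sum_nonneg_eq_0_iff) (auto simp: max_def split: if_splits)
    have "(\<Sum>w\<in>F. - (k w * (w \<bullet> z0))) = - ((\<Sum>w\<in>F. k w *\<^sub>R w) \<bullet> z0)"
      by (simp add: inner_sum_left sum_negf)
    then have "(\<Sum>w\<in>F. - (k w * (w \<bullet> z0))) = 0" unfolding F(4) by simp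
    then have "\<forall>w\<in>F. - (k w * (w \<bullet> z0)) = 0"
      using F(1) le F(3) by (subst (asm) sum_nonneg_eq_0_iff) (auto simp: mult_le_0_iff less_imp_le)
    then have "orthogonal z0 w" if "w \<in> F" for w
      using that F(3)[OF that] by (auto simp: orthogonal_def inner_commute)
    then have "orthogonal z0 z0" using F(5) by (intro orthogonal_to_span[of z0 F]) auto
    then show False using z0(1) by (simp add: orthogonal_self)
  qed
  define \<sigma> where "\<sigma> = g z0 / card F"
  have cF: "card F > 0" using F(1,2) by (simp add: card_gt_0_iff)
  have \<sigma>: "\<sigma> > 0" using \<open>g z0 > 0\<close> cF by (simp add: \<sigma>_def)
  have "\<exists>w\<in>F. \<sigma> * norm z \<le> w \<bullet> z" for z
  proof (cases "z = 0")
    case False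
    define u where "u = z /\<^sub>R norm z"
    have u: "u \<in> sphere 0 1" "z = norm z *\<^sub>R u" using False by (auto simp: u_def)
    have "\<exists>w\<in>F. \<sigma> \<le> max 0 (w \<bullet> u)"
    proof (rule ccontr)
      assume "\<not> ?thesis"
      then have "g u < (\<Sum>w\<in>F. \<sigma>)" unfolding g_def using F(1,2) by (intro sum_strict_mono) (auto simp: not_le)
      also have "\<dots> = g z0" using cF by (simp add: \<sigma>_def)
      finally show False using z0(2)[OF u(1)] by simp
    qed
    then obtain w where w: "w \<in> F" "\<sigma> \<le> w \<bullet> u" using \<sigma> by (auto simp: le_max_iff_disj)
    then have "\<sigma> * norm z \<le> (w \<bullet> u) * norm z" by (intro mult_right_mono) auto
    also have "\<dots> = w \<bullet> (norm z *\<^sub>R u)" by simp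
    finally show ?thesis using w(1) u(2) by auto
  qed (use F(2) in auto)
  with \<sigma> show ?thesis by blast
qed

text \<open>The homothet is placed with the image of \<open>p\<close> at s w. It then contains a
  ball of radius t \<rho> tangent to the hyperplane w . z = s, and inside a bounded region the gap
  between this ball and the half-space is of order 1 / t; the layer of width 1 absorbs it.\<close>

lemma homothet_like_half_space:
  fixes K :: "'a::euclidean_space set"
  assumes "w \<in> inner_ball_normals K"
  shows "\<exists>T>0. \<forall>t\<ge>T. \<exists>x. transl_homothet x t K \<subseteq> {z. s \<le> w \<bullet> z} \<and>
    {z. norm z \<le> r \<and> s + 1 \<le> w \<bullet> z} \<subseteq> transl_homothet x t K"
proof -
  obtain p \<rho> where w: "norm w = 1" "\<rho> > 0" "\<And>y. y \<in> K \<Longrightarrow> w \<bullet> p \<le> w \<bullet> y" "ball (p + \<rho> *\<^sub>R w) \<rho> \<subseteq> K"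
    using assms unfolding inner_ball_normals_def by blast
  have ww: "w \<bullet> w = 1" using w(1) by (simp add: norm_eq_1)
  \<comment> \<open>A vector \<open>u\<close> lies in the ball of radius t \<rho> about t \<rho> w
    as soon as (norm u)^2 < 2 \<rho> t (w . u), and here w . u >= 1 and norm u <= r + |s|. The
    summand 1 makes the inequality strict and \<open>T\<close> positive.\<close>
  define T where "T = ((r + \<bar>s\<bar>)\<^sup>2 + 1) / (2 * \<rho>)"
  have T: "T > 0" using w(2) by (simp add: T_def add_nonneg_pos)
  have "transl_homothet (s *\<^sub>R w - t *\<^sub>R p) t K \<subseteq> {z. s \<le> w \<bullet> z} \<and>
    {z. norm z \<le> r \<and> s + 1 \<le> w \<bullet> z} \<subseteq> transl_homothet (s *\<^sub>R w - t *\<^sub>R p) t K" if "T \<le> t" for t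
  proof
    have t: "t > 0" using T that by linarith
    show "transl_homothet (s *\<^sub>R w - t *\<^sub>R p) t K \<subseteq> {z. s \<le> w \<bullet> z}"
    proof
      fix z assume "z \<in> transl_homothet (s *\<^sub>R w - t *\<^sub>R p) t K"
      then obtain y where y: "y \<in> K" "z = s *\<^sub>R w - t *\<^sub>R p + t *\<^sub>R y" by (auto simp: transl_homothet_def)
      have "t * (w \<bullet> p) \<le> t * (w \<bullet> y)" using w(3)[OF y(1)] t by simp
      then show "z \<in> {z. s \<le> w \<bullet> z}" using y(2) ww by (simp add: inner_add_right inner_diff_right)
    qed
    show "{z. norm z \<le> r \<and> s + 1 \<le> w \<bullet> z} \<subseteq> transl_homothet (s *\<^sub>R w - t *\<^sub>R p) t K"
    proof clarify
      fix z assume z: "norm z \<le> r" "s + 1 \<le> w \<bullet> z"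
      define u where "u = z - s *\<^sub>R w"
      have u1: "1 \<le> w \<bullet> u" using z(2) ww by (simp add: u_def inner_diff_right)
      have "norm u \<le> r + \<bar>s\<bar>" using z(1) w(1) norm_triangle_ineq4[of z "s *\<^sub>R w"] by (simp add: u_def)
      then have "(norm u)\<^sup>2 \<le> (r + \<bar>s\<bar>)\<^sup>2" by (intro power_mono) auto
      also have "\<dots> < 2 * \<rho> * T" using w(2) by (simp add: T_def)
      also have "\<dots> \<le> 2 * \<rho> * t" using w(2) that by simp
      also have "\<dots> \<le> 2 * \<rho> * t * (w \<bullet> u)" using w(2) t u1 by simp
      finally have lt: "(norm u)\<^sup>2 < 2 * \<rho> * t * (w \<bullet> u)" .
      have "(norm (u - (t * \<rho>) *\<^sub>R w))\<^sup>2 = (norm u)\<^sup>2 - 2 * \<rho> * t * (w \<bullet> u) + (t * \<rho>)\<^sup>2"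
        unfolding power2_norm_eq_inner inner_diff_left inner_diff_right inner_scaleR_left inner_scaleR_right
        using ww by (simp add: inner_commute[of u w] power2_eq_square algebra_simps)
      also have "\<dots> < (t * \<rho>)\<^sup>2" using lt by simp
      finally have "norm (u - (t * \<rho>) *\<^sub>R w) < t * \<rho>" using t w(2) by (simp add: power2_less_imp_less)
      moreover have eq: "u /\<^sub>R t - \<rho> *\<^sub>R w = (u - (t * \<rho>) *\<^sub>R w) /\<^sub>R t" using t by (simp add: algebra_simps)
      have "norm (u /\<^sub>R t - \<rho> *\<^sub>R w) = norm (u - (t * \<rho>) *\<^sub>R w) / t"
        unfolding eq norm_scaleR using t by (simp add: divide_inverse mult.commute)
      ultimately have "norm (u /\<^sub>R t - \<rho> *\<^sub>R w) < \<rho>" using t by (simp add: divide_less_eq mult.commute)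
      then have "p + u /\<^sub>R t \<in> ball (p + \<rho> *\<^sub>R w) \<rho>" by (simp add: dist_norm norm_minus_commute)
      then have "p + u /\<^sub>R t \<in> K" using w(4) by blast
      moreover have "(z - (s *\<^sub>R w - t *\<^sub>R p)) /\<^sub>R t = p + u /\<^sub>R t" using t by (simp add: u_def algebra_simps)
      ultimately show "z \<in> transl_homothet (s *\<^sub>R w - t *\<^sub>R p) t K" using t by (simp add: mem_transl_homothet)
    qed
  qed
  with T show ?thesis by blast
qed


text \<open>One member is used per normal in \<open>F\<close>. The positive relation forbids a point
  common to all half-spaces s <= w . z, so at most \<open>card F - 1\<close> members share a point.
  \<open>R\<close> and \<open>N'\<close> tell later stages how far this one reaches in space and in
  index.\<close>

lemma covering_stage:
  fixes K :: "'a::euclidean_space set" and lam :: "nat \<Rightarrow> real"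
  assumes K: "convex_body K" and lam: "\<And>i. lam i > 0" "\<not> bounded (range lam)"
  shows "\<exists>\<tau>>0. \<forall>s>0. \<forall>r N. \<exists>J x R N'. J \<subseteq> {N..<N'} \<and> N \<le> N' \<and>
       (\<forall>i\<in>J. transl_homothet (x i) (lam i) K \<subseteq> {z. s \<le> norm z \<and> norm z \<le> R}) \<and>
       (\<forall>z. card {i\<in>J. z \<in> transl_homothet (x i) (lam i) K} \<le> 2 * DIM('a) - 1) \<and>
       {z. \<tau> * (s + 1) \<le> norm z \<and> norm z \<le> r} \<subseteq> (\<Union>i\<in>J. transl_homothet (x i) (lam i) K)"
proof -
  obtain F k where Fk: "finite F \<and> F \<subseteq> inner_ball_normals K \<and> F \<noteq> {} \<and> card F \<le> 2 * DIM('a) \<and>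
    (\<forall>w\<in>F. k w > 0) \<and> (\<Sum>w\<in>F. k w *\<^sub>R w) = 0 \<and> span F = UNIV"
    using positively_spanning_subset[of "inner_ball_normals K", OF inner_ball_normals_spread[OF K]] by auto
  then have F: "finite F" "F \<subseteq> inner_ball_normals K" "F \<noteq> {}" "card F \<le> 2 * DIM('a)"
    and k: "\<And>w. w \<in> F \<Longrightarrow> k w > 0" "(\<Sum>w\<in>F. k w *\<^sub>R w) = 0" "span F = UNIV"
    by blast+
  obtain \<sigma> where \<sigma>: "\<sigma> > 0" "\<forall>z. \<exists>w\<in>F. \<sigma> * norm z \<le> w \<bullet> z"
    using positively_spanning_lower_bound[OF F(1,3) k] by blast
  have cK: "compact K" using K by (simp add: convex_body_def)
  have large: "infinite {i. N \<le> i \<and> T \<le> lam i}" for N T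
  proof
    assume "finite {i. N \<le> i \<and> T \<le> lam i}"
    then have fin: "finite (lam ` ({i. N \<le> i \<and> T \<le> lam i} \<union> {..<N}))" by simp
    have "range lam \<subseteq> lam ` ({i. N \<le> i \<and> T \<le> lam i} \<union> {..<N}) \<union> {0..T}"
      using lam(1) by (auto simp: image_iff not_le less_imp_le)
    moreover have "bounded (lam ` ({i. N \<le> i \<and> T \<le> lam i} \<union> {..<N}) \<union> {0..T})"
      using finite_imp_bounded[OF fin] by simp
    ultimately show False using lam(2) bounded_subset by blast
  qed
  have "\<exists>J x R N'. J \<subseteq> {N..<N'} \<and> N \<le> N' \<and>
       (\<forall>i\<in>J. transl_homothet (x i) (lam i) K \<subseteq> {z. s \<le> norm z \<and> norm z \<le> R}) \<and>
       (\<forall>z. card {i\<in>J. z \<in> transl_homothet (x i) (lam i) K} \<le> 2 * DIM('a) - 1) \<and>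
       {z. 1 / \<sigma> * (s + 1) \<le> norm z \<and> norm z \<le> r} \<subseteq> (\<Union>i\<in>J. transl_homothet (x i) (lam i) K)"
    if s: "s > 0" for s r N
  proof -
    have "\<exists>T. \<forall>t\<ge>T. \<exists>x. transl_homothet x t K \<subseteq> {z. s \<le> w \<bullet> z} \<and>
      {z. norm z \<le> r \<and> s + 1 \<le> w \<bullet> z} \<subseteq> transl_homothet x t K" if "w \<in> F" for w
      using homothet_like_half_space[of w K] F(2) that by blast
    then obtain T where T: "\<And>w t. w \<in> F \<Longrightarrow> T w \<le> t \<Longrightarrow> \<exists>x. transl_homothet x t K \<subseteq> {z. s \<le> w \<bullet> z} \<and>
      {z. norm z \<le> r \<and> s + 1 \<le> w \<bullet> z} \<subseteq> transl_homothet x t K" by metis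
    obtain J where J: "finite J" "card J = card F" "J \<subseteq> {i. N \<le> i \<and> Max (T ` F) \<le> lam i}"
      using infinite_arbitrarily_large[OF large] by blast
    obtain g where g: "bij_betw g J F" using finite_same_card_bij[OF J(1) F(1) J(2)] by blast
    have gF: "g i \<in> F" if "i \<in> J" for i using g that by (auto simp: bij_betw_def)
    have "\<exists>x. transl_homothet x (lam i) K \<subseteq> {z. s \<le> g i \<bullet> z} \<and>
      {z. norm z \<le> r \<and> s + 1 \<le> g i \<bullet> z} \<subseteq> transl_homothet x (lam i) K" if i: "i \<in> J" for i
    proof -
      have "T (g i) \<le> Max (T ` F)" using F(1) gF[OF i] by (intro Max_ge) auto
      also have "\<dots> \<le> lam i" using J(3) i by auto
      finally show ?thesis by (rule T[OF gF[OF i]])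
    qed
    then obtain x where x: "\<And>i. i \<in> J \<Longrightarrow> transl_homothet (x i) (lam i) K \<subseteq> {z. s \<le> g i \<bullet> z}"
      "\<And>i. i \<in> J \<Longrightarrow> {z. norm z \<le> r \<and> s + 1 \<le> g i \<bullet> z} \<subseteq> transl_homothet (x i) (lam i) K" by metis
    have "bounded (\<Union>i\<in>J. transl_homothet (x i) (lam i) K)"
      using J(1) compact_imp_bounded[OF compact_transl_homothet[OF cK]] by (intro bounded_UN) auto
    then obtain R where R: "\<And>z i. i \<in> J \<Longrightarrow> z \<in> transl_homothet (x i) (lam i) K \<Longrightarrow> norm z \<le> R"
      unfolding bounded_iff by blast
    define N' where "N' = Suc (Max (insert N J))"
    have N': "i < N'" if "i \<in> insert N J" for i
      unfolding N'_def less_Suc_eq_le using J(1) that by (intro Max_ge) auto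
    have g_norm: "g i \<bullet> z \<le> norm z" if "i \<in> J" for i z
    proof -
      have "norm (g i) = 1" using gF[OF that] F(2) by (auto simp: inner_ball_normals_def)
      then show ?thesis using norm_cauchy_schwarz[of "g i" z] by simp
    qed
    have mult: "card {i\<in>J. z \<in> transl_homothet (x i) (lam i) K} \<le> 2 * DIM('a) - 1" for z
    proof -
      have "{i\<in>J. z \<in> transl_homothet (x i) (lam i) K} \<noteq> J"
      proof
        assume eq: "{i\<in>J. z \<in> transl_homothet (x i) (lam i) K} = J"
        have "s \<le> w \<bullet> z" if "w \<in> F" for w
        proof -
          obtain i where "i \<in> J" "w = g i" using g \<open>w \<in> F\<close> by (auto simp: bij_betw_def)
          then show ?thesis using x(1)[of i] eq by blast
        qed
        then have "k w * (w \<bullet> z) > 0" if "w \<in> F" for w using k(1) s that by (intro mult_pos_pos) force+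
        then have "(\<Sum>w\<in>F. k w * (w \<bullet> z)) > 0" using F(1,3) by (intro sum_pos) auto
        moreover have "(\<Sum>w\<in>F. k w * (w \<bullet> z)) = (\<Sum>w\<in>F. k w *\<^sub>R w) \<bullet> z" by (simp add: inner_sum_left)
        ultimately show False using k(2) by simp
      qed
      then have "card {i\<in>J. z \<in> transl_homothet (x i) (lam i) K} < card J"
        using J(1) by (intro psubset_card_mono) auto
      then show ?thesis using J(2) F(4) by linarith
    qed
    have cov: "{z. 1 / \<sigma> * (s + 1) \<le> norm z \<and> norm z \<le> r} \<subseteq> (\<Union>i\<in>J. transl_homothet (x i) (lam i) K)"
    proof clarify
      fix z :: 'a assume z: "1 / \<sigma> * (s + 1) \<le> norm z" "norm z \<le> r"
      obtain w where w: "w \<in> F" "\<sigma> * norm z \<le> w \<bullet> z" using \<sigma>(2) by blast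
      have "s + 1 \<le> \<sigma> * norm z" using z(1) \<sigma>(1) by (simp add: field_simps)
      moreover obtain i where "i \<in> J" "w = g i" using g \<open>w \<in> F\<close> by (auto simp: bij_betw_def)
      ultimately show "z \<in> (\<Union>i\<in>J. transl_homothet (x i) (lam i) K)" using x(2)[of i] w(2) z(2) by auto
    qed
    have "J \<subseteq> {N..<N'}" using J(3) N' by auto
    moreover have "N \<le> N'" using N'[of N] by simp
    moreover have "\<forall>i\<in>J. transl_homothet (x i) (lam i) K \<subseteq> {z. s \<le> norm z \<and> norm z \<le> R}"
    proof (intro ballI subsetI CollectI conjI)
      fix i z assume i: "i \<in> J" and z: "z \<in> transl_homothet (x i) (lam i) K"
      then have "s \<le> g i \<bullet> z" using x(1) by blast
      then show "s \<le> norm z" using g_norm[OF i, of z] by linarith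
      show "norm z \<le> R" using R[OF i z] .
    qed
    ultimately show ?thesis using mult cov by (intro exI[of _ J] exI[of _ x] exI[of _ R] exI[of _ N']) auto
  qed
  then show ?thesis using \<sigma>(1) by (intro exI[of _ "1 / \<sigma>"] conjI allI impI) simp_all
qed

text \<open>The position of member \<open>i0\<close> is prescribed so that it doubles as the set covering the centre of space.\<close>

lemma disjoint_homothets:
  fixes K :: "'a::euclidean_space set" and lam :: "nat \<Rightarrow> real"
  assumes "compact K" "\<And>i. lam i > 0" "k \<in> K"
  shows "\<exists>x. disjoint_family (\<lambda>i. transl_homothet (x i) (lam i) K) \<and> x i0 = - (lam i0 *\<^sub>R k)"
proof -
  obtain R where R: "R > 0" "\<And>y. y \<in> K \<Longrightarrow> norm (y - k) < R"
  proof -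
    obtain B where B: "\<And>y. y \<in> K \<Longrightarrow> norm y \<le> B" using compact_imp_bounded[OF assms(1)] by (auto simp: bounded_iff)
    have "norm (y - k) < 2 * B + 1" if "y \<in> K" for y
      using B[OF that] B[OF assms(3)] norm_triangle_ineq4[of y k] by linarith
    moreover have "2 * B + 1 > 0" using B[OF assms(3)] norm_ge_zero[of k] by linarith
    ultimately show thesis using that by blast
  qed
  obtain b :: 'a where b: "b \<in> Basis" using nonempty_Basis by blast
  \<comment> \<open>Member \<open>i\<close> lies in a ball of radius R * lam i about its point on a
    line; laying these radii end to end puts consecutive centres R times the sum of the two sizes
    apart.\<close>
  define g where "g i = R * (2 * (\<Sum>j<i. lam j) + lam i)" for i
  define x where "x i = (g i - g i0) *\<^sub>R b - lam i *\<^sub>R k" for i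
  have gap: "R * (lam i + lam j) \<le> g j - g i" if "i < j" for i j
  proof -
    have "(\<Sum>l<i. lam l) + lam i = (\<Sum>l<Suc i. lam l)" by simp
    also have "\<dots> \<le> (\<Sum>l<j. lam l)" using that assms(2) by (intro sum_mono2) (auto simp: less_imp_le)
    finally have "R * ((\<Sum>l<i. lam l) + lam i) \<le> R * (\<Sum>l<j. lam l)" using R(1) by (intro mult_left_mono) auto
    then show ?thesis by (simp add: g_def algebra_simps)
  qed
  have near: "norm (z - (g i - g i0) *\<^sub>R b) < R * lam i" if z: "z \<in> transl_homothet (x i) (lam i) K" for z i
  proof -
    obtain y where y: "y \<in> K" "z = x i + lam i *\<^sub>R y" using z by (auto simp: transl_homothet_def)
    have "z - (g i - g i0) *\<^sub>R b = lam i *\<^sub>R (y - k)" using y(2) by (simp add: x_def algebra_simps)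
    then have "norm (z - (g i - g i0) *\<^sub>R b) = lam i * norm (y - k)" using assms(2)[of i] by simp
    also have "\<dots> < lam i * R" using R(2)[OF y(1)] assms(2)[of i] by simp
    finally show ?thesis by (simp add: mult.commute)
  qed
  have dis: "False" if "i < j" "z \<in> transl_homothet (x i) (lam i) K" "z \<in> transl_homothet (x j) (lam j) K" for i j z
  proof -
    have "(g j - g i0) *\<^sub>R b - (g i - g i0) *\<^sub>R b = (g j - g i) *\<^sub>R b" by (simp add: algebra_simps)
    then have "\<bar>g j - g i\<bar> = norm ((z - (g i - g i0) *\<^sub>R b) - (z - (g j - g i0) *\<^sub>R b))"
      using b by simp
    also have "\<dots> < R * lam i + R * lam j"
      using norm_triangle_ineq4[of "z - (g i - g i0) *\<^sub>R b" "z - (g j - g i0) *\<^sub>R b"] near[OF that(2)] near[OF that(3)]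
      by linarith
    finally show False using gap[OF that(1)] by (simp add: algebra_simps)
  qed
  have "disjoint_family (\<lambda>i. transl_homothet (x i) (lam i) K)"
    unfolding disjoint_family_on_def
  proof (intro ballI impI)
    fix i j :: nat assume "i \<noteq> j"
    then consider "i < j" | "j < i" by linarith
    then show "transl_homothet (x i) (lam i) K \<inter> transl_homothet (x j) (lam j) K = {}"
      using dis by cases blast+
  qed
  then show ?thesis by (intro exI[of _ x]) (simp add: x_def)
qed

text \<open>Stage n covers the norms from \<tau> (s n + 1) to \<tau> (s (n + 1) + 1), so consecutive
  shells abut, and none of its members enters the open ball of radius s n. Choosing s (n + 2) beyond
  the reach R n of stage n separates all stages that are not consecutive.\<close>

lemma covering_unbounded:
  fixes K :: "'a::euclidean_space set" and lam :: "nat \<Rightarrow> real"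
  assumes K: "convex_body K" and lam: "\<And>i. lam i > 0" "\<not> bounded (range lam)"
  shows "\<exists>x :: nat \<Rightarrow> 'a. covers (\<lambda>i. transl_homothet (x i) (lam i) K) UNIV
    \<and> (\<forall>p. finite {i. p \<in> transl_homothet (x i) (lam i) K}
         \<and> card {i. p \<in> transl_homothet (x i) (lam i) K} \<le> 4 * DIM('a))"
proof -
  define C where "C x i = transl_homothet x (lam i) K" for x i
  obtain \<tau> where \<tau>: "\<tau> > 0" and stage: 
    "\<forall>s>0. \<forall>r N. \<exists>J x R N'. J \<subseteq> {N..<N'} \<and> N \<le> N' \<and>
       (\<forall>i\<in>J. C (x i) i \<subseteq> {z. s \<le> norm z \<and> norm z \<le> R}) \<and>
       (\<forall>z. card {i\<in>J. z \<in> C (x i) i} \<le> 2 * DIM('a) - 1) \<and>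
       {z. \<tau> * (s + 1) \<le> norm z \<and> norm z \<le> r} \<subseteq> (\<Union>i\<in>J. C (x i) i)"
    using covering_stage[OF K lam] unfolding C_def by (elim exE conjE)
  have cK: "compact K" using K by (simp add: convex_body_def)
  obtain k \<rho> where k: "\<rho> > 0" "ball k \<rho> \<subseteq> K" using K by (auto simp: convex_body_def mem_interior)
  have kK: "k \<in> K" using k by auto
  \<comment> \<open>The first stage begins to cover at norm \<tau> (1 + 1), so the centre needs a
    member containing a ball of that radius.\<close>
  have "\<exists>i0. lam i0 * \<rho> > 2 * \<tau>"
  proof (rule ccontr)
    assume "\<not> ?thesis"
    then have "lam i \<le> 2 * \<tau> / \<rho>" for i using k(1) by (simp add: not_less field_simps)
    then have "bounded (range lam)" using lam(1) by (intro boundedI[of _ "2 * \<tau> / \<rho>"]) (auto simp: abs_of_pos)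
    with lam(2) show False by simp
  qed
  then obtain i0 where i0: "lam i0 * \<rho> > 2 * \<tau>" by blast
  obtain y where y: "disjoint_family (\<lambda>i. C (y i) i)" "y i0 = - (lam i0 *\<^sub>R k)"
    using disjoint_homothets[OF cK _ kK, of lam i0] lam(1) unfolding C_def by auto
  have core: "{z. norm z \<le> 2 * \<tau>} \<subseteq> C (y i0) i0"
  proof clarify
    fix z :: 'a assume "norm z \<le> 2 * \<tau>"
    then have "norm (z /\<^sub>R lam i0) < \<rho>" using i0 lam(1)[of i0] by (simp add: field_simps)
    then have "k + z /\<^sub>R lam i0 \<in> K" using k(2) by (intro subsetD[OF k(2)]) (simp add: dist_norm)
    moreover have "(z - y i0) /\<^sub>R lam i0 = k + z /\<^sub>R lam i0" 
      using lam(1)[of i0] unfolding y(2) by (simp add: algebra_simps)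
    ultimately show "z \<in> C (y i0) i0" using lam(1)[of i0] by (simp add: C_def mem_transl_homothet)
  qed
  \<comment> \<open>A stage records its own inner radius \<open>s\<close> and the inner radius
    \<open>s'\<close> of its successor; its block of indices starts after \<open>i0\<close>, which
    is reserved for the centre.\<close>
  define good where "good = (\<lambda>(s, s', J, x, R, N, N'). s > 0 \<and> s + 1 \<le> s' \<and> Suc i0 \<le> N \<and> N \<le> N' \<and>
       J \<subseteq> {N..<N'} \<and> (\<forall>i\<in>J. C (x i) i \<subseteq> {z. s \<le> norm z \<and> norm z \<le> R}) \<and>
       (\<forall>z. card {i\<in>J. z \<in> C (x i) i} \<le> 2 * DIM('a) - 1) \<and>
       {z. \<tau> * (s + 1) \<le> norm z \<and> norm z \<le> \<tau> * (s' + 1)} \<subseteq> (\<Union>i\<in>J. C (x i) i))"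
  define next_ok where "next_ok = (\<lambda>(s::real, s'::real, J::nat set, x::nat \<Rightarrow> 'a, R::real, N::nat, N'::nat)
       (t::real, t'::real, J2::nat set, x2::nat \<Rightarrow> 'a, R2::real, N2::nat, N2'::nat). t = s' \<and> R < t' \<and> N2 = N')"
  have "\<exists>f. \<forall>n::nat. (good (f n) \<and> (n = 0 \<longrightarrow> fst (f n) = 1)) \<and> next_ok (f n) (f (Suc n))"
  proof (rule dependent_nat_choice)
    obtain J x R N' where "J \<subseteq> {Suc i0..<N'} \<and> Suc i0 \<le> N' \<and>
       (\<forall>i\<in>J. C (x i) i \<subseteq> {z. 1 \<le> norm z \<and> norm z \<le> R}) \<and>
       (\<forall>z. card {i\<in>J. z \<in> C (x i) i} \<le> 2 * DIM('a) - 1) \<and>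
       {z. \<tau> * (1 + 1) \<le> norm z \<and> norm z \<le> \<tau> * (2 + 1)} \<subseteq> (\<Union>i\<in>J. C (x i) i)"
      using stage[rule_format, OF zero_less_one, of "Suc i0" "\<tau> * (2 + 1)"] by (elim exE)
    then have "good (1, 2, J, x, R, Suc i0, N')" by (simp add: good_def)
    then show "\<exists>a. good a \<and> (0 = (0::nat) \<longrightarrow> fst a = 1)" by (intro exI[of _ "(1, 2, J, x, R, Suc i0, N')"]) simp
  next
    fix a and n :: nat assume a: "good a \<and> (n = 0 \<longrightarrow> fst a = 1)"
    obtain s s' J x R N N' where a_eq: "a = (s, s', J, x, R, N, N')" by (metis prod_cases7)
    have s': "s' > 0" "Suc i0 \<le> N'" using a by (auto simp: a_eq good_def)
    \<comment> \<open>The inner radius of the second stage after \<open>a\<close>, chosen once the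
      reach \<open>R\<close> of \<open>a\<close> is known; exceeding \<open>s'\<close> by at least 1
      makes the radii unbounded.\<close>
    define t' where "t' = max R s' + 1"
    obtain J2 x2 R2 N2' where "J2 \<subseteq> {N'..<N2'} \<and> N' \<le> N2' \<and>
       (\<forall>i\<in>J2. C (x2 i) i \<subseteq> {z. s' \<le> norm z \<and> norm z \<le> R2}) \<and>
       (\<forall>z. card {i\<in>J2. z \<in> C (x2 i) i} \<le> 2 * DIM('a) - 1) \<and>
       {z. \<tau> * (s' + 1) \<le> norm z \<and> norm z \<le> \<tau> * (t' + 1)} \<subseteq> (\<Union>i\<in>J2. C (x2 i) i)"
      using stage[rule_format, OF s'(1), of N' "\<tau> * (t' + 1)"] by (elim exE)
    then have "good (s', t', J2, x2, R2, N', N2')" using s' by (simp add: good_def t'_def)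
    moreover have "next_ok a (s', t', J2, x2, R2, N', N2')" by (simp add: next_ok_def a_eq t'_def)
    ultimately show "\<exists>b. (good b \<and> (Suc n = 0 \<longrightarrow> fst b = 1)) \<and> next_ok a b"
      by (intro exI[of _ "(s', t', J2, x2, R2, N', N2')"]) simp
  qed
  then obtain f where f: "\<And>n. good (f n)" "fst (f 0) = 1" "\<And>n. next_ok (f n) (f (Suc n))" by blast
  define s where "s n = fst (f n)" for n
  define J where "J n = fst (snd (snd (f n)))" for n
  define X where "X n = fst (snd (snd (snd (f n))))" for n
  define R where "R n = fst (snd (snd (snd (snd (f n)))))" for n
  define Nb where "Nb n = fst (snd (snd (snd (snd (snd (f n))))))" for n
  have f_eq: "f n = (s n, s (Suc n), J n, X n, R n, Nb n, Nb (Suc n))" for n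
    using f(3)[of n] by (cases "f n"; cases "f (Suc n)") (auto simp: next_ok_def s_def J_def X_def R_def Nb_def)
  have s0: "s 0 = 1" using f(2) by (simp add: s_def)
  have s_pos: "s n > 0" and s_Suc: "s n + 1 \<le> s (Suc n)" and i0N: "i0 < Nb n" and Nb_Suc: "Nb n \<le> Nb (Suc n)"
    and J_sub: "J n \<subseteq> {Nb n..<Nb (Suc n)}"
    and J_ring: "\<And>i. i \<in> J n \<Longrightarrow> C (X n i) i \<subseteq> {z. s n \<le> norm z \<and> norm z \<le> R n}"
    and J_card: "\<And>z. card {i\<in>J n. z \<in> C (X n i) i} \<le> 2 * DIM('a) - 1"
    and J_cov: "{z. \<tau> * (s n + 1) \<le> norm z \<and> norm z \<le> \<tau> * (s (Suc n) + 1)} \<subseteq> (\<Union>i\<in>J n. C (X n i) i)" for n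
    using f(1)[of n] unfolding f_eq good_def by auto
  have R_less: "R n < s (Suc (Suc n))" for n using f(3)[of n] by (simp add: f_eq next_ok_def)
  have s_mono: "s m \<le> s n" if "m \<le> n" for m n
  proof (rule lift_Suc_mono_le[OF _ that])
    show "s n \<le> s (Suc n)" for n using s_Suc[of n] by linarith
  qed
  have Nb_mono: "Nb m \<le> Nb n" if "m \<le> n" for m n
    using Nb_Suc that by (rule lift_Suc_mono_le)
  have s_ge: "s n \<ge> real n" for n
  proof (induction n)
    case (Suc n)
    with s_Suc[of n] show ?case by simp
  qed (use s0 in simp)
  have J_disj: "m = n" if "i \<in> J m" "i \<in> J n" for i m n
  proof (rule ccontr)
    assume "m \<noteq> n"
    then consider "Suc m \<le> n" | "Suc n \<le> m" by linarith
    then show False using J_sub[of m] J_sub[of n] that Nb_mono[of "Suc m" n] Nb_mono[of "Suc n" m]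
      by cases fastforce+
  qed
  have i0J: "i0 \<notin> J n" for n using i0N[of n] J_sub[of n] by auto
  \<comment> \<open>Members outside all stages, among them \<open>i0\<close>, keep their places in a
    disjoint family and together contribute at most 1 to the multiplicity.\<close>
  define x where "x i = (if \<exists>n. i \<in> J n then X (THE n. i \<in> J n) i else y i)" for i
  have x_J: "x i = X n i" if "i \<in> J n" for i n
  proof -
    have "(THE n. i \<in> J n) = n" using that J_disj by (intro the_equality) auto
    then show ?thesis using that by (auto simp: x_def)
  qed
  have x_y: "x i = y i" if "\<And>n. i \<notin> J n" for i using that by (simp add: x_def)
  have cov: "covers (\<lambda>i. C (x i) i) UNIV"
    unfolding covers_def
  proof
    fix z :: 'a
    show "z \<in> (\<Union>i. C (x i) i)"
    proof (cases "norm z \<le> 2 * \<tau>")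
      case True
      then have "z \<in> C (x i0) i0" using core x_y[OF i0J] by auto
      then show ?thesis by blast
    next
      case False
      obtain n where n: "norm z / \<tau> \<le> real n" using real_arch_simple by blast
      have "norm z \<le> \<tau> * (s n + 1)"
      proof -
        have "norm z \<le> \<tau> * real n" using n \<tau> by (simp add: field_simps)
        also have "\<dots> \<le> \<tau> * (s n + 1)" using s_ge[of n] \<tau> by (intro mult_left_mono) auto
        finally show ?thesis .
      qed
      then have ex: "\<exists>n. norm z \<le> \<tau> * (s n + 1)" by blast
      define m where "m = (LEAST n. norm z \<le> \<tau> * (s n + 1))"
      have m: "norm z \<le> \<tau> * (s m + 1)" unfolding m_def using ex by (rule LeastI_ex)
      have "m \<noteq> 0"
      proof
        assume "m = 0"
        then have "norm z \<le> \<tau> * (1 + 1)" using m s0 by simp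
        then show False using False by simp
      qed
      then obtain l where l: "m = Suc l" using not0_implies_Suc by blast
      have "\<not> norm z \<le> \<tau> * (s l + 1)" using l not_less_Least[of l "\<lambda>n. norm z \<le> \<tau> * (s n + 1)"] by (simp add: m_def)
      then have "z \<in> {z. \<tau> * (s l + 1) \<le> norm z \<and> norm z \<le> \<tau> * (s (Suc l) + 1)}"
        using m l by simp
      then have "z \<in> (\<Union>i\<in>J l. C (X l i) i)" using J_cov[of l] by (rule rev_subsetD)
      then obtain i where "i \<in> J l" "z \<in> C (X l i) i" by blast
      then have "z \<in> C (x i) i" using x_J by simp
      then show ?thesis by blast
    qed
  qed
  have "finite {i. p \<in> C (x i) i} \<and> card {i. p \<in> C (x i) i} \<le> 4 * DIM('a)" for p
  proof -
    define A where "A n = {i\<in>J n. p \<in> C (X n i) i}" for n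
    define E where "E = {i. p \<in> C (y i) i}"
    have finA: "finite (A n)" for n using J_sub[of n] by (rule_tac finite_subset[of _ "{Nb n..<Nb (Suc n)}"]) (auto simp: A_def)
    have cardA: "card (A n) \<le> 2 * DIM('a) - 1" for n unfolding A_def by (rule J_card)
    have E1: "finite E \<and> card E \<le> 1"
    proof -
      have "i = j" if "i \<in> E" "j \<in> E" for i j
        using y(1) that unfolding E_def disjoint_family_on_def by blast
      then have "E = {} \<or> (\<exists>i. E = {i})" by blast
      then show ?thesis by auto
    qed
    have sub: "{i. p \<in> C (x i) i} \<subseteq> E \<union> (\<Union>n. A n)"
    proof clarify
      fix i assume i: "p \<in> C (x i) i" "i \<notin> (\<Union>n. A n)"
      then have "i \<notin> J n" for n using x_J[of i n] by (auto simp: A_def)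
      then show "i \<in> E" using i(1) x_y[of i] by (simp add: E_def)
    qed
    have "\<exists>n. (\<Union>n. A n) \<subseteq> A n \<union> A (Suc n)"
    proof (cases "\<exists>n. A n \<noteq> {}")
      case True
      \<comment> \<open>The first stage with a member containing \<open>p\<close>. Then
        \<open>norm p\<close> is at most \<open>R n\<close>, which is below the inner radius of
        every stage after the next.\<close>
      define n where "n = (LEAST n. A n \<noteq> {})"
      have n: "A n \<noteq> {}" unfolding n_def using True by (rule LeastI_ex)
      have less: "A m = {}" if "m < n" for m using not_less_Least[of m "\<lambda>n. A n \<noteq> {}"] that by (simp add: n_def)
      have "norm p \<le> R n" using n J_ring[of _ n] by (auto simp: A_def)
      have "A m = {}" if "Suc (Suc n) \<le> m" for m
      proof (rule ccontr)
        assume "A m \<noteq> {}"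
        then have "s m \<le> norm p" using J_ring[of _ m] by (auto simp: A_def)
        then show False using \<open>norm p \<le> R n\<close> R_less[of n] s_mono[OF that] by linarith
      qed
      then have "A m \<subseteq> A n \<union> A (Suc n)" for m
        using less[of m] by (cases "m < n"; cases "m = n"; cases "m = Suc n") auto
      then show ?thesis by blast
    qed auto
    then obtain n where n: "(\<Union>n. A n) \<subseteq> A n \<union> A (Suc n)" by blast
    have sub': "{i. p \<in> C (x i) i} \<subseteq> E \<union> (A n \<union> A (Suc n))" using sub n by blast
    have fin: "finite (E \<union> (A n \<union> A (Suc n)))" using E1 finA by simp
    have "card {i. p \<in> C (x i) i} \<le> card (E \<union> (A n \<union> A (Suc n)))" using fin sub' by (rule card_mono)
    also have "\<dots> \<le> card E + (card (A n) + card (A (Suc n)))"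
      using card_Un_le[of E "A n \<union> A (Suc n)"] card_Un_le[of "A n" "A (Suc n)"] by linarith
    also have "\<dots> \<le> 1 + ((2 * DIM('a) - 1) + (2 * DIM('a) - 1))"
      using E1 cardA[of n] cardA[of "Suc n"] by linarith
    also have "\<dots> \<le> 4 * DIM('a)" using DIM_positive[where 'a = 'a] by linarith
    finally show ?thesis using finite_subset[OF sub' fin] by blast
  qed
  with cov show ?thesis unfolding C_def by blast
qed

section \<open>The three cases\<close>

theorem theorem1p1:
  fixes K :: "'a::euclidean_space set" and lam :: "nat \<Rightarrow> real"
  assumes "convex_body K"
    and "\<And>i. lam i > 0"
    and "\<not> summable (\<lambda>i. lam i ^ DIM('a))"
  shows
    "(bounded (range lam) \<and>
        (\<exists>l. l \<noteq> 0 \<and> (\<forall>e>0. frequently (\<lambda>i. dist (lam i) l < e) sequentially))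
      \<longrightarrow> (\<exists>x :: nat \<Rightarrow> 'a. covers (\<lambda>i. transl_homothet (x i) (lam i) K) UNIV
             \<and> covering_density (\<lambda>i. transl_homothet (x i) (lam i) K) = transl_cover_density K))
   \<and> (bounded (range lam) \<and>
        \<not> (\<exists>l. l \<noteq> 0 \<and> (\<forall>e>0. frequently (\<lambda>i. dist (lam i) l < e) sequentially))
      \<longrightarrow> (\<exists>x :: nat \<Rightarrow> 'a. covers (\<lambda>i. transl_homothet (x i) (lam i) K) UNIV
             \<and> covering_density (\<lambda>i. transl_homothet (x i) (lam i) K) = 1))
   \<and> (\<not> bounded (range lam)
      \<longrightarrow> (\<exists>x :: nat \<Rightarrow> 'a. covers (\<lambda>i. transl_homothet (x i) (lam i) K) UNIV
             \<and> (\<forall>p. finite {i. p \<in> transl_homothet (x i) (lam i) K}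
                    \<and> card {i. p \<in> transl_homothet (x i) (lam i) K} \<le> 4 * DIM('a))))"
proof (intro conjI impI)
  assume "bounded (range lam) \<and>
    (\<exists>l. l \<noteq> 0 \<and> (\<forall>e>0. frequently (\<lambda>i. dist (lam i) l < e) sequentially))"
  then show "\<exists>x :: nat \<Rightarrow> 'a. covers (\<lambda>i. transl_homothet (x i) (lam i) K) UNIV
      \<and> covering_density (\<lambda>i. transl_homothet (x i) (lam i) K) = transl_cover_density K"
    using covering_bounded_with_limit_point[of K lam] assms(1,2) by blast
next
  assume "bounded (range lam) \<and>
    \<not> (\<exists>l. l \<noteq> 0 \<and> (\<forall>e>0. frequently (\<lambda>i. dist (lam i) l < e) sequentially))"
  then have "lam \<longlonglongrightarrow> 0" by (intro tendsto_zero_if_no_other_limit_point) blast+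
  then interpret null_homothets K lam using assms by unfold_locales
  show "\<exists>x :: nat \<Rightarrow> 'a. covers (\<lambda>i. transl_homothet (x i) (lam i) K) UNIV
      \<and> covering_density (\<lambda>i. transl_homothet (x i) (lam i) K) = 1"
    by (rule covering_density_one)
next
  assume "\<not> bounded (range lam)"
  then show "\<exists>x :: nat \<Rightarrow> 'a. covers (\<lambda>i. transl_homothet (x i) (lam i) K) UNIV
      \<and> (\<forall>p. finite {i. p \<in> transl_homothet (x i) (lam i) K}
           \<and> card {i. p \<in> transl_homothet (x i) (lam i) K} \<le> 4 * DIM('a))"
    using covering_unbounded[of K lam] assms(1,2) by blast
qed

end
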